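(* Let $n,p$ be positive integers with $n-p-1>0$ and $0\le\gamma_i\le p$ for $i=1,\dots,p$. For $N>0$ observe $Y\in\mathbb R^{n\times p}$ with independent entries $Y_{ai}\sim\mathrm N(M_{ai},N^{-1})$. Let $\hat M_{\mathrm{SVS}}$ and $\hat M_{\mathrm{MSVS2}}$ be the generalized Bayes estimators with respect to $\pi_{\mathrm{SVS}}(M)=\det(M^\top M)^{-(n-p-1)/2}$ and $\pi_{\mathrm{MSVS2}}(M)=\pi_{\mathrm{SVS}}(M)\prod_{i=1}^p\|M_{\cdot i}\|^{-\gamma_i}$. Then for every $M$ with $M^\top M$ nonsingular, $$N^2\left(\mathrm E_M[(\hat M_{\mathrm{MSVS2}}-M)^\top(\hat M_{\mathrm{MSVS2}}-M)]-\mathrm E_M[(\hat M_{\mathrm{SVS}}-M)^\top(\hat M_{\mathrm{SVS}}-M)]\right)\to-2(p-1)D+DM^\top MD$$ as $N\to\infty$, where $D=\mathrm{diag}(\gamma_1\|M_{\cdot1}\|^{-2},\dots,\gamma_p\|M_{\cdot p}\|^{-2})$. Consequently, if $p\ge2$ and $0<\gamma_1=\dots=\gamma_p<2-2/p$, then $\hat M_{\mathrm{MSVS2}}$ asymptotically dominates $\hat M_{\mathrm{SVS}}$ under the matrix quadratic loss, i.e., the limit matrix is negative definite for every such $M$.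
   Context: $M_{\cdot i}$ is the $i$-th column of $M$. The generalized Bayes estimator with respect to a nonnegative function $\pi$ with finite marginal $m_\pi(Y)=\int p(Y\mid M)\pi(M)\,\mathrm dM$ is the posterior mean $\int Mp(Y\mid M)\pi(M)\,\mathrm dM/m_\pi(Y)$. The matrix quadratic loss of $\hat M$ is the $p\times p$ matrix $(\hat M-M)^\top(\hat M-M)$. *)

theory Defs
  imports "HOL-Probability.Probability"
begin

text \<open>Matrices in R^{n x p} are rendered as real^'p^'n (rows indexed by 'n, columns by 'p);
  entry M_{ai} is M $ a $ i and the i-th column is column i M.\<close>

definition lik :: "real \<Rightarrow> real^'p^'n \<Rightarrow> real^'p^'n \<Rightarrow> real" where
  "lik N M Y = (\<Prod>a\<in>UNIV. \<Prod>i\<in>UNIV. normal_density (M $ a $ i) (1 / sqrt N) (Y $ a $ i))"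

definition marginal :: "(real^'p^'n \<Rightarrow> real) \<Rightarrow> real \<Rightarrow> real^'p^'n \<Rightarrow> real" where
  "marginal \<pi> N Y = (\<integral>M. lik N M Y * \<pi> M \<partial>lborel)"

definition gen_bayes :: "(real^'p^'n \<Rightarrow> real) \<Rightarrow> real \<Rightarrow> real^'p^'n \<Rightarrow> real^'p^'n" where
  "gen_bayes \<pi> N Y = (1 / marginal \<pi> N Y) *\<^sub>R (\<integral>M. (lik N M Y * \<pi> M) *\<^sub>R M \<partial>lborel)"

definition mat_loss :: "real^'p^'n \<Rightarrow> real^'p^'n \<Rightarrow> real^'p^'p" where
  "mat_loss Mh M = transpose (Mh - M) ** (Mh - M)"

definition mat_risk :: "(real \<Rightarrow> real^'p^'n \<Rightarrow> real^'p^'n) \<Rightarrow> real \<Rightarrow> real^'p^'n \<Rightarrow> real^'p^'p" where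
  "mat_risk est N M = (\<integral>Y. lik N M Y *\<^sub>R mat_loss (est N Y) M \<partial>lborel)"

definition pi_SVS :: "real^'p^'n \<Rightarrow> real" where
  "pi_SVS M = det (transpose M ** M) powr (- (real CARD('n) - real CARD('p) - 1) / 2)"

definition pi_MSVS2 :: "('p \<Rightarrow> real) \<Rightarrow> real^'p^'n \<Rightarrow> real" where
  "pi_MSVS2 \<gamma> M = pi_SVS M * (\<Prod>i\<in>UNIV. norm (column i M) powr (- \<gamma> i))"

definition diagD :: "('p \<Rightarrow> real) \<Rightarrow> real^'p^'n \<Rightarrow> real^'p^'p" where
  "diagD \<gamma> M = (\<chi> i j. if i = j then \<gamma> i / (norm (column i M))\<^sup>2 else 0)"

definition neg_definite :: "real^'p^'p \<Rightarrow> bool" where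
  "neg_definite A \<longleftrightarrow> (\<forall>x. x \<noteq> 0 \<longrightarrow> x \<bullet> (A *v x) < 0)"

end

theory Submission
  imports Defs "HOL-Library.Landau_Symbols"
begin

text \<open>
  Put \<open>s = 1 / sqrt N\<close> and write the data as \<open>M + s Z\<close> with \<open>Z\<close> standard Gaussian. The posterior
  mean is \<open>M + s Z + s\<^sup>2 K\<close>, where \<open>K = E[W \<pi>(M + s (Z + W))] / (s E[\<pi>(M + s (Z + W))])\<close> with
  \<open>W\<close> an independent standard Gaussian. If \<open>ln \<pi>\<close> has gradient \<open>u\<close> and Hessian \<open>H\<close> at \<open>M\<close>, then
  \<open>K = u + s H Z + o(s)\<close>, so \<open>N\<^sup>2\<close> times the excess of the risk over that of the data themselves
  tends to \<open>2 H + u u\<^sup>T\<close> (partially traced over the rows). Only a second order Peano expansion of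
  \<open>\<pi>\<close> at \<open>M\<close> enters. Away from \<open>M\<close> the prior is controlled by a polynomial lower bound and by
  uniform bounds for its Gaussian moments; any power of \<open>s\<close> is gained there, because \<open>|v| \<ge> \<delta>\<close>
  forces \<open>1 \<le> (|v| / \<delta>)\<^sup>j\<close> for \<open>v = s (Z + W)\<close>. The moment bounds hold since the Gram determinant
  factors into squared distances of each column from the span of the others, and a rotated
  distance is bounded below by each of its coordinates.
\<close>

section \<open>The standard Gaussian measure\<close>

text \<open>In the difference of the two risks the Hessian of the SVS prior and the square of its
  gradient cancel, so the determinant enters only through the existence of a second order expansion
  and through its gradient. With k = n - p - 1, the column factor contributes -2(n-2)D through its
  Hessian and D M^T M D through the square of its gradient. The two mixed terms contribute 2kD,
  because the gradient of ln det(M^T M), paired with the columns of M, gives twice the identity. The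
  coefficient -2(p-1) is -2(n-2-k). The obstacle is that the prior is unbounded near rank deficient
  matrices, while the estimator divides by a marginal that can be small for remote data. Dominated
  convergence therefore needs control from both sides: negative powers of s are tolerated in the
  moment bounds, and polynomial decay in the lower bound. Given the other columns, a column carries
  the exponent k on its distance to their span and at most p on its norm. The total k + p = n - 1
  lies just below the dimension n of a column, which is where the restriction on the exponents
  enters.\<close>

lemma nn_integral_lborel_translate:
  fixes f :: "'a::euclidean_space \<Rightarrow> ennreal"
  assumes [measurable]: "f \<in> borel_measurable borel"
  shows "(\<integral>\<^sup>+x. f (c + x) \<partial>lborel) = (\<integral>\<^sup>+x. f x \<partial>lborel)"
  by (subst (2) lborel_distr_plus[symmetric, of c]) (simp add: nn_integral_distr)

text \<open>Comparing with the ball, which is invariant, pins down the constant in the uniqueness of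
  translation invariant measures.\<close>
lemma nn_integral_lborel_orthogonal:
  fixes T :: "'a::euclidean_space \<Rightarrow> 'a" and g :: "'a \<Rightarrow> ennreal"
  assumes T: "orthogonal_transformation T" and g[measurable]: "g \<in> borel_measurable borel"
  shows "(\<integral>\<^sup>+x. g (T x) \<partial>lborel) = (\<integral>\<^sup>+x. g x \<partial>lborel)"
proof -
  define f :: "'a \<Rightarrow> ennreal" where "f = indicator (cball 0 1)"
  have lin: "linear T" using T by (simp add: orthogonal_transformation_linear)
  have Tm[measurable]: "T \<in> borel_measurable borel"
    using lin by (intro borel_measurable_continuous_onI linear_continuous_on)
      (simp add: linear_conv_bounded_linear)
  have fm[measurable]: "f \<in> borel_measurable borel" unfolding f_def by (intro borel_measurable_indicator borel_closed closed_cball)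
  have fT: "f (T x) = f x" for x
    using T by (simp add: f_def orthogonal_transformation_norm indicator_def)
  have fneg: "f (- x) = f x" for x by (simp add: f_def indicator_def)
  define c where "c = (\<integral>\<^sup>+x. f x \<partial>(lborel :: 'a measure))"
  have c: "c = emeasure lborel (cball (0::'a) 1)" unfolding c_def f_def by simp
  have c0: "c \<noteq> 0"
    unfolding c using content_cball_pos[of 1 "0::'a"]
    by (metis measure_eq_emeasure_eq_ennreal ennreal_0 less_numeral_extra(1) measure_def enn2real_0 less_irrefl
        measure_completion sets_lborel borel_closed closed_cball)
  have cfin: "c \<noteq> \<top>" unfolding c using emeasure_lborel_cball_finite[of "0::'a" 1] by (simp add: less_top)
  \<comment> \<open>\<open>c\<close> is also the integral of \<open>f\<close> composed with
    \<open>T\<close>. Shifting \<open>y\<close> by \<open>T x\<close>, swapping the integrals, and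
    shifting \<open>x\<close> by a preimage of \<open>y\<close> moves the dependence on
    \<open>y\<close> into \<open>f\<close>; its integral over \<open>y\<close> is again
    \<open>c\<close>, now multiplying the integral of \<open>g\<close> composed with
    \<open>T\<close>. Cancelling \<open>c\<close> is legitimate because the ball has positive finite
    volume.\<close>
  have "c * (\<integral>\<^sup>+y. g y \<partial>lborel) = (\<integral>\<^sup>+x. f (T x) * (\<integral>\<^sup>+y. g y \<partial>lborel) \<partial>lborel)"
    by (simp add: nn_integral_multc c_def fT)
  also have "\<dots> = (\<integral>\<^sup>+x. (\<integral>\<^sup>+y. f (T x) * g (T x + y) \<partial>lborel) \<partial>lborel)"
    by (simp add: nn_integral_cmult nn_integral_lborel_translate)
  also have "\<dots> = (\<integral>\<^sup>+y. (\<integral>\<^sup>+x. f (T x) * g (T x + y) \<partial>lborel) \<partial>lborel)"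
    by (rule lborel_pair.Fubini') measurable
  also have "\<dots> = (\<integral>\<^sup>+y. (\<integral>\<^sup>+x. f (T x - y) * g (T x) \<partial>lborel) \<partial>lborel)"
  proof (rule nn_integral_cong)
    fix y
    obtain z where z: "T z = y" using T orthogonal_transformation_surj by (metis surj_def)
    have "(\<integral>\<^sup>+x. f (T x) * g (T x + y) \<partial>lborel) = (\<integral>\<^sup>+x. f (T (- z + x)) * g (T (- z + x) + y) \<partial>lborel)"
      by (rule nn_integral_lborel_translate[symmetric]) measurable
    also have "\<dots> = (\<integral>\<^sup>+x. f (T x - y) * g (T x) \<partial>lborel)"
      by (intro nn_integral_cong) (simp add: linear_diff[OF lin] z)
    finally show "(\<integral>\<^sup>+x. f (T x) * g (T x + y) \<partial>lborel) = (\<integral>\<^sup>+x. f (T x - y) * g (T x) \<partial>lborel)" .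
  qed
  also have "\<dots> = (\<integral>\<^sup>+x. (\<integral>\<^sup>+y. f (T x - y) * g (T x) \<partial>lborel) \<partial>lborel)"
    by (rule lborel_pair.Fubini') measurable
  also have "\<dots> = (\<integral>\<^sup>+x. c * g (T x) \<partial>lborel)"
  proof (rule nn_integral_cong)
    fix x
    have "(\<integral>\<^sup>+y. f (T x - y) * g (T x) \<partial>lborel) = (\<integral>\<^sup>+y. f (y - T x) \<partial>lborel) * g (T x)"
      by (subst fneg[symmetric]) (simp add: nn_integral_multc)
    also have "(\<integral>\<^sup>+y. f (y - T x) \<partial>lborel) = c"
      unfolding c_def using nn_integral_lborel_translate[of f "- T x"] by simp
    finally show "(\<integral>\<^sup>+y. f (T x - y) * g (T x) \<partial>lborel) = c * g (T x)" .
  qed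
  also have "\<dots> = c * (\<integral>\<^sup>+x. g (T x) \<partial>lborel)" by (simp add: nn_integral_cmult)
  finally show ?thesis using c0 cfin by (simp add: ennreal_mult_cancel_left)
qed

definition gauss_dens :: "'a::euclidean_space \<Rightarrow> real" where
  "gauss_dens w = (1 / sqrt (2 * pi)) ^ DIM('a) * exp (- (norm w)\<^sup>2 / 2)"

definition gauss :: "'a::euclidean_space measure" where
  "gauss = density lborel (\<lambda>w. ennreal (gauss_dens w))"

lemma gauss_dens_measurable[measurable]: "gauss_dens \<in> borel_measurable borel"
  unfolding gauss_dens_def by measurable

lemma gauss_dens_pos: "0 < gauss_dens w" unfolding gauss_dens_def by simp

lemma gauss_dens_nonneg[simp]: "0 \<le> gauss_dens w" using gauss_dens_pos[of w] by simp

lemma sets_gauss[simp, measurable_cong]: "sets gauss = sets borel" unfolding gauss_def by simp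

lemma space_gauss[simp]: "space gauss = UNIV" unfolding gauss_def by simp

lemma norm_square_eq_sum_inner:
  fixes w :: "'a::euclidean_space"
  shows "(norm w)\<^sup>2 = (\<Sum>b\<in>Basis. (w \<bullet> b)\<^sup>2)"
  unfolding power2_norm_eq_inner by (subst euclidean_inner) (simp add: power2_eq_square)

lemma gauss_dens_prod:
  fixes w :: "'a::euclidean_space"
  shows "gauss_dens w = (\<Prod>b\<in>Basis. std_normal_density (w \<bullet> b))"
proof -
  have "(norm w)\<^sup>2 = (\<Sum>b\<in>Basis. (w \<bullet> b)\<^sup>2)" by (rule norm_square_eq_sum_inner)
  then show ?thesis
    by (simp add: gauss_dens_def std_normal_density_def prod.distrib sum_negf sum_divide_distrib power_divide prod_dividef
        flip: exp_sum)
qed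

lemma nn_integral_gauss:
  "f \<in> borel_measurable borel \<Longrightarrow> (\<integral>\<^sup>+w. f w \<partial>gauss) = (\<integral>\<^sup>+w. ennreal (gauss_dens w) * f w \<partial>lborel)"
  unfolding gauss_def by (subst nn_integral_density) auto

lemma nn_integral_gauss_prod:
  fixes f :: "'a::euclidean_space \<Rightarrow> real \<Rightarrow> real"
  assumes [measurable]: "\<And>b. b \<in> Basis \<Longrightarrow> f b \<in> borel_measurable borel" and "\<And>b x. 0 \<le> f b x"
  shows "(\<integral>\<^sup>+w. ennreal (\<Prod>b\<in>Basis. f b (w \<bullet> b)) \<partial>gauss)
    = (\<Prod>b\<in>Basis. \<integral>\<^sup>+x. ennreal (std_normal_density x * f b x) \<partial>lborel)"
proof -
  have "(\<integral>\<^sup>+w. ennreal (\<Prod>b\<in>Basis. f b (w \<bullet> b)) \<partial>gauss)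
     = (\<integral>\<^sup>+w. (\<Prod>b\<in>Basis. ennreal (std_normal_density (w \<bullet> b) * f b (w \<bullet> b))) \<partial>lborel)"
    using assms(2) by (subst nn_integral_gauss)
      (auto intro!: nn_integral_cong simp: gauss_dens_prod prod_ennreal prod.distrib prod_nonneg ennreal_mult)
  also have "\<dots> = (\<Prod>b\<in>Basis. \<integral>\<^sup>+x. ennreal (std_normal_density x * f b x) \<partial>lborel)"
    by (subst nn_integral_lborel_prod[where f="\<lambda>b x. ennreal (std_normal_density x * f b x)"]) auto
  finally show ?thesis .
qed

lemma nn_integral_std_normal: "(\<integral>\<^sup>+x. ennreal (std_normal_density x) \<partial>lborel) = 1"
  by (subst nn_integral_eq_integral) auto

lemma prob_space_gauss: "prob_space (gauss :: 'a::euclidean_space measure)"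
proof
  have "emeasure (gauss :: 'a measure) (space gauss) = (\<integral>\<^sup>+(w::'a). ennreal (\<Prod>b\<in>(Basis::'a set). 1) \<partial>gauss)" by simp
  also have "\<dots> = 1"
    by (subst nn_integral_gauss_prod[where f="\<lambda>(b::'a) (x::real). 1::real"]) (auto simp: nn_integral_std_normal)
  finally show "emeasure (gauss :: 'a measure) (space gauss) = 1" .
qed

interpretation gauss: prob_space "gauss :: 'a::euclidean_space measure" by (rule prob_space_gauss)

section \<open>Polynomial weights against the Gaussian\<close>

lemma power_mult_exp_neg_square_bound:
  fixes a :: real
  assumes "0 < a"
  obtains C where "0 < C" "\<And>x. 0 \<le> x \<Longrightarrow> (1 + x) ^ q * exp (- a * x\<^sup>2) \<le> C"
proof -
  have "((\<lambda>x. (1 + x) ^ q * exp (- a * x\<^sup>2)) \<longlongrightarrow> 0) at_top"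
  proof -
    have 1: "((\<lambda>x::real. (1 + x) ^ q / exp (1 + x)) \<longlongrightarrow> 0) at_top"
      by (rule filterlim_compose[OF tendsto_power_div_exp_0])
        (rule filterlim_tendsto_add_at_top[OF tendsto_const filterlim_ident])
    have "((\<lambda>x::real. (1 + x) ^ q / exp (1 + x)) \<longlongrightarrow> 0) at_top \<Longrightarrow> ?thesis"
    proof (rule tendsto_sandwich[of "\<lambda>_. 0" _ _ "\<lambda>x. (1 + x) ^ q / exp (1 + x)"])
      show "\<forall>\<^sub>F x in at_top. (1 + x) ^ q * exp (- a * x\<^sup>2) \<le> (1 + x) ^ q / exp (1 + x)"
      \<comment> \<open>Beyond 2 / a one has 2 x \<le> a x^2, and beyond 1 also 1 + x \<le> 2 x, so
        the Gaussian is dominated by exp (- (1 + x)).\<close>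
      proof (rule eventually_at_top_linorderI[of "max 1 (2 / a)"])
        fix x :: real assume x: "max 1 (2 / a) \<le> x"
        then have "2 \<le> a * x" using assms by (simp add: field_simps)
        then have "2 * x \<le> a * x * x" using x by (intro mult_right_mono) auto
        then have "1 + x \<le> a * x\<^sup>2" using x unfolding power2_eq_square max.bounded_iff by linarith
        then show "(1 + x) ^ q * exp (- a * x\<^sup>2) \<le> (1 + x) ^ q / exp (1 + x)"
          using x by (simp add: divide_inverse exp_minus[symmetric])
      qed
    qed (auto intro!: always_eventually eventually_at_top_linorderI[of 0])
    then show ?thesis using 1 by blast
  qed
  then have "\<forall>\<^sub>F x in at_top. (1 + x) ^ q * exp (- a * x\<^sup>2) < 1"
    by (rule order_tendstoD) simp
  then obtain R where R: "\<And>x. R \<le> x \<Longrightarrow> (1 + x) ^ q * exp (- a * x\<^sup>2) < 1"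
    unfolding eventually_at_top_linorder by blast
  have "(1 + x) ^ q * exp (- a * x\<^sup>2) \<le> (1 + \<bar>R\<bar>) ^ q + 1" if "0 \<le> x" for x
  proof (cases "R \<le> x")
    case True
    then show ?thesis using R[OF True] by (smt (verit) zero_le_power)
  next
    case False
    then have "(1 + x) ^ q \<le> (1 + \<bar>R\<bar>) ^ q" using that by (intro power_mono) auto
    moreover have "(1 + x) ^ q * exp (- a * x\<^sup>2) \<le> (1 + x) ^ q * 1"
      using that assms by (intro mult_left_mono) auto
    ultimately show ?thesis by simp
  qed
  then show ?thesis by (intro that[of "(1 + \<bar>R\<bar>) ^ q + 1"]) (auto simp: add_nonneg_pos)
qed

text \<open>Polynomial weights are absorbed by halving the exponent of the Gaussian.\<close>
lemma gauss_dens_poly_bound: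
  obtains C where "0 < C"
    "\<And>w::'a::euclidean_space. gauss_dens w * (1 + norm w) ^ q \<le> C * exp (- (norm w)\<^sup>2 / 4)"
proof -
  obtain C :: real where C: "0 < C" "\<And>x. 0 \<le> x \<Longrightarrow> (1 + x) ^ q * exp (- (1/4) * x\<^sup>2) \<le> C"
    using power_mult_exp_neg_square_bound[of "1/4" q] zero_less_divide_1_iff zero_less_numeral by blast
  let ?c = "(1 / sqrt (2 * pi)) ^ DIM('a)"
  have "gauss_dens w * (1 + norm w) ^ q \<le> (?c * C) * exp (- (norm w)\<^sup>2 / 4)" for w :: 'a
  proof -
    have "exp (- (norm w)\<^sup>2 / 2) = exp (- (1/4) * (norm w)\<^sup>2) * exp (- (norm w)\<^sup>2 / 4)"
      by (simp flip: exp_add)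
    then have "gauss_dens w * (1 + norm w) ^ q
        = ?c * (((1 + norm w) ^ q * exp (- (1/4) * (norm w)\<^sup>2)) * exp (- (norm w)\<^sup>2 / 4))"
      by (simp add: gauss_dens_def)
    also have "\<dots> \<le> ?c * (C * exp (- (norm w)\<^sup>2 / 4))"
      by (intro mult_left_mono mult_right_mono C(2)) auto
    finally show ?thesis by (simp add: mult.assoc)
  qed
  then show ?thesis using C(1) by (intro that[of "?c * C"]) auto
qed

lemma exp_quarter_norm_prod:
  fixes w :: "'a::euclidean_space"
  shows "exp (- (norm w)\<^sup>2 / 4) = (\<Prod>b\<in>Basis. exp (- (w \<bullet> b)\<^sup>2 / 4))"
  by (simp add: norm_square_eq_sum_inner sum_negf sum_divide_distrib flip: exp_sum)

lemma nn_integral_exp_quarter_real: "(\<integral>\<^sup>+x. ennreal (exp (- (x - y)\<^sup>2 / 4)) \<partial>lborel) = ennreal (sqrt (4 * pi))"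
proof -
  have "exp (- (x - y)\<^sup>2 / 4) = sqrt (4 * pi) * normal_density y (sqrt 2) x" for x
    by (simp add: normal_density_def)
  then have "(\<integral>\<^sup>+x. ennreal (exp (- (x - y)\<^sup>2 / 4)) \<partial>lborel)
      = ennreal (sqrt (4 * pi)) * (\<integral>\<^sup>+x. ennreal (normal_density y (sqrt 2) x) \<partial>lborel)"
    by (subst nn_integral_cmult[symmetric]) (auto simp: ennreal_mult)
  also have "(\<integral>\<^sup>+x. ennreal (normal_density y (sqrt 2) x) \<partial>lborel) = 1"
    by (subst nn_integral_eq_integral) auto
  finally show ?thesis by simp
qed

lemma integrable_gauss_poly: "integrable (gauss :: 'a::euclidean_space measure) (\<lambda>w. (1 + norm w) ^ q)"
proof (rule integrableI_nonneg)
  obtain C where C: "0 < C" "\<And>w::'a. gauss_dens w * (1 + norm w) ^ q \<le> C * exp (- (norm w)\<^sup>2 / 4)"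
    using gauss_dens_poly_bound by blast
  have "(\<integral>\<^sup>+(w::'a). ennreal ((1 + norm w) ^ q) \<partial>gauss) = (\<integral>\<^sup>+(w::'a). ennreal (gauss_dens w * (1 + norm w) ^ q) \<partial>lborel)"
    by (subst nn_integral_gauss) (auto simp: ennreal_mult intro!: nn_integral_cong)
  also have "\<dots> \<le> (\<integral>\<^sup>+(w::'a). ennreal C * (\<Prod>b\<in>Basis. ennreal (exp (- (w \<bullet> b)\<^sup>2 / 4))) \<partial>lborel)"
    using C(1) by (intro nn_integral_mono)
      (subst prod_ennreal, auto simp: exp_quarter_norm_prod[simplified, symmetric] ennreal_mult[symmetric]
        intro!: ennreal_leI C(2)[simplified])
  also have "\<dots> = ennreal C * (\<Prod>b\<in>(Basis::'a set). ennreal (sqrt (4 * pi)))"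
    using nn_integral_exp_quarter_real[of 0]
    by (subst nn_integral_cmult, measurable)
      (subst nn_integral_lborel_prod[where f="\<lambda>b x. ennreal (exp (- x\<^sup>2 / 4))"], auto)
  also have "\<dots> < \<infinity>" by (simp add: prod_ennreal ennreal_mult[symmetric] ennreal_mult_less_top del: prod_constant)
  finally show "(\<integral>\<^sup>+(w::'a). ennreal ((1 + norm w) ^ q) \<partial>gauss) < \<infinity>" .
qed auto

lemma integrable_gauss_bounded:
  fixes f :: "'a::euclidean_space \<Rightarrow> 'b::{banach,second_countable_topology}"
  assumes "f \<in> borel_measurable borel" "\<And>w. norm (f w) \<le> C * (1 + norm w) ^ q"
  shows "integrable gauss f"
  by (rule Bochner_Integration.integrable_bound[OF integrable_mult_right[OF integrable_gauss_poly[of q], of C]])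
    (use assms in \<open>auto intro: order_trans[OF _ abs_ge_self]\<close>)

section \<open>Orthogonal invariance and low order moments\<close>

lemma distr_gauss_orthogonal:
  fixes T :: "'a::euclidean_space \<Rightarrow> 'a"
  assumes T: "orthogonal_transformation T"
  shows "distr gauss borel T = gauss"
proof (rule measure_eqI)
  have Tm[measurable]: "T \<in> borel_measurable borel"
    using T by (intro borel_measurable_continuous_onI linear_continuous_on)
      (simp add: linear_conv_bounded_linear[symmetric] orthogonal_transformation_linear)
  fix A assume "A \<in> sets (distr gauss borel T)"
  then have [measurable]: "A \<in> sets borel" by simp
  have "emeasure (distr gauss borel T) A = (\<integral>\<^sup>+x. indicator A (T x) \<partial>gauss)"
    by (subst nn_integral_distr[symmetric, where M'=borel and f="indicator A"]) auto
  also have "\<dots> = (\<integral>\<^sup>+x. ennreal (gauss_dens (T x)) * indicator A (T x) \<partial>lborel)"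
    using T by (subst nn_integral_gauss) (auto simp: gauss_dens_def orthogonal_transformation_norm)
  also have "\<dots> = (\<integral>\<^sup>+x. ennreal (gauss_dens x) * indicator A x \<partial>lborel)"
    by (rule nn_integral_lborel_orthogonal[OF T]) measurable
  also have "\<dots> = emeasure gauss A"
    by (subst nn_integral_gauss[symmetric]) auto
  finally show "emeasure (distr gauss borel T) A = emeasure gauss A" .
qed simp

lemma integral_gauss_orthogonal:
  fixes T :: "'a::euclidean_space \<Rightarrow> 'a" and f :: "'a \<Rightarrow> real"
  assumes T: "orthogonal_transformation T" and [measurable]: "f \<in> borel_measurable borel"
  shows "(\<integral>x. f (T x) \<partial>gauss) = (\<integral>x. f x \<partial>gauss)"
proof -
  have [measurable]: "T \<in> borel_measurable borel"
    using T by (intro borel_measurable_continuous_onI linear_continuous_on)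
      (simp add: linear_conv_bounded_linear[symmetric] orthogonal_transformation_linear)
  show ?thesis
    by (subst (2) distr_gauss_orthogonal[OF T, symmetric]) (simp add: integral_distr)
qed

lemma integral_gauss_odd:
  fixes f :: "'a::euclidean_space \<Rightarrow> real"
  assumes "f \<in> borel_measurable borel" "\<And>w. f (- w) = - f w"
  shows "(\<integral>w. f w \<partial>gauss) = 0"
proof -
  have "orthogonal_transformation (\<lambda>w::'a. - w)"
    by (simp add: orthogonal_transformation_def linear_iff)
  from integral_gauss_orthogonal[OF this assms(1)] show ?thesis
    by (simp add: assms(2))
qed

lemma integral_gauss_square:
  fixes b :: "'a::euclidean_space"
  assumes b: "b \<in> Basis"
  shows "(\<integral>w. (w \<bullet> b)\<^sup>2 \<partial>gauss) = 1"
proof -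
  have "(\<integral>\<^sup>+w. ennreal ((w \<bullet> b)\<^sup>2) \<partial>gauss) = (\<integral>\<^sup>+w. ennreal (\<Prod>c\<in>Basis. if c = b then (w \<bullet> c)\<^sup>2 else 1) \<partial>gauss)"
    using b by (subst prod.delta) auto
  also have "\<dots> = (\<Prod>c\<in>Basis. \<integral>\<^sup>+x. ennreal (std_normal_density x * (if c = b then x\<^sup>2 else 1)) \<partial>lborel)"
    by (subst nn_integral_gauss_prod[where f="\<lambda>c x. if c = b then x\<^sup>2 else 1"]) auto
  also have "\<dots> = (\<Prod>c\<in>(Basis::'a set). 1)"
  proof (rule prod.cong[OF refl])
    fix c :: 'a
    have "has_bochner_integral lborel (\<lambda>x. std_normal_density x * x\<^sup>2) 1"
      using std_normal_moment_even[of 1] by simp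
    then have "(\<integral>\<^sup>+x. ennreal (std_normal_density x * x\<^sup>2) \<partial>lborel) = 1"
      by (subst nn_integral_eq_integral) (auto simp: has_bochner_integral_iff)
    then show "(\<integral>\<^sup>+x. ennreal (std_normal_density x * (if c = b then x\<^sup>2 else 1)) \<partial>lborel) = 1"
      by (cases "c = b") (auto simp: nn_integral_std_normal)
  qed
  finally have "(\<integral>\<^sup>+w. ennreal ((w \<bullet> b)\<^sup>2) \<partial>gauss) = 1" by simp
  then show ?thesis by (subst integral_eq_nn_integral) auto
qed

lemma integrable_gauss_inner_mult:
  "integrable gauss (\<lambda>w::'a::euclidean_space. (w \<bullet> b) * (w \<bullet> c))"
proof (rule integrable_gauss_bounded[where C="norm b * norm c" and q=2])
  fix w :: 'a
  have "\<bar>w \<bullet> b\<bar> * \<bar>w \<bullet> c\<bar> \<le> (norm w * norm b) * (norm w * norm c)"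
    by (intro mult_mono Cauchy_Schwarz_ineq2) auto
  also have "\<dots> \<le> norm b * norm c * (1 + norm w)\<^sup>2"
  proof -
    have "(norm w)\<^sup>2 \<le> (1 + norm w)\<^sup>2" by (intro power_mono) auto
    from mult_left_mono[OF this, of "norm b * norm c"] show ?thesis
      by (simp add: power2_eq_square algebra_simps)
  qed
  finally show "norm ((w \<bullet> b) * (w \<bullet> c)) \<le> norm b * norm c * (1 + norm w)\<^sup>2" by (simp add: abs_mult)
qed simp

lemma integral_gauss_cross:
  fixes b c :: "'a::euclidean_space"
  assumes b: "b \<in> Basis" and c: "c \<in> Basis" and ne: "b \<noteq> c"
  shows "(\<integral>w. (w \<bullet> b) * (w \<bullet> c) \<partial>gauss) = 0"
proof -
  \<comment> \<open>The reflection that reverses \<open>b\<close> and fixes \<open>c\<close> changes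
    the sign of exactly one factor.\<close>
  define T where "T w = w - (2 * (w \<bullet> b)) *\<^sub>R b" for w :: 'a
  have bb: "b \<bullet> b = 1" "b \<bullet> c = 0" using b c ne by (auto simp: inner_Basis)
  have "linear T" unfolding T_def by (rule linearI) (auto simp: algebra_simps)
  moreover have "T v \<bullet> T w = v \<bullet> w" for v w
    by (simp add: T_def inner_diff_left inner_diff_right bb inner_commute algebra_simps)
  ultimately have T: "orthogonal_transformation T" by (simp add: orthogonal_transformation_def)
  have "(\<integral>w. (w \<bullet> b) * (w \<bullet> c) \<partial>gauss) = (\<integral>w. (T w \<bullet> b) * (T w \<bullet> c) \<partial>gauss)"
    by (rule integral_gauss_orthogonal[OF T, symmetric]) measurable
  also have "\<dots> = (\<integral>w. - ((w \<bullet> b) * (w \<bullet> c)) \<partial>gauss)"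
    by (intro Bochner_Integration.integral_cong) (auto simp: T_def inner_diff_left bb)
  finally show ?thesis by simp
qed

text \<open>Since the covariance is the identity, pairing with a coordinate reads off that
  coefficient of a linear form. This is how gradient and Hessian entries are extracted, once inside
  the posterior mean (integration over w) and once in the risk (integration over Z).\<close>

lemma integral_gauss_linear:
  fixes l :: "'a::euclidean_space \<Rightarrow> real"
  assumes l: "linear l" and b: "b \<in> Basis"
  shows "(\<integral>w. (w \<bullet> b) * l w \<partial>gauss) = l b"
proof -
  have "(\<integral>w. (w \<bullet> b) * l w \<partial>gauss) = (\<integral>w. (\<Sum>c\<in>Basis. l c * ((w \<bullet> b) * (w \<bullet> c))) \<partial>gauss)"
  proof (intro Bochner_Integration.integral_cong refl)
    fix w
    have "l w = l (\<Sum>c\<in>Basis. (w \<bullet> c) *\<^sub>R c)" by (simp add: euclidean_representation)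
    also have "\<dots> = (\<Sum>c\<in>Basis. (w \<bullet> c) * l c)"
      by (simp add: linear_sum[OF l] linear_cmul[OF l])
    finally show "(w \<bullet> b) * l w = (\<Sum>c\<in>Basis. l c * ((w \<bullet> b) * (w \<bullet> c)))"
      by (simp add: sum_distrib_left ac_simps)
  qed
  also have "\<dots> = (\<Sum>c\<in>Basis. l c * (\<integral>w. (w \<bullet> b) * (w \<bullet> c) \<partial>gauss))"
    by (subst Bochner_Integration.integral_sum) (auto intro: integrable_gauss_inner_mult)
  also have "\<dots> = (\<Sum>c\<in>Basis. l c * (if c = b then 1 else 0))"
  proof (intro sum.cong refl)
    fix c :: 'a assume "c \<in> Basis"
    then show "l c * (\<integral>w. (w \<bullet> b) * (w \<bullet> c) \<partial>gauss) = l c * (if c = b then 1 else 0)"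
      using integral_gauss_square[OF b] integral_gauss_cross[OF b, of c]
      by (auto simp: power2_eq_square)
  qed
  also have "\<dots> = l b" using b by (subst sum.cong[OF refl, where h="\<lambda>c. if c = b then l c else 0"]) auto
  finally show ?thesis .
qed

section \<open>Second order behaviour of posterior means\<close>

text \<open>\<open>u\<close> and \<open>H\<close> are the gradient and Hessian of ln f:
  exponentiating u . v + H v v / 2 produces the extra term (u . v)^2 / 2. In these data products
  become sums and real powers become scalar multiples. The remainder is of Peano type, so nothing is
  required of \<open>f\<close> away from \<open>M\<close>.\<close>

definition log_taylor2 ::
    "('a::euclidean_space \<Rightarrow> real) \<Rightarrow> 'a \<Rightarrow> 'a \<Rightarrow> ('a \<Rightarrow> 'a \<Rightarrow> real) \<Rightarrow> bool" where
  "log_taylor2 f M u H \<longleftrightarrow> 0 < f M \<and> bilinear H \<and> (\<forall>v w. H v w = H w v) \<and>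
    (\<forall>\<epsilon>>0. \<exists>\<delta>>0. \<forall>v. norm v < \<delta> \<longrightarrow>
      \<bar>f (M + v) - f M * (1 + u \<bullet> v + (H v v + (u \<bullet> v)\<^sup>2) / 2)\<bar> \<le> \<epsilon> * (norm v)\<^sup>2)"

text \<open>Carries Lebesgue null sets over to Gaussians with arbitrary centre and scale; the lower
  bound on the prior is known only off a null set.\<close>

lemma AE_gauss_affine:
  fixes t :: "'a::euclidean_space"
  assumes "AE x in lborel. P x" and c: "c \<noteq> 0"
  shows "AE w in gauss. P (t + c *\<^sub>R w)"
proof -
  have "AE x in density (distr lborel borel (\<lambda>x. t + c *\<^sub>R x)) (\<lambda>_. ennreal (\<bar>c\<bar>^DIM('a))). P x"
    unfolding lborel_affine[OF c, of t, symmetric] by (rule assms(1))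
  then have "AE x in distr lborel borel (\<lambda>x. t + c *\<^sub>R x). P x"
    using c by (subst (asm) AE_density) auto
  then have "AE w in lborel. P (t + c *\<^sub>R w)" by (rule AE_distrD[rotated]) measurable
  then show ?thesis unfolding gauss_def by (subst AE_density) auto
qed

text \<open>The moment bound is uniform in the centre \<open>A\<close> and may blow up as s tends to
  0; the Taylor remainder will gain enough powers of s to pay for this. The lower bound holds almost
  everywhere because \<open>powr\<close> gives the concrete priors the value 0 at singular matrices.
  One exponent \<open>k\<close> serves both conditions; for the concrete priors it is a multiple of
  p, not n - p - 1.\<close>

locale taylor_prior =
  fixes \<pi> :: "'a::euclidean_space \<Rightarrow> real" and M u :: 'a and H :: "'a \<Rightarrow> 'a \<Rightarrow> real" and k :: nat
  assumes prior_measurable[measurable]: "\<pi> \<in> borel_measurable borel"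
    and prior_nonneg: "0 \<le> \<pi> x"
    and prior_moments: "\<And>q. \<exists>C\<ge>0. \<forall>A s. 0 < s \<and> s \<le> 1 \<longrightarrow>
      (\<integral>\<^sup>+w. ennreal ((1 + norm w) ^ q * \<pi> (A + s *\<^sub>R w)) \<partial>gauss) \<le> ennreal (C / s ^ k)"
    and prior_lower: "AE x in lborel. 1 / (1 + norm x) ^ k \<le> \<pi> x"
    and prior_taylor: "log_taylor2 \<pi> M u H"
begin

text \<open>The Hessian of the prior itself, divided by its value at \<open>M\<close>;
  \<open>H\<close> belongs to the logarithm.\<close>

definition Q :: "'a \<Rightarrow> 'a \<Rightarrow> real" where "Q v w = H v w + (u \<bullet> v) * (u \<bullet> w)"

definition rest :: "'a \<Rightarrow> real" where
  "rest v = \<pi> (M + v) - \<pi> M * (1 + u \<bullet> v + Q v v / 2)"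

text \<open>The weight 1 + |w| covers both uses of the remainder: against a coordinate of w in the
  numerator and against 1 in the denominator.\<close>

definition err :: "real \<Rightarrow> 'a \<Rightarrow> real" where
  "err s Z = (\<integral>w. (1 + norm w) * \<bar>rest (s *\<^sub>R (Z + w))\<bar> \<partial>gauss)"

definition num :: "'a \<Rightarrow> real \<Rightarrow> 'a \<Rightarrow> real" where
  "num c s Z = (\<integral>w. (w \<bullet> c) * \<pi> (M + s *\<^sub>R (Z + w)) \<partial>gauss)"

definition den :: "real \<Rightarrow> 'a \<Rightarrow> real" where
  "den s Z = (\<integral>w. \<pi> (M + s *\<^sub>R (Z + w)) \<partial>gauss)"

text \<open>With noise level \<open>s\<close> and data \<open>M + s Z\<close>, the posterior mean is \<open>M + s Z + s\<^sup>2 mean_shift\<close>.\<close>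
definition mean_shift :: "'a \<Rightarrow> real \<Rightarrow> 'a \<Rightarrow> real" where
  "mean_shift c s Z = num c s Z / (s * den s Z)"

text \<open>The shift minus its limit, on the scale s. This is the quantity that carries the Hessian
  into the risk: its limit is linear in Z.\<close>

definition slope :: "'a \<Rightarrow> real \<Rightarrow> 'a \<Rightarrow> real" where
  "slope c s Z = (mean_shift c s Z - u \<bullet> c) / s"

lemma prior_pos: "0 < \<pi> M" and bilinear_H: "bilinear H" and H_commute: "H v w = H w v"
  using prior_taylor unfolding log_taylor2_def by auto

lemma bilinear_Q: "bilinear Q"
  using bilinear_H unfolding bilinear_def Q_def
  by (auto intro!: linearI simp: linear_add linear_cmul linear_add[of "\<lambda>x. H x _"] linear_cmul[of "\<lambda>x. H x _"]
      inner_add_right algebra_simps)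

lemma Q_commute: "Q v w = Q w v" by (simp add: Q_def H_commute)

lemma Q_bound: obtains B where "0 < B" "\<And>v w. \<bar>Q v w\<bar> \<le> B * norm v * norm w"
  using bilinear_bounded_pos[OF bilinear_Q] by auto

lemma linear_Q: "linear (Q v)" "linear (\<lambda>v. Q v w)" using bilinear_Q by (auto simp: bilinear_def)

lemma Q_diag_measurable[measurable]: "(\<lambda>w. Q w w) \<in> borel_measurable borel"
proof -
  have "bounded_bilinear Q" using bilinear_Q bilinear_conv_bounded_bilinear by blast
  then have "continuous_on UNIV (\<lambda>w. Q w w)"
    by (intro bounded_bilinear.continuous_on[of Q] continuous_intros)
  then show ?thesis by (rule borel_measurable_continuous_onI)
qed

lemma Q_left_measurable[measurable]: "(\<lambda>w. Q v w) \<in> borel_measurable borel"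
  using linear_Q(1)[of v] by (intro borel_measurable_continuous_onI linear_continuous_on)
    (simp add: linear_conv_bounded_linear)

lemma rest_measurable[measurable]: "rest \<in> borel_measurable borel"
  unfolding rest_def by measurable

section \<open>Size of the Taylor remainder\<close>

lemma prior_moment:
  obtains C where "0 \<le> C"
    "\<And>A s. 0 < s \<Longrightarrow> s \<le> 1 \<Longrightarrow> integrable gauss (\<lambda>w. (1 + norm w) ^ q * \<pi> (A + s *\<^sub>R w))"
    "\<And>A s. 0 < s \<Longrightarrow> s \<le> 1 \<Longrightarrow> (\<integral>w. (1 + norm w) ^ q * \<pi> (A + s *\<^sub>R w) \<partial>gauss) \<le> C / s ^ k"
proof -
  obtain C where C: "C \<ge> 0" "\<And>A s. 0 < s \<Longrightarrow> s \<le> 1 \<Longrightarrow>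
      (\<integral>\<^sup>+w. ennreal ((1 + norm w) ^ q * \<pi> (A + s *\<^sub>R w)) \<partial>gauss) \<le> ennreal (C / s ^ k)"
    using prior_moments[of q] by blast
  have nn: "0 \<le> (1 + norm w) ^ q * \<pi> (A + s *\<^sub>R w)" for A s w using prior_nonneg by simp
  have I: "integrable gauss (\<lambda>w. (1 + norm w) ^ q * \<pi> (A + s *\<^sub>R w))" if "0 < s" "s \<le> 1" for A s
    by (rule integrableI_nonneg) (use nn C(2)[OF that, of A] in \<open>auto intro: le_less_trans\<close>)
  have "(\<integral>w. (1 + norm w) ^ q * \<pi> (A + s *\<^sub>R w) \<partial>gauss) \<le> C / s ^ k" if "0 < s" "s \<le> 1" for A s
  proof -
    have "ennreal (\<integral>w. (1 + norm w) ^ q * \<pi> (A + s *\<^sub>R w) \<partial>gauss) \<le> ennreal (C / s ^ k)"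
      using C(2)[OF that, of A] nn by (subst nn_integral_eq_integral[symmetric, OF I[OF that]]) auto
    then show ?thesis using that C(1) by (subst (asm) ennreal_le_iff) auto
  qed
  with that C(1) I show ?thesis by blast
qed

text \<open>Near \<open>M\<close> the Peano estimate applies. At distance at least d, the prior and
  the quadratic polynomial are bounded separately and multiplied by powers of |v| / d \<ge> 1. The
  prior gets the power k + 3: its moment bound costs s^-k, and three powers must remain so that the
  error is o(s^2).\<close>

lemma rest_pointwise:
  assumes \<epsilon>: "0 < \<epsilon>"
  obtains C1 C2 where "0 \<le> C1" "0 \<le> C2"
    "\<And>v. \<bar>rest v\<bar> \<le> \<epsilon> * (norm v)\<^sup>2 + C1 * norm v ^ (k + 3) * \<pi> (M + v) + C2 * norm v ^ 3"
proof -
  obtain B where B: "0 < B" "\<And>v w. \<bar>Q v w\<bar> \<le> B * norm v * norm w" using Q_bound by blast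
  obtain d where d: "0 < d" "\<And>v. norm v < d \<Longrightarrow> \<bar>rest v\<bar> \<le> \<epsilon> * (norm v)\<^sup>2"
    using prior_taylor \<epsilon> unfolding log_taylor2_def rest_def Q_def power2_eq_square by meson
  \<comment> \<open>\<open>C2\<close> multiplies the terms of degree 0, 1 and 2 of the polynomial by
    (|v| / d) to the powers 3, 2 and 1, so that all of them become cubic.\<close>
  define C1 where "C1 = 1 / d ^ (k + 3)"
  define C2 where "C2 = \<pi> M * (1 / d ^ 3 + norm u / d ^ 2 + B / d)"
  have p: "0 \<le> \<pi> M" using prior_pos by simp
  have pos: "0 \<le> C1" "0 \<le> C2" unfolding C1_def C2_def using d B(1) p by auto
  have "\<bar>rest v\<bar> \<le> \<epsilon> * (norm v)\<^sup>2 + C1 * norm v ^ (k + 3) * \<pi> (M + v) + C2 * norm v ^ 3" for v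
  proof (cases "norm v < d")
    case True
    have "0 \<le> C1 * norm v ^ (k + 3) * \<pi> (M + v)" "0 \<le> C2 * norm v ^ 3"
      using pos prior_nonneg by auto
    with d(2)[OF True] show ?thesis by linarith
  next
    case False
    then have f: "1 \<le> norm v / d" using d(1) by simp
    define x where "x = norm v / d"
    have x: "1 \<le> x" and nv: "norm v = x * d" using f d(1) by (auto simp: x_def)
    have x1: "1 \<le> x ^ (k + 3)" using x by (rule one_le_power)
    have "C1 * norm v ^ (k + 3) = x ^ (k + 3)" using d(1) by (simp add: C1_def nv power_mult_distrib)
    then have 1: "\<pi> (M + v) \<le> C1 * norm v ^ (k + 3) * \<pi> (M + v)"
      using x1 prior_nonneg[of "M + v"] by (simp add: mult_le_cancel_right1)
    have 2: "\<bar>1 + u \<bullet> v + Q v v / 2\<bar> \<le> 1 + norm u * norm v + B * (norm v)\<^sup>2"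
    proof -
      have "\<bar>u \<bullet> v\<bar> \<le> norm u * norm v" by (rule Cauchy_Schwarz_ineq2)
      moreover have "\<bar>Q v v / 2\<bar> \<le> B * (norm v)\<^sup>2"
        using B(2)[of v v] B(1) by (simp add: power2_eq_square mult.assoc)
      ultimately show ?thesis by linarith
    qed
    have 3: "1 + norm u * norm v + B * (norm v)\<^sup>2 \<le> x ^ 3 + norm u * d * x ^ 3 + B * d\<^sup>2 * x ^ 3"
    proof -
      have "1 \<le> x ^ 3" "x ^ 1 \<le> x ^ 3" "x ^ 2 \<le> x ^ 3" using x power_increasing[of 1 3 x] by (auto intro!: power_increasing one_le_power)
      moreover have "norm u * d * x \<le> norm u * d * x ^ 3" using calculation(2) d(1) by (intro mult_left_mono) auto
      moreover have "B * d\<^sup>2 * x ^ 2 \<le> B * d\<^sup>2 * x ^ 3" using calculation(3) B(1) by (intro mult_left_mono) auto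
      ultimately show ?thesis by (simp add: nv power_mult_distrib algebra_simps)
    qed
    have 4: "\<pi> M * (x ^ 3 + norm u * d * x ^ 3 + B * d\<^sup>2 * x ^ 3) = C2 * norm v ^ 3"
      using d(1) by (simp add: C2_def nv power_mult_distrib field_simps power2_eq_square power3_eq_cube)
    have "\<bar>rest v\<bar> \<le> \<pi> (M + v) + \<pi> M * \<bar>1 + u \<bullet> v + Q v v / 2\<bar>"
      unfolding rest_def using prior_nonneg[of "M + v"] p abs_triangle_ineq4[of "\<pi> (M + v)" "\<pi> M * (1 + u \<bullet> v + Q v v / 2)"]
      by (simp add: abs_mult)
    also have "\<pi> M * \<bar>1 + u \<bullet> v + Q v v / 2\<bar> \<le> C2 * norm v ^ 3"
      unfolding 4[symmetric] using 2 3 p by (intro mult_left_mono) auto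
    finally have "\<bar>rest v\<bar> \<le> C1 * norm v ^ (k + 3) * \<pi> (M + v) + C2 * norm v ^ 3" using 1 by linarith
    moreover have "0 \<le> \<epsilon> * (norm v)\<^sup>2" using \<epsilon> by simp
    ultimately show ?thesis by linarith
  qed
  with that pos show ?thesis by blast
qed

text \<open>The two terms separate the roles: the first is small relative to s^2 by choice of
  \<epsilon>, the second by its additional factor s. Both are polynomial in Z, as the later
  domination requires.\<close>

lemma rest_integrable_err_bound:
  assumes \<epsilon>: "0 < \<epsilon>"
  obtains C where "0 \<le> C"
    "\<And>s Z. 0 < s \<Longrightarrow> s \<le> 1 \<Longrightarrow> integrable gauss (\<lambda>w. (1 + norm w) * \<bar>rest (s *\<^sub>R (Z + w))\<bar>)"
    "\<And>s Z. 0 < s \<Longrightarrow> s \<le> 1 \<Longrightarrow>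
      err s Z \<le> \<epsilon> * s\<^sup>2 * (1 + norm Z)\<^sup>2 + C * s ^ 3 * (1 + norm Z) ^ (k + 3)"
proof -
  define m where "m j = (\<integral>w. (1 + norm (w::'a)) ^ j \<partial>gauss)" for j :: nat
  have m1: "1 \<le> m j" for j
  proof -
    have "(\<integral>w. 1 \<partial>(gauss::'a measure)) \<le> m j" unfolding m_def
      by (intro integral_mono integrable_gauss_poly) (auto intro!: one_le_power)
    then show ?thesis by (simp add: gauss.prob_space[simplified])
  qed
  then have m0: "0 < m j" for j using less_le_trans zero_less_one by blast
  \<comment> \<open>The weight 1 + |w| times |v|^2 integrates to the third moment
    \<open>m 3\<close>; dividing by it in advance keeps the final coefficient equal to
    \<epsilon>.\<close>
  obtain C1 C2 where C12: "0 \<le> C1" "0 \<le> C2"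
    "\<And>v. \<bar>rest v\<bar> \<le> \<epsilon> / m 3 * (norm v)\<^sup>2 + C1 * norm v ^ (k + 3) * \<pi> (M + v) + C2 * norm v ^ 3"
    using rest_pointwise[of "\<epsilon> / m 3"] \<epsilon> m0[of 3] by auto
  \<comment> \<open>k + 3 powers come from \<open>rest_pointwise\<close> and one more from the
    weight 1 + |w|.\<close>
  obtain C3 where C3: "0 \<le> C3"
    "\<And>A s. 0 < s \<Longrightarrow> s \<le> 1 \<Longrightarrow> integrable gauss (\<lambda>w. (1 + norm w) ^ (k + 4) * \<pi> (A + s *\<^sub>R w))"
    "\<And>A s. 0 < s \<Longrightarrow> s \<le> 1 \<Longrightarrow> (\<integral>w. (1 + norm w) ^ (k + 4) * \<pi> (A + s *\<^sub>R w) \<partial>gauss) \<le> C3 / s ^ k"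
    using prior_moment by blast
  have *: "integrable gauss (\<lambda>w. (1 + norm w) * \<bar>rest (s *\<^sub>R (Z + w))\<bar>)
    \<and> err s Z \<le> \<epsilon> * s\<^sup>2 * (1 + norm Z)\<^sup>2 + (C1 * C3 + C2 * m 4) * s ^ 3 * (1 + norm Z) ^ (k + 3)"
    if s: "0 < s" "s \<le> 1" for s Z
  proof -
    define a where "a = 1 + norm Z"
    have a: "1 \<le> a" by (simp add: a_def)
    define g where "g w = \<epsilon> / m 3 * s\<^sup>2 * a\<^sup>2 * (1 + norm w) ^ 3
        + C1 * s ^ (k + 3) * a ^ (k + 3) * ((1 + norm w) ^ (k + 4) * \<pi> ((M + s *\<^sub>R Z) + s *\<^sub>R w))
        + C2 * s ^ 3 * a ^ 3 * (1 + norm w) ^ 4" for w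
    have gi: "integrable gauss g" unfolding g_def
      by (intro Bochner_Integration.integrable_add integrable_mult_right integrable_gauss_poly C3(2) s)
    have le: "(1 + norm w) * \<bar>rest (s *\<^sub>R (Z + w))\<bar> \<le> g w" for w
    proof -
      define b where "b = 1 + norm w"
      have b: "1 \<le> b" by (simp add: b_def)
      define v where "v = s *\<^sub>R (Z + w)"
      have nv: "norm v \<le> s * (a * b)"
      proof -
        \<comment> \<open>A sum is bounded by a product so that powers of the norm of v factor into
          parts depending on s, Z and w alone.\<close>
        have "norm (Z + w) \<le> norm Z + norm w" by (rule norm_triangle_ineq)
        also have "\<dots> \<le> a * b" by (simp add: a_def b_def algebra_simps)
        finally show ?thesis using s by (simp add: v_def)
      qed
      have p: "norm v ^ j \<le> s ^ j * a ^ j * b ^ j" for j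
        using power_mono[OF nv norm_ge_zero, of j] by (simp add: power_mult_distrib)
      have "b * \<bar>rest v\<bar> \<le> b * (\<epsilon> / m 3 * (norm v)\<^sup>2 + C1 * norm v ^ (k + 3) * \<pi> (M + v) + C2 * norm v ^ 3)"
        using b C12(3) by (intro mult_left_mono) auto
      also have "\<dots> \<le> b * (\<epsilon> / m 3 * (s\<^sup>2 * a\<^sup>2 * b\<^sup>2) + C1 * (s ^ (k + 3) * a ^ (k + 3) * b ^ (k + 3)) * \<pi> (M + v)
          + C2 * (s ^ 3 * a ^ 3 * b ^ 3))"
        using b \<epsilon> m0[of 3] C12 prior_nonneg
        by (intro mult_left_mono add_mono mult_right_mono p) auto
      also have "\<dots> = g w"
        by (simp add: g_def b_def[symmetric] v_def scaleR_add_right add.assoc algebra_simps power2_eq_square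
            power3_eq_cube power4_eq_xxxx power_add)
      finally show ?thesis by (simp add: b_def v_def)
    qed
    have I: "integrable gauss (\<lambda>w. (1 + norm w) * \<bar>rest (s *\<^sub>R (Z + w))\<bar>)"
      by (rule Bochner_Integration.integrable_bound[OF gi])
        (auto intro!: AE_I2 order_trans[OF _ abs_ge_self] order_trans[OF _ le] simp: abs_mult)
    have "err s Z \<le> integral\<^sup>L gauss g" unfolding err_def by (intro integral_mono I gi le)
    also have "\<dots> = \<epsilon> / m 3 * s\<^sup>2 * a\<^sup>2 * m 3
        + C1 * s ^ (k + 3) * a ^ (k + 3) * (\<integral>w. (1 + norm w) ^ (k + 4) * \<pi> ((M + s *\<^sub>R Z) + s *\<^sub>R w) \<partial>gauss)
        + C2 * s ^ 3 * a ^ 3 * m 4"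
      unfolding g_def m_def
      by (simp add: integrable_gauss_poly C3(2) s)
    also have "\<dots> \<le> \<epsilon> * s\<^sup>2 * a\<^sup>2 + C1 * s ^ (k + 3) * a ^ (k + 3) * (C3 / s ^ k) + C2 * s ^ 3 * a ^ (k + 3) * m 4"
    proof (intro add_mono mult_left_mono mult_right_mono C3(3) s)
      show "a ^ 3 \<le> a ^ (k + 3)" using a by (intro power_increasing) auto
    qed (use m0[of 3] m0[of 4] C12 s a in auto)
    also have "C1 * s ^ (k + 3) * a ^ (k + 3) * (C3 / s ^ k) = C1 * C3 * s ^ 3 * a ^ (k + 3)"
      using s by (simp add: power_add)
    finally show ?thesis using I by (simp add: a_def algebra_simps)
  qed
  show ?thesis
    by (rule that[of "C1 * C3 + C2 * m 4"]) (use * C12 C3(1) m0[of 4] in auto)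
qed

lemma rest_integrable:
  assumes s: "0 < s" "s \<le> 1"
  shows "integrable gauss (\<lambda>w. (1 + norm w) * \<bar>rest (s *\<^sub>R (Z + w))\<bar>)"
  by (rule rest_integrable_err_bound[OF zero_less_one]) (use s in auto)

lemma err_bound:
  assumes "0 < \<epsilon>"
  obtains C where "0 \<le> C" "\<And>s Z. 0 < s \<Longrightarrow> s \<le> 1 \<Longrightarrow>
      err s Z \<le> \<epsilon> * s\<^sup>2 * (1 + norm Z)\<^sup>2 + C * s ^ 3 * (1 + norm Z) ^ (k + 3)"
proof (rule rest_integrable_err_bound[OF assms])
  fix C assume a: "0 \<le> C"
    and b: "\<And>s Z. 0 < s \<Longrightarrow> s \<le> 1 \<Longrightarrow> err s Z \<le> \<epsilon> * s\<^sup>2 * (1 + norm Z)\<^sup>2 + C * s ^ 3 * (1 + norm Z) ^ (k + 3)"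
  show thesis by (rule that[OF a b])
qed

section \<open>Gaussian integrals of the Taylor polynomial\<close>

lemma prior_poly_integrable:
  "0 < s \<Longrightarrow> s \<le> 1 \<Longrightarrow> integrable gauss (\<lambda>w. (1 + norm w) ^ q * \<pi> (M + s *\<^sub>R (Z + w)))"
  by (rule prior_moment[of q]) (auto simp: scaleR_add_right add.assoc[symmetric])

lemma integrable_gauss_inner: "integrable gauss (\<lambda>w::'a. w \<bullet> c)"
proof (rule integrable_gauss_bounded[where C="norm c" and q=1])
  fix w
  have "\<bar>w \<bullet> c\<bar> \<le> norm w * norm c" by (rule Cauchy_Schwarz_ineq2)
  then show "norm (w \<bullet> c) \<le> norm c * (1 + norm w) ^ 1" using norm_ge_zero[of c] by (simp add: algebra_simps del: norm_ge_zero)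
qed simp

lemma integrable_Q_diag: "integrable gauss (\<lambda>w. Q w w)"
proof -
  obtain B where B: "0 < B" "\<And>v w. \<bar>Q v w\<bar> \<le> B * norm v * norm w" using Q_bound by blast
  show ?thesis
  proof (rule integrable_gauss_bounded[where C=B and q=2])
    fix w :: 'a
    have "norm w * norm w \<le> (1 + norm w) * (1 + norm w)" by (intro mult_mono) auto
    then have "B * (norm w * norm w) \<le> B * ((1 + norm w) * (1 + norm w))" using B(1) by (intro mult_left_mono) auto
    then show "norm (Q w w) \<le> B * (1 + norm w)\<^sup>2"
      using B(2)[of w w] by (simp add: power2_eq_square mult.assoc)
  qed simp
qed

lemma integrable_inner_Q_diag: "c \<in> Basis \<Longrightarrow> integrable gauss (\<lambda>w. (w \<bullet> c) * Q w w)"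
proof -
  assume c: "c \<in> Basis"
  obtain B where B: "0 < B" "\<And>v w. \<bar>Q v w\<bar> \<le> B * norm v * norm w" using Q_bound by blast
  show ?thesis
  proof (rule integrable_gauss_bounded[where C=B and q=3])
    fix w :: 'a
    have "\<bar>w \<bullet> c\<bar> * \<bar>Q w w\<bar> \<le> norm w * (B * norm w * norm w)"
      using Basis_le_norm[OF c] B(2) by (intro mult_mono) auto
    also have "\<dots> = B * norm w ^ 3" by (simp add: power3_eq_cube)
    also have "\<dots> \<le> B * (1 + norm w) ^ 3" using B(1) by (intro mult_left_mono power_mono) auto
    finally show "norm ((w \<bullet> c) * Q w w) \<le> B * (1 + norm w) ^ 3" by (simp add: abs_mult)
  qed simp
qed

lemma integrable_inner_linear:
  assumes l: "linear l" and c: "c \<in> Basis"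
  shows "integrable gauss (\<lambda>w::'a. (w \<bullet> c) * l w)"
proof -
  have lm: "l \<in> borel_measurable borel" using l
    by (intro borel_measurable_continuous_onI linear_continuous_on) (simp add: linear_conv_bounded_linear)
  obtain B where B: "0 < B" "\<And>w. \<bar>l w\<bar> \<le> B * norm w" using linear_bounded_pos[OF l] by auto
  show ?thesis
  proof (rule integrable_gauss_bounded[where C=B and q=2])
    fix w :: 'a
    have "\<bar>w \<bullet> c\<bar> * \<bar>l w\<bar> \<le> norm w * (B * norm w)"
      using Basis_le_norm[OF c] B(2) by (intro mult_mono) auto
    also have "\<dots> = B * norm w ^ 2" by (simp add: power2_eq_square)
    also have "\<dots> \<le> B * (1 + norm w) ^ 2" using B(1) by (intro mult_left_mono power_mono) auto
    finally show "norm ((w \<bullet> c) * l w) \<le> B * (1 + norm w) ^ 2" by (simp add: abs_mult)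
  qed (use lm in measurable)
qed

text \<open>Sorting by degree in w exposes the parity on which the next two integrals rest.\<close>

lemma taylor_poly_expand:
  "1 + u \<bullet> (s *\<^sub>R (Z + w)) + Q (s *\<^sub>R (Z + w)) (s *\<^sub>R (Z + w)) / 2
    = (1 + s * (u \<bullet> Z) + s\<^sup>2 * Q Z Z / 2) + (s * (u \<bullet> w) + s\<^sup>2 * Q Z w) + s\<^sup>2 / 2 * Q w w"
proof -
  have "Q (Z + w) (Z + w) = Q Z Z + 2 * Q Z w + Q w w"
    by (simp add: linear_add[OF linear_Q(1)] linear_add[OF linear_Q(2)] Q_commute[of w Z])
  moreover have "Q (s *\<^sub>R (Z + w)) (s *\<^sub>R (Z + w)) = s\<^sup>2 * Q (Z + w) (Z + w)"
    unfolding linear_cmul[OF linear_Q(1)] linear_cmul[OF linear_Q(2)] by (simp add: power2_eq_square)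
  ultimately show ?thesis by (simp only: inner_scaleR_right inner_add_right) (simp add: algebra_simps add_divide_distrib)
qed

text \<open>Multiplied by a coordinate, the constant and quadratic parts are odd and integrate to 0;
  the linear part is read off at \<open>c\<close>.\<close>

lemma has_integral_num_poly:
  assumes c: "c \<in> Basis"
  shows "has_bochner_integral gauss (\<lambda>w. (w \<bullet> c) *
    (1 + u \<bullet> (s *\<^sub>R (Z + w)) + Q (s *\<^sub>R (Z + w)) (s *\<^sub>R (Z + w)) / 2)) (s * (u \<bullet> c) + s\<^sup>2 * Q Z c)"
proof -
  let ?l = "\<lambda>w. s * (u \<bullet> w) + s\<^sup>2 * Q Z w"
  have l: "linear ?l"
    by (rule linearI) (auto simp: inner_add_right linear_add[OF linear_Q(1)] linear_cmul[OF linear_Q(1)] algebra_simps)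
  have "has_bochner_integral gauss (\<lambda>w. (1 + s * (u \<bullet> Z) + s\<^sup>2 * Q Z Z / 2) * (w \<bullet> c) + (w \<bullet> c) * ?l w
      + s\<^sup>2 / 2 * ((w \<bullet> c) * Q w w))
     ((1 + s * (u \<bullet> Z) + s\<^sup>2 * Q Z Z / 2) * 0 + ?l c + s\<^sup>2 / 2 * 0)"
  proof (intro has_bochner_integral_add has_bochner_integral_mult_right)
    show "has_bochner_integral gauss (\<lambda>w. w \<bullet> c) 0"
      using integral_gauss_odd[of "\<lambda>w. w \<bullet> c"] by (simp add: has_bochner_integral_iff integrable_gauss_inner)
    show "has_bochner_integral gauss (\<lambda>w. (w \<bullet> c) * ?l w) (?l c)"
      using integral_gauss_linear[OF l c] integrable_inner_linear[OF l c] by (simp add: has_bochner_integral_iff)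
    show "has_bochner_integral gauss (\<lambda>w. (w \<bullet> c) * Q w w) 0"
      using integral_gauss_odd[of "\<lambda>w. (w \<bullet> c) * Q w w"] integrable_inner_Q_diag[OF c]
      by (simp add: has_bochner_integral_iff linear_neg[OF linear_Q(1)] linear_neg[OF linear_Q(2)])
  qed
  then show ?thesis unfolding taylor_poly_expand by (simp add: algebra_simps)
qed

text \<open>Here the linear part is the odd one. The trace of \<open>Q\<close> stays an unevaluated
  integral, since it reaches \<open>slope\<close> only with an additional factor s.\<close>

lemma has_integral_den_poly:
  "has_bochner_integral gauss (\<lambda>w. 1 + u \<bullet> (s *\<^sub>R (Z + w)) + Q (s *\<^sub>R (Z + w)) (s *\<^sub>R (Z + w)) / 2)
    (1 + s * (u \<bullet> Z) + s\<^sup>2 * (Q Z Z + (\<integral>w. Q w w \<partial>gauss)) / 2)"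
proof -
  let ?l = "\<lambda>w. s * (u \<bullet> w) + s\<^sup>2 * Q Z w"
  have l: "linear ?l"
    by (rule linearI) (auto simp: inner_add_right linear_add[OF linear_Q(1)] linear_cmul[OF linear_Q(1)] algebra_simps)
  then have "integrable gauss ?l"
  proof -
    obtain B where B: "0 < B" "\<And>w. \<bar>?l w\<bar> \<le> B * norm w" using linear_bounded_pos[OF l] by auto
    show ?thesis
      by (rule integrable_gauss_bounded[where C=B and q=1])
        (use B in \<open>auto intro: order_trans simp: distrib_left add_increasing\<close>)
  qed
  then have 1: "has_bochner_integral gauss ?l 0"
    using integral_gauss_odd[of ?l] linear_neg[OF l] by (simp add: has_bochner_integral_iff)
  have "has_bochner_integral gauss (\<lambda>w. (1 + s * (u \<bullet> Z) + s\<^sup>2 * Q Z Z / 2) + ?l w + s\<^sup>2 / 2 * Q w w)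
     ((1 + s * (u \<bullet> Z) + s\<^sup>2 * Q Z Z / 2) + 0 + s\<^sup>2 / 2 * (\<integral>w. Q w w \<partial>gauss))"
    by (intro has_bochner_integral_add has_bochner_integral_mult_right 1)
      (auto simp: has_bochner_integral_iff integrable_Q_diag gauss.prob_space[simplified])
  then show ?thesis unfolding taylor_poly_expand by (simp add: algebra_simps add_divide_distrib)
qed

section \<open>Expansion and lower bound of numerator and denominator\<close>

lemma num_expand:
  assumes s: "0 < s" "s \<le> 1" and c: "c \<in> Basis"
  shows "\<bar>num c s Z - \<pi> M * (s * (u \<bullet> c) + s\<^sup>2 * Q Z c)\<bar> \<le> err s Z"
proof -
  let ?P = "\<lambda>w. 1 + u \<bullet> (s *\<^sub>R (Z + w)) + Q (s *\<^sub>R (Z + w)) (s *\<^sub>R (Z + w)) / 2"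
  have i1: "integrable gauss (\<lambda>w. (w \<bullet> c) * rest (s *\<^sub>R (Z + w)))"
    by (rule Bochner_Integration.integrable_bound[OF rest_integrable[OF s, of Z]])
      (auto intro!: AE_I2 mult_mono simp: abs_mult intro: order_trans[OF Basis_le_norm[OF c]])
  have "num c s Z = (\<integral>w. \<pi> M * ((w \<bullet> c) * ?P w) + (w \<bullet> c) * rest (s *\<^sub>R (Z + w)) \<partial>gauss)"
    unfolding num_def rest_def by (intro Bochner_Integration.integral_cong) (auto simp: algebra_simps)
  also have "\<dots> = \<pi> M * (s * (u \<bullet> c) + s\<^sup>2 * Q Z c) + (\<integral>w. (w \<bullet> c) * rest (s *\<^sub>R (Z + w)) \<partial>gauss)"
    using has_integral_num_poly[OF c, of s Z] i1 by (simp add: has_bochner_integral_iff)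
  finally have "\<bar>num c s Z - \<pi> M * (s * (u \<bullet> c) + s\<^sup>2 * Q Z c)\<bar> = \<bar>\<integral>w. (w \<bullet> c) * rest (s *\<^sub>R (Z + w)) \<partial>gauss\<bar>"
    by simp
  also have "\<dots> \<le> (\<integral>w. \<bar>(w \<bullet> c) * rest (s *\<^sub>R (Z + w))\<bar> \<partial>gauss)" by (rule integral_abs_bound)
  also have "\<dots> \<le> err s Z" unfolding err_def
    by (intro integral_mono rest_integrable s integrable_abs i1)
      (auto simp: abs_mult intro!: mult_right_mono intro: order_trans[OF Basis_le_norm[OF c]])
  finally show ?thesis .
qed

lemma den_expand:
  assumes s: "0 < s" "s \<le> 1"
  shows "\<bar>den s Z - \<pi> M * (1 + s * (u \<bullet> Z) + s\<^sup>2 * (Q Z Z + (\<integral>w. Q w w \<partial>gauss)) / 2)\<bar> \<le> err s Z"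
proof -
  let ?P = "\<lambda>w. 1 + u \<bullet> (s *\<^sub>R (Z + w)) + Q (s *\<^sub>R (Z + w)) (s *\<^sub>R (Z + w)) / 2"
  have i1: "integrable gauss (\<lambda>w. rest (s *\<^sub>R (Z + w)))"
    by (rule Bochner_Integration.integrable_bound[OF rest_integrable[OF s, of Z]])
      (auto intro!: AE_I2 simp: abs_mult mult_le_cancel_right1)
  have "den s Z = (\<integral>w. \<pi> M * ?P w + rest (s *\<^sub>R (Z + w)) \<partial>gauss)"
    unfolding den_def rest_def by (intro Bochner_Integration.integral_cong) (auto simp: algebra_simps)
  also have "\<dots> = \<pi> M * (1 + s * (u \<bullet> Z) + s\<^sup>2 * (Q Z Z + (\<integral>w. Q w w \<partial>gauss)) / 2)
      + (\<integral>w. rest (s *\<^sub>R (Z + w)) \<partial>gauss)"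
    using has_integral_den_poly[of s Z] i1 by (simp add: has_bochner_integral_iff)
  finally have "\<bar>den s Z - \<pi> M * (1 + s * (u \<bullet> Z) + s\<^sup>2 * (Q Z Z + (\<integral>w. Q w w \<partial>gauss)) / 2)\<bar>
      = \<bar>\<integral>w. rest (s *\<^sub>R (Z + w)) \<partial>gauss\<bar>"
    by simp
  also have "\<dots> \<le> (\<integral>w. \<bar>rest (s *\<^sub>R (Z + w))\<bar> \<partial>gauss)" by (rule integral_abs_bound)
  also have "\<dots> \<le> err s Z" unfolding err_def
    by (intro integral_mono rest_integrable s integrable_abs i1) (auto simp: mult_le_cancel_right1)
  finally show ?thesis .
qed

text \<open>1 + |M + s (Z + w)| is at most the product of 1 + |M|, 1 + |Z| and 1 + |w|, so the lower
  bound on the prior splits and only the expectation of (1 + |W|)^-k remains. Division by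
  \<open>den\<close> thus costs merely polynomial growth in Z.\<close>

lemma den_lower:
  obtains c where "0 < c" "\<And>s Z. 0 < s \<Longrightarrow> s \<le> 1 \<Longrightarrow> c / (1 + norm Z) ^ k \<le> den s Z"
proof -
  define e where "e = (\<integral>w. 1 / (1 + norm (w::'a)) ^ k \<partial>gauss)"
  have ei: "integrable gauss (\<lambda>w::'a. 1 / (1 + norm w) ^ k)"
  proof (rule integrable_gauss_bounded[where C=1 and q=0])
    fix w :: 'a
    have "1 \<le> (1 + norm w) ^ k" by (rule one_le_power) simp
    then show "norm (1 / (1 + norm w) ^ k) \<le> 1 * (1 + norm w) ^ 0"
      by (subst norm_divide) (simp add: divide_le_eq_1_pos[OF less_le_trans[OF zero_less_one]])
  qed simp
  have pos: "0 < 1 / (1 + norm (w::'a)) ^ k" for w by (simp add: add_pos_nonneg)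
  have "e \<noteq> 0"
  proof
    assume "e = 0"
    then have "AE w::'a in gauss. 1 / (1 + norm w) ^ k = 0"
      unfolding e_def using pos by (subst (asm) integral_nonneg_eq_0_iff_AE[OF ei]) (auto intro: less_imp_le)
    then have "AE w::'a in gauss. False"
    proof (rule eventually_mono)
      fix w :: 'a assume "1 / (1 + norm w) ^ k = 0"
      then show False using pos[of w] by (simp only: less_irrefl)
    qed
    then show False by (simp add: gauss.AE_False)
  qed
  moreover have "0 \<le> e" unfolding e_def by (intro Bochner_Integration.integral_nonneg) (simp add: less_imp_le[OF pos])
  ultimately have e: "0 < e" by simp
  have "e / (1 + norm M) ^ k / (1 + norm Z) ^ k \<le> den s Z" if s: "0 < s" "s \<le> 1" for s Z
  proof -
    let ?a = "(1 + norm M) ^ k * (1 + norm Z) ^ k"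
    have pa: "0 < ?a" by (intro mult_pos_pos zero_less_power) (auto simp: add_pos_nonneg)
    have AE: "AE w in gauss. 1 / ?a * (1 / (1 + norm w) ^ k) \<le> \<pi> (M + s *\<^sub>R (Z + w))"
    proof -
      have "AE w in gauss. 1 / (1 + norm ((M + s *\<^sub>R Z) + s *\<^sub>R w)) ^ k \<le> \<pi> ((M + s *\<^sub>R Z) + s *\<^sub>R w)"
        using s by (intro AE_gauss_affine prior_lower) auto
      then show ?thesis
      proof (rule eventually_mono)
        fix w assume w: "1 / (1 + norm ((M + s *\<^sub>R Z) + s *\<^sub>R w)) ^ k \<le> \<pi> ((M + s *\<^sub>R Z) + s *\<^sub>R w)"
        have "norm ((M + s *\<^sub>R Z) + s *\<^sub>R w) \<le> norm M + s * norm Z + s * norm w"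
          using norm_triangle_ineq[of "M + s *\<^sub>R Z" "s *\<^sub>R w"] norm_triangle_ineq[of M "s *\<^sub>R Z"] s by simp
        also have "\<dots> \<le> norm M + norm Z + norm w"
          using s by (intro add_mono mult_left_le_one_le) auto
        finally have "1 + norm ((M + s *\<^sub>R Z) + s *\<^sub>R w)
          \<le> (1 + norm M + norm Z + norm w) + (norm M * norm Z + norm M * norm w + norm Z * norm w + norm M * norm Z * norm w)"
          by (simp add: add_increasing2)
        also have "\<dots> = (1 + norm M) * (1 + norm Z) * (1 + norm w)" by (simp add: algebra_simps)
        finally have "1 + norm ((M + s *\<^sub>R Z) + s *\<^sub>R w) \<le> (1 + norm M) * (1 + norm Z) * (1 + norm w)" .
        then have "(1 + norm ((M + s *\<^sub>R Z) + s *\<^sub>R w)) ^ k \<le> ((1 + norm M) * (1 + norm Z) * (1 + norm w)) ^ k"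
          by (intro power_mono) auto
        then have "1 / ((1 + norm M) * (1 + norm Z) * (1 + norm w)) ^ k \<le> 1 / (1 + norm ((M + s *\<^sub>R Z) + s *\<^sub>R w)) ^ k"
          by (intro divide_left_mono mult_pos_pos zero_less_power) (auto simp: add_pos_nonneg)
        then show "1 / ?a * (1 / (1 + norm w) ^ k) \<le> \<pi> (M + s *\<^sub>R (Z + w))"
          using w by (simp add: power_mult_distrib scaleR_add_right add.assoc)
      qed
    qed
    have "1 / ?a * e = (\<integral>w. 1 / ?a * (1 / (1 + norm (w::'a)) ^ k) \<partial>gauss)"
      unfolding e_def by (rule Bochner_Integration.integral_mult_right[symmetric]) (rule ei)
    also have "\<dots> \<le> den s Z" unfolding den_def
      using prior_poly_integrable[OF s, of 0 Z]
      by (intro integral_mono_AE integrable_mult_right ei AE) auto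
    finally show ?thesis by simp
  qed
  moreover have "0 < e / (1 + norm M) ^ k" using e by (simp add: add_pos_nonneg)
  ultimately show ?thesis using that by blast
qed

lemma den_pos: "0 < s \<Longrightarrow> s \<le> 1 \<Longrightarrow> 0 < den s Z"
proof -
  assume s: "0 < s" "s \<le> 1"
  obtain c where "0 < c" "\<And>s Z. 0 < s \<Longrightarrow> s \<le> 1 \<Longrightarrow> c / (1 + norm Z) ^ k \<le> den s Z"
    using den_lower by blast
  moreover have "0 < c / (1 + norm Z) ^ k" using calculation by (simp add: add_pos_nonneg)
  ultimately show ?thesis using s by (meson less_le_trans)
qed

text \<open>The form in which the quotient rule delivers the limit: the second derivative of the
  prior minus the product of first derivatives, all relative to its value at
  \<open>M\<close>.\<close>

definition limit_slope :: "'a \<Rightarrow> 'a \<Rightarrow> real" where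
  "limit_slope c Z = Q Z c - (u \<bullet> c) * (u \<bullet> Z)"

lemma limit_slope_eq: "limit_slope c Z = H Z c" by (simp add: limit_slope_def Q_def)

text \<open>Multiplying by \<open>den\<close> leaves a combination of \<open>num\<close> and
  \<open>den\<close> in which the terms of order s cancel. After division by s^2 the leading term is
  the limit; the rest is of order s or controlled by \<open>err\<close>.\<close>

lemma slope_numerator:
  assumes s: "0 < s" "s \<le> 1" and c: "c \<in> Basis"
  shows "\<bar>slope c s Z * den s Z - \<pi> M * limit_slope c Z\<bar>
    \<le> \<pi> M * \<bar>u \<bullet> c\<bar> * \<bar>Q Z Z + (\<integral>w. Q w w \<partial>gauss)\<bar> * s + (1 + \<bar>u \<bullet> c\<bar>) * (err s Z / s\<^sup>2)"
proof -
  define q where "q = Q Z Z + (\<integral>w. Q w w \<partial>gauss)"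
  define R1 where "R1 = num c s Z - \<pi> M * (s * (u \<bullet> c) + s\<^sup>2 * Q Z c)"
  define R2 where "R2 = den s Z - \<pi> M * (1 + s * (u \<bullet> Z) + s\<^sup>2 * q / 2)"
  have R: "\<bar>R1\<bar> \<le> err s Z" "\<bar>R2\<bar> \<le> err s Z"
    unfolding R1_def R2_def q_def using num_expand[OF s c] den_expand[OF s] by auto
  have D: "0 < den s Z" using s by (rule den_pos)
  have "slope c s Z * den s Z = (num c s Z - s * (u \<bullet> c) * den s Z) / s\<^sup>2"
    using s D by (simp add: slope_def mean_shift_def field_simps power2_eq_square)
  also have "num c s Z - s * (u \<bullet> c) * den s Z = (\<pi> M * (s * (u \<bullet> c) + s\<^sup>2 * Q Z c) + R1)
       - s * (u \<bullet> c) * (\<pi> M * (1 + s * (u \<bullet> Z) + s\<^sup>2 * q / 2) + R2)" by (simp add: R1_def R2_def)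
  also have "\<dots> / s\<^sup>2
     = \<pi> M * limit_slope c Z - \<pi> M * (u \<bullet> c) * q * s / 2 + (R1 / s\<^sup>2 - (u \<bullet> c) * (s * R2 / s\<^sup>2))"
    using s by (simp add: limit_slope_def field_simps power2_eq_square)
  finally have eq: "slope c s Z * den s Z - \<pi> M * limit_slope c Z
     = - (\<pi> M * (u \<bullet> c) * q * s / 2) + (R1 / s\<^sup>2 - (u \<bullet> c) * (s * R2 / s\<^sup>2))" by simp
  have 1: "\<bar>\<pi> M * (u \<bullet> c) * q * s / 2\<bar> \<le> \<pi> M * \<bar>u \<bullet> c\<bar> * \<bar>q\<bar> * s"
    using s prior_pos by (simp add: abs_mult)
  have 2: "\<bar>R1 / s\<^sup>2\<bar> \<le> err s Z / s\<^sup>2" using R s by (simp add: divide_right_mono)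
  have "s * \<bar>R2\<bar> \<le> 1 * err s Z" using R s by (intro mult_mono) auto
  then have "\<bar>s * R2 / s\<^sup>2\<bar> \<le> err s Z / s\<^sup>2" using s by (simp add: divide_right_mono abs_mult)
  then have 3: "\<bar>(u \<bullet> c) * (s * R2 / s\<^sup>2)\<bar> \<le> \<bar>u \<bullet> c\<bar> * (err s Z / s\<^sup>2)"
    unfolding abs_mult[of "u \<bullet> c"] by (intro mult_left_mono) auto
  show ?thesis unfolding eq q_def[symmetric] distrib_right[of 1] mult_1 using 1 2 3 by linarith
qed

lemma err_tendsto: "((\<lambda>s. err s Z / s\<^sup>2) \<longlongrightarrow> 0) (at_right 0)"
proof (rule tendstoI)
  fix e :: real assume e: "0 < e"
  define a where "a = 1 + norm Z"
  have a: "1 \<le> a" by (simp add: a_def)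
  \<comment> \<open>With this choice the first term of \<open>err_bound\<close>, divided by s^2,
    equals e / 2.\<close>
  have "0 < e / (2 * a\<^sup>2)" using e a by simp
  from err_bound[OF this] obtain C where C': "0 \<le> C" "\<And>s Z. 0 < s \<Longrightarrow> s \<le> 1 \<Longrightarrow>
      err s Z \<le> e / (2 * a\<^sup>2) * s\<^sup>2 * (1 + norm Z)\<^sup>2 + C * s ^ 3 * (1 + norm Z) ^ (k + 3)"
    by blast
  note C = C'(1) C'(2)[of _ Z, folded a_def]
  have "((\<lambda>s. C * s * a ^ (k + 3)) \<longlongrightarrow> C * 0 * a ^ (k + 3)) (at_right 0)" by (intro tendsto_intros)
  then have "\<forall>\<^sub>F s in at_right 0. C * s * a ^ (k + 3) < e / 2"
    using e by (intro order_tendstoD) auto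
  moreover have "\<forall>\<^sub>F s in at_right (0::real). 0 < s \<and> s < 1"
    by (auto simp: eventually_at_right_field intro!: exI[of _ 1])
  ultimately show "\<forall>\<^sub>F s in at_right 0. dist (err s Z / s\<^sup>2) 0 < e"
  proof eventually_elim
    case (elim s)
    have "0 \<le> err s Z" unfolding err_def by (intro Bochner_Integration.integral_nonneg) auto
    moreover have "err s Z / s\<^sup>2 \<le> (e / (2 * a\<^sup>2) * s\<^sup>2 * a\<^sup>2 + C * s ^ 3 * a ^ (k + 3)) / s\<^sup>2"
      using C(2)[of s] elim by (intro divide_right_mono) auto
    moreover have "\<dots> = e / 2 + C * s * a ^ (k + 3)"
      using elim a by (simp add: field_simps power2_eq_square power3_eq_cube)
    ultimately show ?case using elim by simp
  qed
qed

lemma s_small: "\<forall>\<^sub>F s in at_right (0::real). 0 < s \<and> s \<le> 1"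
  by (auto simp: eventually_at_right_field intro!: exI[of _ 1])

lemma den_tendsto: "((\<lambda>s. den s Z) \<longlongrightarrow> \<pi> M) (at_right 0)"
proof -
  let ?p = "\<lambda>s. \<pi> M * (1 + s * (u \<bullet> Z) + s\<^sup>2 * (Q Z Z + (\<integral>w. Q w w \<partial>gauss)) / 2)"
  have e: "((\<lambda>s. err s Z / s\<^sup>2 * s\<^sup>2) \<longlongrightarrow> 0 * 0\<^sup>2) (at_right 0)"
    by (intro tendsto_intros err_tendsto)
  have "((\<lambda>s. den s Z - ?p s) \<longlongrightarrow> 0) (at_right 0)"
  proof (rule Lim_null_comparison)
    show "\<forall>\<^sub>F s in at_right 0. norm (den s Z - ?p s) \<le> err s Z / s\<^sup>2 * s\<^sup>2"
      using s_small by eventually_elim (use den_expand in auto)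
  qed (use e in simp)
  moreover have "(?p \<longlongrightarrow> \<pi> M * (1 + 0 * (u \<bullet> Z) + 0\<^sup>2 * (Q Z Z + (\<integral>w. Q w w \<partial>gauss)) / 2)) (at_right 0)"
    by (intro tendsto_intros) auto
  ultimately have "((\<lambda>s. (den s Z - ?p s) + ?p s) \<longlongrightarrow> 0 + \<pi> M) (at_right 0)"
    by (intro tendsto_add) auto
  then show ?thesis by simp
qed

lemma slope_tendsto:
  assumes c: "c \<in> Basis"
  shows "((\<lambda>s. slope c s Z) \<longlongrightarrow> limit_slope c Z) (at_right 0)"
proof -
  let ?K = "\<pi> M * \<bar>u \<bullet> c\<bar> * \<bar>Q Z Z + (\<integral>w. Q w w \<partial>gauss)\<bar>"
  have e: "((\<lambda>s. ?K * s + (1 + \<bar>u \<bullet> c\<bar>) * (err s Z / s\<^sup>2)) \<longlongrightarrow> ?K * 0 + (1 + \<bar>u \<bullet> c\<bar>) * 0) (at_right 0)"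
    by (intro tendsto_intros err_tendsto)
  have "((\<lambda>s. slope c s Z * den s Z - \<pi> M * limit_slope c Z) \<longlongrightarrow> 0) (at_right 0)"
  proof (rule Lim_null_comparison)
    show "\<forall>\<^sub>F s in at_right 0. norm (slope c s Z * den s Z - \<pi> M * limit_slope c Z)
        \<le> ?K * s + (1 + \<bar>u \<bullet> c\<bar>) * (err s Z / s\<^sup>2)"
      using s_small by eventually_elim (use slope_numerator c in auto)
  qed (use e in simp)
  then have "((\<lambda>s. slope c s Z * den s Z) \<longlongrightarrow> \<pi> M * limit_slope c Z) (at_right 0)"
    using LIM_zero_iff by blast
  then have "((\<lambda>s. slope c s Z * den s Z / den s Z) \<longlongrightarrow> \<pi> M * limit_slope c Z / \<pi> M) (at_right 0)"
    using prior_pos by (intro tendsto_divide den_tendsto) auto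
  moreover have "\<forall>\<^sub>F s in at_right 0. slope c s Z * den s Z / den s Z = slope c s Z"
    using s_small by eventually_elim (use den_pos[of _ Z] in \<open>auto simp: less_imp_neq[symmetric]\<close>)
  ultimately show ?thesis using prior_pos by (simp add: filterlim_cong)
qed

text \<open>Supplies the dominating function for all limits under the integral. The degree is k + 3
  from the remainder plus k from dividing by \<open>den\<close>.\<close>

lemma slope_bound:
  obtains C where "0 \<le> C"
    "\<And>c s Z. c \<in> Basis \<Longrightarrow> 0 < s \<Longrightarrow> s \<le> 1 \<Longrightarrow> \<bar>slope c s Z\<bar> \<le> C * (1 + norm Z) ^ (2 * k + 3)"
proof -
  define U where "U = norm u"
  define T where "T = \<bar>\<integral>w. Q w w \<partial>gauss\<bar>"
  obtain B where B: "0 < B" "\<And>v w. \<bar>Q v w\<bar> \<le> B * norm v * norm w" using Q_bound by blast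
  obtain C1 where C1: "0 \<le> C1" "\<And>s Z. 0 < s \<Longrightarrow> s \<le> 1 \<Longrightarrow>
      err s Z \<le> 1 * s\<^sup>2 * (1 + norm Z)\<^sup>2 + C1 * s ^ 3 * (1 + norm Z) ^ (k + 3)"
    using err_bound[OF zero_less_one] by blast
  obtain c0 where c0: "0 < c0" "\<And>s Z. 0 < s \<Longrightarrow> s \<le> 1 \<Longrightarrow> c0 / (1 + norm Z) ^ k \<le> den s Z"
    using den_lower by blast
  define C where "C = \<pi> M * (B + U * U) + \<pi> M * U * (B + T) + (1 + U) * (1 + C1)"
  have p: "0 \<le> \<pi> M" using prior_pos by simp
  have nonneg: "0 \<le> U" "0 \<le> T" by (auto simp: U_def T_def)
  have C: "0 \<le> C" unfolding C_def using p nonneg B(1) C1(1) by auto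
  have "\<bar>slope c s Z\<bar> \<le> C / c0 * (1 + norm Z) ^ (2 * k + 3)"
    if c: "c \<in> Basis" and s: "0 < s" "s \<le> 1" for c s Z
  proof -
    define a where "a = 1 + norm Z"
    have a: "1 \<le> a" and Za: "norm Z \<le> a" by (auto simp: a_def)
    have pw: "a ^ j \<le> a ^ (k + 3)" if "j \<le> k + 3" for j using a that by (intro power_increasing) auto
    have pw1: "a \<le> a ^ (k + 3)" "1 \<le> a ^ (k + 3)" "a\<^sup>2 \<le> a ^ (k + 3)" using pw[of 1] pw[of 0] pw[of 2] by auto
    have uc: "\<bar>u \<bullet> c\<bar> \<le> U" unfolding U_def using Basis_le_norm[OF c] .
    have uZ: "\<bar>u \<bullet> Z\<bar> \<le> U * a"
      using Cauchy_Schwarz_ineq2[of u Z] mult_left_mono[OF Za nonneg(1)] by (simp add: U_def)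
    have QZc: "\<bar>Q Z c\<bar> \<le> B * a"
      using B(2)[of Z c] mult_left_mono[OF Za less_imp_le[OF B(1)]] c by (simp add: norm_Basis)
    have ls: "\<bar>\<pi> M * limit_slope c Z\<bar> \<le> \<pi> M * (B + U * U) * a ^ (k + 3)"
    proof -
      have "\<bar>(u \<bullet> c) * (u \<bullet> Z)\<bar> \<le> U * (U * a)" unfolding abs_mult using uc uZ nonneg by (intro mult_mono) auto
      then have "\<bar>limit_slope c Z\<bar> \<le> (B + U * U) * a"
        unfolding limit_slope_def using QZc by (simp add: distrib_right mult.assoc; linarith)
      also have "\<dots> \<le> (B + U * U) * a ^ (k + 3)" using B(1) nonneg pw1 by (intro mult_left_mono) auto
      finally show ?thesis unfolding abs_mult using p by (simp add: mult.assoc mult_left_mono)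
    qed
    have q: "\<bar>Q Z Z + (\<integral>w. Q w w \<partial>gauss)\<bar> \<le> (B + T) * a ^ (k + 3)"
    proof -
      have "B * norm Z * norm Z \<le> B * a * a" using Za B(1) a by (intro mult_mono) auto
      then have "\<bar>Q Z Z\<bar> \<le> B * a\<^sup>2" using B(2)[of Z Z] by (simp add: power2_eq_square mult.assoc)
      also have "\<dots> \<le> B * a ^ (k + 3)" using pw1 B(1) by (intro mult_left_mono) auto
      finally have 1: "\<bar>Q Z Z\<bar> \<le> B * a ^ (k + 3)" .
      have "T * 1 \<le> T * a ^ (k + 3)" using pw1 nonneg by (intro mult_left_mono) auto
      with 1 show ?thesis unfolding T_def by (simp add: distrib_right)
    qed
    have er: "err s Z / s\<^sup>2 \<le> (1 + C1) * a ^ (k + 3)"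
    proof -
      have "err s Z / s\<^sup>2 \<le> (1 * s\<^sup>2 * a\<^sup>2 + C1 * s ^ 3 * a ^ (k + 3)) / s\<^sup>2"
        using C1(2)[OF s, of Z] by (intro divide_right_mono) (auto simp: a_def)
      also have "\<dots> = a\<^sup>2 + s * (C1 * a ^ (k + 3))"
        using s by (simp add: field_simps power2_eq_square power3_eq_cube)
      also have "s * (C1 * a ^ (k + 3)) \<le> 1 * (C1 * a ^ (k + 3))"
        using s C1(1) a by (intro mult_right_mono) auto
      finally show ?thesis using pw1 by (simp add: distrib_right)
    qed
    have e0: "0 \<le> err s Z / s\<^sup>2" unfolding err_def by (intro divide_nonneg_nonneg Bochner_Integration.integral_nonneg) auto
    have t2: "\<pi> M * \<bar>u \<bullet> c\<bar> * \<bar>Q Z Z + (\<integral>w. Q w w \<partial>gauss)\<bar> * s \<le> \<pi> M * U * ((B + T) * a ^ (k + 3)) * 1"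
      using p uc q s nonneg B(1) a by (intro mult_mono mult_left_mono mult_nonneg_nonneg) auto
    have t3: "(1 + \<bar>u \<bullet> c\<bar>) * (err s Z / s\<^sup>2) \<le> (1 + U) * ((1 + C1) * a ^ (k + 3))"
      using uc er e0 nonneg by (intro mult_mono) auto
    have "\<bar>slope c s Z * den s Z\<bar> \<le> C * a ^ (k + 3)"
      using slope_numerator[OF s c, of Z] ls t2 t3 unfolding C_def by (simp add: distrib_right mult.assoc; linarith)
    moreover have D: "0 < den s Z" using s by (rule den_pos)
    ultimately have 1: "\<bar>slope c s Z\<bar> * den s Z \<le> C * a ^ (k + 3)" by (simp add: abs_mult)
    have "\<bar>slope c s Z\<bar> * (c0 / a ^ k) \<le> \<bar>slope c s Z\<bar> * den s Z"
      using c0(2)[OF s, of Z] by (intro mult_left_mono) (auto simp: a_def)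
    then have "\<bar>slope c s Z\<bar> * (c0 / a ^ k) \<le> C * a ^ (k + 3)" using 1 by linarith
    then have "\<bar>slope c s Z\<bar> \<le> C * a ^ (k + 3) * a ^ k / c0"
      using c0(1) a by (simp add: field_simps)
    moreover have "a ^ (2 * k + 3) = a ^ (k + 3) * a ^ k" 
      unfolding power_add[symmetric] by (rule arg_cong[where f="\<lambda>j. a ^ j"]) simp
    ultimately show ?thesis unfolding a_def[symmetric] by simp
  qed
  then show ?thesis using C c0(1) by (intro that[of "C / c0"]) auto
qed

section \<open>Passage to the limit in the risk\<close>

lemma num_measurable[measurable]: "num c s \<in> borel_measurable borel"
  unfolding num_def by (intro gauss.borel_measurable_lebesgue_integral) measurable

lemma den_measurable[measurable]: "den s \<in> borel_measurable borel"
  unfolding den_def by (intro gauss.borel_measurable_lebesgue_integral) measurable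

lemma shift_measurable[measurable]: "mean_shift c s \<in> borel_measurable borel"
  unfolding mean_shift_def by measurable

lemma slope_measurable[measurable]: "slope c s \<in> borel_measurable borel"
  unfolding slope_def by measurable

lemma limit_slope_measurable[measurable]: "limit_slope c \<in> borel_measurable borel"
  unfolding limit_slope_def by (subst Q_commute) measurable

lemma shift_eq: "0 < s \<Longrightarrow> mean_shift c s Z = u \<bullet> c + s * slope c s Z"
  by (simp add: slope_def)

lemma shift_bound:
  obtains C where "0 \<le> C"
    "\<And>c s Z. c \<in> Basis \<Longrightarrow> 0 < s \<Longrightarrow> s \<le> 1 \<Longrightarrow> \<bar>mean_shift c s Z\<bar> \<le> C * (1 + norm Z) ^ (2 * k + 3)"
proof -
  obtain C where C: "0 \<le> C"
    "\<And>c s Z. c \<in> Basis \<Longrightarrow> 0 < s \<Longrightarrow> s \<le> 1 \<Longrightarrow> \<bar>slope c s Z\<bar> \<le> C * (1 + norm Z) ^ (2 * k + 3)"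
    using slope_bound by blast
  have "\<bar>mean_shift c s Z\<bar> \<le> (norm u + C) * (1 + norm Z) ^ (2 * k + 3)" if "c \<in> Basis" "0 < s" "s \<le> 1" for c s Z
  proof -
    have "s * \<bar>slope c s Z\<bar> \<le> 1 * (C * (1 + norm Z) ^ (2 * k + 3))" using C(2)[OF that, of Z] that by (intro mult_mono) auto
    moreover have "\<bar>u \<bullet> c\<bar> \<le> norm u" by (rule Basis_le_norm[OF that(1)])
    moreover have "norm u * 1 \<le> norm u * (1 + norm Z) ^ (2 * k + 3)" by (intro mult_left_mono one_le_power) auto
    ultimately show ?thesis
      using that abs_triangle_ineq[of "u \<bullet> c" "s * slope c s Z"] by (simp add: shift_eq abs_mult distrib_right)
  qed
  then show ?thesis using C(1) by (intro that[of "norm u + C"]) auto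
qed

lemma sqrt_inverse_at_right: "filterlim (\<lambda>N::real. 1 / sqrt N) (at_right 0) at_top"
proof -
  have "filterlim (\<lambda>N::real. inverse (sqrt N)) (at_right 0) at_top"
    by (rule filterlim_compose[OF filterlim_inverse_at_right_top sqrt_at_top])
  then show ?thesis by (simp add: inverse_eq_divide)
qed

text \<open>By dominated convergence the slope may be replaced by its linear limit, and pairing that
  with the coordinate \<open>b\<close> gives the Hessian entry.\<close>

lemma inner_slope_integral_tendsto:
  assumes b: "b \<in> Basis" and c: "c \<in> Basis"
  shows "((\<lambda>N. \<integral>Z. (Z \<bullet> b) * slope c (1 / sqrt N) Z \<partial>gauss) \<longlongrightarrow> H b c) at_top"
proof -
  obtain C where C: "0 \<le> C"
    "\<And>c s Z. c \<in> Basis \<Longrightarrow> 0 < s \<Longrightarrow> s \<le> 1 \<Longrightarrow> \<bar>slope c s Z\<bar> \<le> C * (1 + norm Z) ^ (2 * k + 3)"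
    using slope_bound by blast
  have "((\<lambda>N. \<integral>Z. (Z \<bullet> b) * slope c (1 / sqrt N) Z \<partial>gauss) \<longlongrightarrow> (\<integral>Z. (Z \<bullet> b) * limit_slope c Z \<partial>gauss)) at_top"
  proof (rule integral_dominated_convergence_at_top[where w="\<lambda>Z. C * (1 + norm Z) ^ (2 * k + 4)"])
    show "integrable gauss (\<lambda>Z::'a. C * (1 + norm Z) ^ (2 * k + 4))"
      by (intro integrable_mult_right integrable_gauss_poly)
    show "AE Z in gauss. ((\<lambda>N. (Z \<bullet> b) * slope c (1 / sqrt N) Z) \<longlongrightarrow> (Z \<bullet> b) * limit_slope c Z) at_top"
      by (intro AE_I2 tendsto_mult tendsto_const filterlim_compose[OF slope_tendsto[OF c] sqrt_inverse_at_right])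
    show "\<forall>\<^sub>F N in at_top. AE Z in gauss. norm ((Z \<bullet> b) * slope c (1 / sqrt N) Z) \<le> C * (1 + norm Z) ^ (2 * k + 4)"
    proof (rule eventually_at_top_linorderI[of 1], rule AE_I2)
      fix N :: real and Z :: 'a assume N: "1 \<le> N"
      have "\<bar>Z \<bullet> b\<bar> * \<bar>slope c (1 / sqrt N) Z\<bar> \<le> (1 + norm Z) * (C * (1 + norm Z) ^ (2 * k + 3))"
        using C(2)[OF c, of "1 / sqrt N" Z] N Basis_le_norm[OF b, of Z] by (intro mult_mono) auto
      then show "norm ((Z \<bullet> b) * slope c (1 / sqrt N) Z) \<le> C * (1 + norm Z) ^ (2 * k + 4)"
        by (simp add: abs_mult numeral_eq_Suc ac_simps)
    qed
  qed measurable
  also have "(\<integral>Z. (Z \<bullet> b) * limit_slope c Z \<partial>gauss) = limit_slope c b"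
    by (rule integral_gauss_linear[OF _ b])
      (use bilinear_H in \<open>simp add: limit_slope_eq bilinear_def\<close>)
  finally show ?thesis by (simp add: limit_slope_eq)
qed

lemma shift_tendsto:
  assumes c: "c \<in> Basis"
  shows "((\<lambda>s. mean_shift c s Z) \<longlongrightarrow> u \<bullet> c) (at_right 0)"
proof -
  have "((\<lambda>s. u \<bullet> c + s * slope c s Z) \<longlongrightarrow> u \<bullet> c + 0 * limit_slope c Z) (at_right 0)"
    by (intro tendsto_intros slope_tendsto c)
  moreover have "\<forall>\<^sub>F s in at_right 0. u \<bullet> c + s * slope c s Z = mean_shift c s Z"
    using s_small by eventually_elim (simp add: shift_eq)
  ultimately show ?thesis by (simp add: filterlim_cong)
qed

lemma shift_shift_integral_tendsto:
  assumes b: "b \<in> Basis" and c: "c \<in> Basis"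
  shows "((\<lambda>N. \<integral>Z. mean_shift b (1 / sqrt N) Z * mean_shift c (1 / sqrt N) Z \<partial>gauss) \<longlongrightarrow> (u \<bullet> b) * (u \<bullet> c)) at_top"
proof -
  obtain C where C: "0 \<le> C"
    "\<And>c s Z. c \<in> Basis \<Longrightarrow> 0 < s \<Longrightarrow> s \<le> 1 \<Longrightarrow> \<bar>mean_shift c s Z\<bar> \<le> C * (1 + norm Z) ^ (2 * k + 3)"
    using shift_bound by blast
  have "((\<lambda>N. \<integral>Z. mean_shift b (1 / sqrt N) Z * mean_shift c (1 / sqrt N) Z \<partial>gauss)
      \<longlongrightarrow> (\<integral>Z. (u \<bullet> b) * (u \<bullet> c) \<partial>(gauss :: 'a measure))) at_top"
  proof (rule integral_dominated_convergence_at_top[where w="\<lambda>Z. C * C * (1 + norm Z) ^ (2 * (2 * k + 3))"])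
    show "integrable gauss (\<lambda>Z::'a. C * C * (1 + norm Z) ^ (2 * (2 * k + 3)))"
      by (intro integrable_mult_right integrable_gauss_poly)
    show "AE Z in gauss. ((\<lambda>N. mean_shift b (1 / sqrt N) Z * mean_shift c (1 / sqrt N) Z) \<longlongrightarrow> (u \<bullet> b) * (u \<bullet> c)) at_top"
      by (intro AE_I2 tendsto_mult filterlim_compose[OF shift_tendsto sqrt_inverse_at_right] b c)
    show "\<forall>\<^sub>F N in at_top. AE Z in gauss. norm (mean_shift b (1 / sqrt N) Z * mean_shift c (1 / sqrt N) Z)
        \<le> C * C * (1 + norm Z) ^ (2 * (2 * k + 3))"
    proof (rule eventually_at_top_linorderI[of 1], rule AE_I2)
      fix N :: real and Z :: 'a assume N: "1 \<le> N"
      have "\<bar>mean_shift b (1 / sqrt N) Z\<bar> * \<bar>mean_shift c (1 / sqrt N) Z\<bar>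
          \<le> (C * (1 + norm Z) ^ (2 * k + 3)) * (C * (1 + norm Z) ^ (2 * k + 3))"
        using C(2)[OF b, of "1 / sqrt N" Z] C(2)[OF c, of "1 / sqrt N" Z] N C(1) by (intro mult_mono) auto
      then show "norm (mean_shift b (1 / sqrt N) Z * mean_shift c (1 / sqrt N) Z) \<le> C * C * (1 + norm Z) ^ (2 * (2 * k + 3))"
        unfolding mult_2[of "2 * k + 3"] power_add by (simp add: abs_mult ac_simps)
    qed
  qed measurable
  then show ?thesis by (simp add: gauss.prob_space[simplified])
qed

lemma integrable_inner_slope:
  assumes b: "b \<in> Basis" and c: "c \<in> Basis" and s: "0 < s" "s \<le> 1"
  shows "integrable gauss (\<lambda>Z. (Z \<bullet> b) * slope c s Z)"
proof -
  obtain C where C: "0 \<le> C"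
    "\<And>c s Z. c \<in> Basis \<Longrightarrow> 0 < s \<Longrightarrow> s \<le> 1 \<Longrightarrow> \<bar>slope c s Z\<bar> \<le> C * (1 + norm Z) ^ (2 * k + 3)"
    using slope_bound by blast
  show ?thesis
  proof (rule integrable_gauss_bounded[where C=C and q="2 * k + 4"])
    fix Z :: 'a
    have "\<bar>Z \<bullet> b\<bar> * \<bar>slope c s Z\<bar> \<le> (1 + norm Z) * (C * (1 + norm Z) ^ (2 * k + 3))"
      using C(2)[OF c s, of Z] Basis_le_norm[OF b, of Z] by (intro mult_mono) auto
    then show "norm ((Z \<bullet> b) * slope c s Z) \<le> C * (1 + norm Z) ^ (2 * k + 4)"
      by (simp add: abs_mult numeral_eq_Suc ac_simps)
  qed measurable
qed

lemma integrable_shift_shift: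
  assumes b: "b \<in> Basis" and c: "c \<in> Basis" and s: "0 < s" "s \<le> 1"
  shows "integrable gauss (\<lambda>Z. mean_shift b s Z * mean_shift c s Z)"
proof -
  obtain C where C: "0 \<le> C"
    "\<And>c s Z. c \<in> Basis \<Longrightarrow> 0 < s \<Longrightarrow> s \<le> 1 \<Longrightarrow> \<bar>mean_shift c s Z\<bar> \<le> C * (1 + norm Z) ^ (2 * k + 3)"
    using shift_bound by blast
  show ?thesis
  proof (rule integrable_gauss_bounded[where C="C * C" and q="2 * (2 * k + 3)"])
    fix Z :: 'a
    have "\<bar>mean_shift b s Z\<bar> * \<bar>mean_shift c s Z\<bar> \<le> (C * (1 + norm Z) ^ (2 * k + 3)) * (C * (1 + norm Z) ^ (2 * k + 3))"
      using C(2)[OF b s, of Z] C(2)[OF c s, of Z] C(1) by (intro mult_mono) auto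
    then show "norm (mean_shift b s Z * mean_shift c s Z) \<le> C * C * (1 + norm Z) ^ (2 * (2 * k + 3))"
      unfolding mult_2[of "2 * k + 3"] power_add by (simp add: abs_mult ac_simps)
  qed measurable
qed

text \<open>The terms of order s^3 pair the constant limit of the shift with a coordinate of Z and
  have mean zero. After the risk of the data themselves, the next contribution is therefore of order
  s^4, that is 1 / N^2.\<close>

lemma has_integral_risk:
  assumes b: "b \<in> Basis" and c: "c \<in> Basis" and s: "0 < s" "s \<le> 1"
  shows "has_bochner_integral gauss
    (\<lambda>Z. (s * (Z \<bullet> b) + s\<^sup>2 * mean_shift b s Z) * (s * (Z \<bullet> c) + s\<^sup>2 * mean_shift c s Z))
    (s\<^sup>2 * (b \<bullet> c) + s ^ 4 * ((\<integral>Z. (Z \<bullet> b) * slope c s Z \<partial>gauss) + (\<integral>Z. (Z \<bullet> c) * slope b s Z \<partial>gauss)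
       + (\<integral>Z. mean_shift b s Z * mean_shift c s Z \<partial>gauss)))"
proof -
  have 0: "has_bochner_integral gauss (\<lambda>w. w \<bullet> c) 0" for c :: 'a
    using integral_gauss_odd[of "\<lambda>w. w \<bullet> c"] by (simp add: has_bochner_integral_iff integrable_gauss_inner)
  have 2: "has_bochner_integral gauss (\<lambda>w. (w \<bullet> b) * (w \<bullet> c)) (b \<bullet> c)"
    using integral_gauss_linear[of "\<lambda>w. w \<bullet> c", OF _ b]
    by (simp add: has_bochner_integral_iff integrable_gauss_inner_mult bounded_linear.linear bounded_linear_inner_left)
  have "has_bochner_integral gauss
    (\<lambda>Z. s\<^sup>2 * ((Z \<bullet> b) * (Z \<bullet> c)) + s ^ 4 * ((Z \<bullet> b) * slope c s Z + (Z \<bullet> c) * slope b s Z + mean_shift b s Z * mean_shift c s Z)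
       + s ^ 3 * (u \<bullet> c) * (Z \<bullet> b) + s ^ 3 * (u \<bullet> b) * (Z \<bullet> c))
    (s\<^sup>2 * (b \<bullet> c) + s ^ 4 * ((\<integral>Z. (Z \<bullet> b) * slope c s Z \<partial>gauss) + (\<integral>Z. (Z \<bullet> c) * slope b s Z \<partial>gauss)
       + (\<integral>Z. mean_shift b s Z * mean_shift c s Z \<partial>gauss)) + s ^ 3 * (u \<bullet> c) * 0 + s ^ 3 * (u \<bullet> b) * 0)"
    by (intro has_bochner_integral_add has_bochner_integral_mult_right 0 2 has_bochner_integral_integrable
        integrable_inner_slope integrable_shift_shift b c s)
  also have "(\<lambda>Z. s\<^sup>2 * ((Z \<bullet> b) * (Z \<bullet> c)) + s ^ 4 * ((Z \<bullet> b) * slope c s Z + (Z \<bullet> c) * slope b s Z + mean_shift b s Z * mean_shift c s Z)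
       + s ^ 3 * (u \<bullet> c) * (Z \<bullet> b) + s ^ 3 * (u \<bullet> b) * (Z \<bullet> c))
     = (\<lambda>Z. (s * (Z \<bullet> b) + s\<^sup>2 * mean_shift b s Z) * (s * (Z \<bullet> c) + s\<^sup>2 * mean_shift c s Z))"
  proof
    fix Z
    have "(s * (Z \<bullet> b) + s\<^sup>2 * mean_shift b s Z) * (s * (Z \<bullet> c) + s\<^sup>2 * mean_shift c s Z)
      = s\<^sup>2 * ((Z \<bullet> b) * (Z \<bullet> c)) + s ^ 3 * (Z \<bullet> b) * mean_shift c s Z + s ^ 3 * (Z \<bullet> c) * mean_shift b s Z
        + s ^ 4 * (mean_shift b s Z * mean_shift c s Z)"
      by (simp add: algebra_simps power2_eq_square power3_eq_cube power4_eq_xxxx)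
    also have "s ^ 3 * (Z \<bullet> b) * mean_shift c s Z = s ^ 3 * (u \<bullet> c) * (Z \<bullet> b) + s ^ 4 * ((Z \<bullet> b) * slope c s Z)"
      using s by (subst shift_eq) (auto simp: algebra_simps power3_eq_cube power4_eq_xxxx)
    also have "s ^ 3 * (Z \<bullet> c) * mean_shift b s Z = s ^ 3 * (u \<bullet> b) * (Z \<bullet> c) + s ^ 4 * ((Z \<bullet> c) * slope b s Z)"
      using s by (subst shift_eq) (auto simp: algebra_simps power3_eq_cube power4_eq_xxxx)
    finally show "s\<^sup>2 * ((Z \<bullet> b) * (Z \<bullet> c)) + s ^ 4 * ((Z \<bullet> b) * slope c s Z + (Z \<bullet> c) * slope b s Z + mean_shift b s Z * mean_shift c s Z)
       + s ^ 3 * (u \<bullet> c) * (Z \<bullet> b) + s ^ 3 * (u \<bullet> b) * (Z \<bullet> c)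
      = (s * (Z \<bullet> b) + s\<^sup>2 * mean_shift b s Z) * (s * (Z \<bullet> c) + s\<^sup>2 * mean_shift c s Z)"
      by (simp add: distrib_left)
  qed
  finally show ?thesis by simp
qed

text \<open>The subtracted (b . c) / N is the risk of the data themselves. The factor 2 comes from
  the two mixed products, whose limits agree by symmetry of \<open>H\<close>.\<close>

theorem risk_expansion:
  assumes b: "b \<in> Basis" and c: "c \<in> Basis"
  shows "((\<lambda>N. N\<^sup>2 * ((\<integral>Z. (1 / sqrt N * (Z \<bullet> b) + (1 / sqrt N)\<^sup>2 * mean_shift b (1 / sqrt N) Z)
        * (1 / sqrt N * (Z \<bullet> c) + (1 / sqrt N)\<^sup>2 * mean_shift c (1 / sqrt N) Z) \<partial>gauss) - (b \<bullet> c) / N))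
      \<longlongrightarrow> 2 * H b c + (u \<bullet> b) * (u \<bullet> c)) at_top"
proof -
  have "((\<lambda>N. (\<integral>Z. (Z \<bullet> b) * slope c (1 / sqrt N) Z \<partial>gauss) + (\<integral>Z. (Z \<bullet> c) * slope b (1 / sqrt N) Z \<partial>gauss)
       + (\<integral>Z. mean_shift b (1 / sqrt N) Z * mean_shift c (1 / sqrt N) Z \<partial>gauss))
     \<longlongrightarrow> H b c + H c b + (u \<bullet> b) * (u \<bullet> c)) at_top"
    by (intro tendsto_add inner_slope_integral_tendsto shift_shift_integral_tendsto b c)
  moreover have "\<forall>\<^sub>F N in at_top. (\<integral>Z. (Z \<bullet> b) * slope c (1 / sqrt N) Z \<partial>gauss) + (\<integral>Z. (Z \<bullet> c) * slope b (1 / sqrt N) Z \<partial>gauss)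
       + (\<integral>Z. mean_shift b (1 / sqrt N) Z * mean_shift c (1 / sqrt N) Z \<partial>gauss)
     = N\<^sup>2 * ((\<integral>Z. (1 / sqrt N * (Z \<bullet> b) + (1 / sqrt N)\<^sup>2 * mean_shift b (1 / sqrt N) Z)
        * (1 / sqrt N * (Z \<bullet> c) + (1 / sqrt N)\<^sup>2 * mean_shift c (1 / sqrt N) Z) \<partial>gauss) - (b \<bullet> c) / N)"
  proof (rule eventually_at_top_linorderI[of 1])
    fix N :: real assume N: "1 \<le> N"
    define s where "s = 1 / sqrt N"
    have s: "0 < s" "s \<le> 1" using N by (auto simp: s_def)
    have s2: "s\<^sup>2 = 1 / N" using N by (simp add: s_def power_divide)
    have "s ^ 4 = (s\<^sup>2)\<^sup>2" by simp
    then have s4: "s ^ 4 = 1 / N\<^sup>2" unfolding s2 by (simp add: power_divide)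
    show "(\<integral>Z. (Z \<bullet> b) * slope c (1 / sqrt N) Z \<partial>gauss) + (\<integral>Z. (Z \<bullet> c) * slope b (1 / sqrt N) Z \<partial>gauss)
       + (\<integral>Z. mean_shift b (1 / sqrt N) Z * mean_shift c (1 / sqrt N) Z \<partial>gauss)
     = N\<^sup>2 * ((\<integral>Z. (1 / sqrt N * (Z \<bullet> b) + (1 / sqrt N)\<^sup>2 * mean_shift b (1 / sqrt N) Z)
        * (1 / sqrt N * (Z \<bullet> c) + (1 / sqrt N)\<^sup>2 * mean_shift c (1 / sqrt N) Z) \<partial>gauss) - (b \<bullet> c) / N)"
      unfolding s_def[symmetric] has_bochner_integral_integral_eq[OF has_integral_risk[OF b c s]] s4
      unfolding s2 using N by simp
  qed
  ultimately show ?thesis by (simp add: filterlim_cong H_commute[of c b])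
qed

end

section \<open>Gram determinants\<close>

text \<open>The residual of the orthogonal projection onto the span of \<open>S\<close>, whose norm
  is the distance to that span. The orthogonal decomposition makes the choice unique.\<close>

definition perp_part :: "'a::euclidean_space set \<Rightarrow> 'a \<Rightarrow> 'a" where
  "perp_part S x = (SOME z. x - z \<in> span S \<and> (\<forall>w\<in>span S. orthogonal z w))"

lemma perp_part: "x - perp_part S x \<in> span S" "w \<in> span S \<Longrightarrow> perp_part S x \<bullet> w = 0"
proof -
  obtain y z where "y \<in> span S" "\<And>w. w \<in> span S \<Longrightarrow> orthogonal z w" "x = y + z"
    using orthogonal_subspace_decomp_exists by blast
  then have "x - z \<in> span S \<and> (\<forall>w\<in>span S. orthogonal z w)" by auto
  then have "x - perp_part S x \<in> span S \<and> (\<forall>w\<in>span S. orthogonal (perp_part S x) w)"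
    unfolding perp_part_def by (rule someI)
  then show "x - perp_part S x \<in> span S" "w \<in> span S \<Longrightarrow> perp_part S x \<bullet> w = 0"
    by (auto simp: orthogonal_def)
qed

lemma perp_part_inner: "perp_part S x \<bullet> x = (norm (perp_part S x))\<^sup>2"
  using perp_part(2)[OF perp_part(1), of S x x] by (simp add: inner_diff_right power2_norm_eq_inner)

lemma perp_part_norm_le: "norm (perp_part S x) \<le> norm x"
proof (cases "perp_part S x = 0")
  case False
  have "norm (perp_part S x) * norm (perp_part S x) \<le> norm (perp_part S x) * norm x"
    using norm_cauchy_schwarz[of "perp_part S x" x] unfolding perp_part_inner power2_eq_square .
  then show ?thesis using False by simp
qed simp

text \<open>The Gram matrix of the family over \<open>I\<close>, padded by an identity block. The
  matrix type is then the same for every \<open>I\<close>, which permits induction over subsets of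
  columns.\<close>

definition gram :: "'p::finite set \<Rightarrow> ('p \<Rightarrow> 'a::euclidean_space) \<Rightarrow> real" where
  "gram I c = det (\<chi> i j. if i \<in> I \<and> j \<in> I then c i \<bullet> c j else if i = j then 1 else 0 :: real^'p^'p)"

text \<open>In the Leibniz sum a permutation that moves \<open>i\<close> picks a zero from row
  \<open>i\<close>, and one that fixes \<open>i\<close> meets column \<open>i\<close> only on the
  diagonal. The other entries of column \<open>i\<close> are therefore free.\<close>

lemma det_unit_row:
  fixes A B :: "real^'n^'n"
  assumes "\<And>j. A $ i $ j = (if i = j then 1 else 0)" "\<And>j. B $ i $ j = (if i = j then 1 else 0)"
    and "\<And>k j. k \<noteq> i \<Longrightarrow> j \<noteq> i \<Longrightarrow> A $ k $ j = B $ k $ j"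
  shows "det A = det B"
  unfolding det_def
proof (rule sum.cong[OF refl])
  fix p assume "p \<in> {p. p permutes (UNIV :: 'n set)}"
  then have p: "inj p" by (simp add: permutes_inj)
  have "(\<Prod>k\<in>UNIV. A $ k $ p k) = (\<Prod>k\<in>UNIV. B $ k $ p k)"
  proof (cases "p i = i")
    case True
    then have "k \<noteq> i \<Longrightarrow> p k \<noteq> i" for k using p by (metis injD)
    then have "A $ k $ p k = B $ k $ p k" for k using assms True by (cases "k = i") auto
    then show ?thesis by simp
  next
    case False
    then have "A $ i $ p i = 0" "B $ i $ p i = 0" using assms by auto
    then have "(\<Prod>k\<in>UNIV. A $ k $ p k) = 0" "(\<Prod>k\<in>UNIV. B $ k $ p k) = 0"
      by (auto intro!: prod_zero bexI[of _ i])
    then show ?thesis by (simp only:)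
  qed
  then show "of_int (sign p) * (\<Prod>k\<in>UNIV. A $ k $ p k) = of_int (sign p) * (\<Prod>k\<in>UNIV. B $ k $ p k)" by simp
qed

text \<open>The projection of the new column is a combination of the old columns, so subtracting the
  matching combination of rows leaves the inner products with the residual: its squared norm on the
  diagonal and 0 elsewhere.\<close>

lemma gram_insert:
  fixes c :: "'p::finite \<Rightarrow> 'a::euclidean_space"
  assumes i: "i \<notin> I"
  shows "gram (insert i I) c = (norm (perp_part (c ` I) (c i)))\<^sup>2 * gram I c"
proof -
  define z where "z = perp_part (c ` I) (c i)"
  define A :: "real^'p^'p" where
    "A = (\<chi> k j. if k \<in> insert i I \<and> j \<in> insert i I then c k \<bullet> c j else if k = j then 1 else 0)"
  \<comment> \<open>A linear map sending each participating column to its row of \<open>A\<close>,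
    so linear relations among columns become relations among rows.\<close>
  define f :: "'a \<Rightarrow> real^'p" where "f y = (\<chi> j. if j \<in> insert i I then y \<bullet> c j else 0)" for y
  have f: "linear f" unfolding f_def by (rule linearI) (auto simp: vec_eq_iff inner_add_left)
  have row: "f (c j) = row j A" if "j \<in> insert i I" for j
    using that by (auto simp: f_def A_def row_def vec_eq_iff)
  have "f (c i - z) \<in> f ` span (c ` I)" unfolding z_def by (intro imageI perp_part(1))
  also have "f ` span (c ` I) = span (f ` c ` I)" using f by (simp add: linear_span_image)
  also have "\<dots> \<subseteq> span {row j A |j. j \<noteq> i}"
  proof (rule span_mono, safe)
    fix j assume "j \<in> I"
    then show "\<exists>k. f (c j) = row k A \<and> k \<noteq> i" using i row[of j] by (intro exI[of _ j]) auto
  qed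
  finally have "- f (c i - z) \<in> vec.span {row j A |j. j \<noteq> i}" by (simp add: span_neg span_vec_eq)
  then have "det (\<chi> k. if k = i then row i A + - f (c i - z) else row k A) = det A" by (rule det_row_span)
  also have "row i A + - f (c i - z) = f z" using row[of i] by (simp add: linear_diff[OF f])
  also have "f z = (norm z)\<^sup>2 *s axis i 1"
  proof (simp add: vec_eq_iff f_def axis_def, intro conjI impI allI)
    show "z \<bullet> c i = (norm z)\<^sup>2" unfolding z_def by (rule perp_part_inner)
    fix j assume "j \<in> I"
    then show "z \<bullet> c j = 0" unfolding z_def by (intro perp_part(2) span_base) auto
  qed (use i in auto)
  also have "det (\<chi> k. if k = i then (norm z)\<^sup>2 *s axis i 1 else row k A)
      = (norm z)\<^sup>2 * det (\<chi> k. if k = i then axis i 1 else row k A)"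
    by (rule det_row_mul)
  \<comment> \<open>Row \<open>i\<close> is now a unit vector, but column \<open>i\<close> still
    contains inner products with \<open>c i\<close>; these are the entries that
    \<open>det_unit_row\<close> discards.\<close>
  also have "det (\<chi> k. if k = i then axis i 1 else row k A) = gram I c"
    unfolding gram_def by (rule det_unit_row[where i=i]) (use i in \<open>auto simp: axis_def row_def A_def\<close>)
  finally show ?thesis by (simp add: gram_def A_def z_def)
qed

lemma gram_empty:
  fixes c :: "'p::finite \<Rightarrow> 'a::euclidean_space"
  shows "gram {} c = 1"
proof -
  have "(\<chi> i j. if i \<in> {} \<and> j \<in> {} then c i \<bullet> c j else if i = j then 1 else 0 :: real^'p^'p) = mat 1"
    by (simp add: mat_def vec_eq_iff)
  then show ?thesis unfolding gram_def by (simp add: det_I)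
qed

lemma gram_nonneg: "0 \<le> gram I c"
  using finite[of I] by induction (auto simp: gram_empty gram_insert)

text \<open>Hadamard's inequality: a residual is no longer than the vector itself.\<close>

lemma gram_le: "gram I c \<le> (\<Prod>i\<in>I. (norm (c i))\<^sup>2)"
  using finite[of I]
  by induction (auto simp: gram_empty gram_insert gram_nonneg intro!: mult_mono power_mono perp_part_norm_le)

lemma gram_cong: "(\<And>i. i \<in> I \<Longrightarrow> c i = d i) \<Longrightarrow> gram I c = gram I d"
  unfolding gram_def by (intro arg_cong[where f=det]) (simp add: vec_eq_iff)

lemma gram_zero_column: "i \<in> I \<Longrightarrow> c i = 0 \<Longrightarrow> gram I c = 0"
proof -
  assume "i \<in> I" "c i = 0"
  then have "(\<Prod>i\<in>I. (norm (c i))\<^sup>2) = 0" by (intro prod_zero) auto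
  then show ?thesis using gram_le[of I c] gram_nonneg[of I c] by linarith
qed

lemma gram_columns: "gram UNIV (\<lambda>i. column i A) = det (transpose A ** A)"
  unfolding gram_def by (simp add: matrix_mult_transpose_dot_column)

lemma gram_measurable[measurable]:
  "gram I \<in> borel_measurable (Pi\<^sub>M I (\<lambda>_. lborel :: 'a::euclidean_space measure))"
proof -
  have [measurable]: "(\<lambda>c. if i \<in> I \<and> j \<in> I then c i \<bullet> c j else if i = j then 1 else 0 :: real)
      \<in> borel_measurable (Pi\<^sub>M I (\<lambda>_. lborel :: 'a measure))" for i j
    by (cases "i \<in> I \<and> j \<in> I") auto
  show ?thesis unfolding gram_def det_def by simp measurable
qed

section \<open>Integrability of determinantal priors\<close>

text \<open>1 + |z|^-\<theta> dominates all powers |z|^-\<eta> with 0 \<le> \<eta> \<le> \<theta>.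
  The infinite value at 0 is explicit because \<open>powr\<close> would give 0 there and spoil the
  domination.\<close>

definition pole :: "real \<Rightarrow> real \<Rightarrow> ennreal" where
  "pole \<theta> z = (if z = 0 then \<top> else ennreal (1 + \<bar>z\<bar> powr - \<theta>))"

lemma pole_measurable[measurable]: "pole \<theta> \<in> borel_measurable borel"
  unfolding pole_def by measurable

lemma pole_ge_one: "1 \<le> pole \<theta> z" by (simp add: pole_def)

lemma nn_integral_powr_unit:
  assumes "\<theta> < 1"
  shows "(\<integral>\<^sup>+z. ennreal (indicator {0..1} z * z powr - \<theta>) \<partial>lborel) = ennreal (1 / (1 - \<theta>))"
proof -
  have "((\<lambda>x::real. x powr - \<theta>) has_integral 1 powr (- \<theta> + 1) / (- \<theta> + 1)) {0..1}"
    using assms by (intro has_integral_powr_from_0) auto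
  then have "(\<integral>\<^sup>+x. ennreal (indicator {0..1} x * x powr - \<theta>) \<partial>lborel) = ennreal (1 powr (- \<theta> + 1) / (- \<theta> + 1))"
    by (intro nn_integral_has_integral_lebesgue) auto
  then show ?thesis by simp
qed

text \<open>For |z| \<le> 1 the Gaussian factor is at most 1 in front of the singular power, and
  elsewhere that power is at most 1, whence uniformity in the centre \<open>y\<close>. The two sides
  of the unit interval give 2 / (1 - \<theta>).\<close>

lemma nn_integral_pole_bound:
  assumes \<theta>: "0 \<le> \<theta>" "\<theta> < 1"
  obtains C where "0 \<le> C"
    "\<And>y. (\<integral>\<^sup>+z. ennreal (exp (- (z - y)\<^sup>2 / 4)) * pole \<theta> z \<partial>lborel) \<le> ennreal C"
proof -
  let ?p = "\<lambda>z::real. ennreal (indicator {0..1} z * z powr - \<theta>)"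
  have "(\<integral>\<^sup>+z. ennreal (exp (- (z - y)\<^sup>2 / 4)) * pole \<theta> z \<partial>lborel) \<le> ennreal (2 * sqrt (4 * pi) + 2 / (1 - \<theta>))" for y
  proof -
    have "(\<integral>\<^sup>+z. ennreal (exp (- (z - y)\<^sup>2 / 4)) * pole \<theta> z \<partial>lborel)
       \<le> (\<integral>\<^sup>+z. 2 * ennreal (exp (- (z - y)\<^sup>2 / 4)) + (?p z + ?p (- z)) \<partial>lborel)"
    proof (rule nn_integral_mono_AE, use AE_lborel_singleton[of "0::real"] in eventually_elim)
      fix z :: real assume z: "z \<noteq> 0"
      have e: "exp (- (z - y)\<^sup>2 / 4) \<le> 1" by simp
      have "\<bar>z\<bar> powr - \<theta> \<le> 1 \<or> \<bar>z\<bar> \<le> 1"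
        using \<theta> z by (cases "\<bar>z\<bar> \<le> 1") (auto intro: powr_le_one_le simp: powr_minus ge_one_powr_ge_zero inverse_le_1_iff)
      then have "exp (- (z - y)\<^sup>2 / 4) * \<bar>z\<bar> powr - \<theta> \<le> exp (- (z - y)\<^sup>2 / 4)
          + (indicator {0..1} z * z powr - \<theta> + indicator {0..1} (- z) * (- z) powr - \<theta>)"
      proof
        assume "\<bar>z\<bar> powr - \<theta> \<le> 1"
        then have "exp (- (z - y)\<^sup>2 / 4) * \<bar>z\<bar> powr - \<theta> \<le> exp (- (z - y)\<^sup>2 / 4) * 1" by (intro mult_left_mono) auto
        then show ?thesis by (simp add: add_increasing2)
      next
        assume "\<bar>z\<bar> \<le> 1"
        then have "\<bar>z\<bar> powr - \<theta> = indicator {0..1} z * z powr - \<theta> + indicator {0..1} (- z) * (- z) powr - \<theta>"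
          using z by (auto simp: indicator_def abs_if)
        moreover have "exp (- (z - y)\<^sup>2 / 4) * \<bar>z\<bar> powr - \<theta> \<le> 1 * \<bar>z\<bar> powr - \<theta>"
          using e by (intro mult_right_mono) auto
        ultimately show ?thesis by (simp add: add_increasing)
      qed
      then have "exp (- (z - y)\<^sup>2 / 4) * (1 + \<bar>z\<bar> powr - \<theta>) \<le> 2 * exp (- (z - y)\<^sup>2 / 4)
          + (indicator {0..1} z * z powr - \<theta> + indicator {0..1} (- z) * (- z) powr - \<theta>)"
        by (simp add: distrib_left)
      then have "ennreal (exp (- (z - y)\<^sup>2 / 4) * (1 + \<bar>z\<bar> powr - \<theta>)) \<le> ennreal (2 * exp (- (z - y)\<^sup>2 / 4)
          + (indicator {0..1} z * z powr - \<theta> + indicator {0..1} (- z) * (- z) powr - \<theta>))"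
        by (rule ennreal_leI)
      then show "ennreal (exp (- (z - y)\<^sup>2 / 4)) * pole \<theta> z \<le> 2 * ennreal (exp (- (z - y)\<^sup>2 / 4)) + (?p z + ?p (- z))"
        using z by (simp add: pole_def ennreal_mult ennreal_plus del: ennreal_plus flip: ennreal_plus)
          (simp add: ennreal_mult ennreal_plus)
    qed
    also have "\<dots> = 2 * (\<integral>\<^sup>+z. ennreal (exp (- (z - y)\<^sup>2 / 4)) \<partial>lborel) + ((\<integral>\<^sup>+z. ?p z \<partial>lborel) + (\<integral>\<^sup>+z. ?p (- z) \<partial>lborel))"
      by (simp add: nn_integral_add nn_integral_cmult)
    also have "(\<integral>\<^sup>+z. ?p (- z) \<partial>lborel) = (\<integral>\<^sup>+z. ?p z \<partial>lborel)"
      by (rule nn_integral_lborel_orthogonal[where T=uminus])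
        (auto simp: orthogonal_transformation_def linear_iff)
    also have "2 * (\<integral>\<^sup>+z. ennreal (exp (- (z - y)\<^sup>2 / 4)) \<partial>lborel) + ((\<integral>\<^sup>+z. ?p z \<partial>lborel) + (\<integral>\<^sup>+z. ?p z \<partial>lborel))
       = ennreal (2 * sqrt (4 * pi) + 2 / (1 - \<theta>))"
      unfolding nn_integral_powr_unit[OF \<theta>(2)] nn_integral_exp_quarter_real
    proof -
      have "ennreal (1 / (1 - \<theta>)) + ennreal (1 / (1 - \<theta>)) = ennreal (2 / (1 - \<theta>))"
        using \<theta> by (subst ennreal_plus[symmetric]) auto
      then show "2 * ennreal (sqrt (4 * pi)) + (ennreal (1 / (1 - \<theta>)) + ennreal (1 / (1 - \<theta>)))
          = ennreal (2 * sqrt (4 * pi) + 2 / (1 - \<theta>))"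
        using \<theta> by (subst ennreal_plus) (auto simp: ennreal_mult)
    qed
    finally show ?thesis .
  qed
  then show ?thesis using \<theta> by (intro that[of "2 * sqrt (4 * pi) + 2 / (1 - \<theta>)"]) auto
qed

text \<open>Orthonormal bases of the span and of its orthogonal complement are joined and matched
  with the standard basis; \<open>J\<close> collects the indices sent into the complement.\<close>

lemma orthogonal_transformation_adapted:
  fixes S :: "'a::euclidean_space set"
  obtains T :: "'a \<Rightarrow> 'a" and J where "orthogonal_transformation T" "J \<subseteq> Basis" "card J = DIM('a) - dim S"
    "\<And>b v. b \<in> J \<Longrightarrow> v \<in> span S \<Longrightarrow> T b \<bullet> v = 0"
proof -
  define W where "W = {y :: 'a. \<forall>x\<in>span S. orthogonal x y}"
  have W: "subspace W" unfolding W_def by (rule subspace_orthogonal_to_vectors)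
  have dimW: "dim W + dim S = DIM('a)"
    using dim_subspace_orthogonal_to_vectors[of "span S" UNIV] unfolding W_def by simp
  obtain B where B: "B \<subseteq> span S" "pairwise orthogonal B" "\<And>x. x \<in> B \<Longrightarrow> norm x = 1"
      "independent B" "card B = dim (span S)"
    by (metis orthonormal_basis_subspace[OF subspace_span])
  obtain C where C: "C \<subseteq> W" "pairwise orthogonal C" "\<And>x. x \<in> C \<Longrightarrow> norm x = 1"
      "independent C" "card C = dim W"
    by (metis orthonormal_basis_subspace[OF W])
  have BC: "x \<bullet> y = 0" if "x \<in> B" "y \<in> C" for x y
    using that B(1) C(1) unfolding W_def orthogonal_def by blast
  have disj: "B \<inter> C = {}" using BC B(3) by (force simp: norm_eq_1)
  have fin: "finite B" "finite C" using B(4) C(4) by (auto intro: independent_imp_finite)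
  have "card (B \<union> C) = DIM('a)" using card_Un_disjoint[OF fin disj] B(5) C(5) dimW by simp
  then obtain f where f: "bij_betw f (Basis :: 'a set) (B \<union> C)"
    using finite_same_card_bij[of "Basis :: 'a set" "B \<union> C"] fin by auto
  have ortho: "f b \<bullet> f c = (if b = c then 1 else 0)" if "b \<in> Basis" "c \<in> Basis" for b c
  proof (cases "b = c")
    case True
    have "f b \<in> B \<union> C" using f that by (auto simp: bij_betw_def)
    then have "norm (f b) = 1" using B(3) C(3) by blast
    with True show ?thesis by (simp add: norm_eq_1)
  next
    case False
    then have ne: "f b \<noteq> f c" and "f b \<in> B \<union> C" "f c \<in> B \<union> C"
      using f that by (auto simp: bij_betw_def inj_on_def)
    then have "f b \<bullet> f c = 0"
      using B(2) C(2) BC[of "f b" "f c"] BC[of "f c" "f b"]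
      by (auto simp: pairwise_def orthogonal_def inner_commute)
    with False show ?thesis by simp
  qed
  define T where "T x = (\<Sum>b\<in>Basis. (x \<bullet> b) *\<^sub>R f b)" for x :: 'a
  have "linear T" unfolding T_def
    by (rule linearI) (auto simp: inner_add_left scaleR_add_left sum.distrib scaleR_sum_right)
  moreover have "T x \<bullet> T y = x \<bullet> y" for x y
  proof -
    have "T x \<bullet> T y = (\<Sum>b\<in>Basis. \<Sum>c\<in>Basis. (x \<bullet> b) * ((y \<bullet> c) * (f b \<bullet> f c)))"
      unfolding T_def inner_sum_left unfolding inner_sum_right inner_scaleR_left inner_scaleR_right sum_distrib_left
      by (intro sum.cong refl) simp
    also have "\<dots> = (\<Sum>b\<in>Basis. \<Sum>c\<in>Basis. if b = c then (x \<bullet> b) * (y \<bullet> c) else 0)"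
      by (intro sum.cong refl) (auto simp: ortho)
    also have "\<dots> = x \<bullet> y" by (subst euclidean_inner) simp
    finally show ?thesis .
  qed
  ultimately have T: "orthogonal_transformation T" by (simp add: orthogonal_transformation_def)
  define J where "J = {b\<in>Basis. f b \<in> C}"
  have Tb: "T b = f b" if "b \<in> Basis" for b
    using that unfolding T_def by (simp add: inner_Basis if_distrib[of "\<lambda>x. x *\<^sub>R _"] sum.delta cong: if_cong)
  have "f ` J = C" unfolding J_def using f by (auto simp: bij_betw_def image_def set_eq_iff) (metis UnI2 image_iff)
  moreover have "inj_on f J" using f unfolding J_def bij_betw_def by (auto intro: inj_on_subset)
  ultimately have "card J = card C" using card_image by fastforce
  then have "card J = DIM('a) - dim S" using C(5) dimW by simp
  moreover have "T b \<bullet> v = 0" if "b \<in> J" "v \<in> span S" for b v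
    using that C(1) Tb[of b] unfolding J_def W_def orthogonal_def by (auto simp: inner_commute)
  ultimately show ?thesis using T by (intro that[of T J]) (auto simp: J_def)
qed

text \<open>Spreading the total exponent \<open>k + \<gamma> < n\<close> evenly over the coordinates leaves every single
  coordinate with an exponent at most \<open>(n - 1) / n < 1\<close>.\<close>
lemma pole_product_bound:
  fixes z :: "'b \<Rightarrow> real" and k p :: nat
  assumes B: "finite B" "card B = k + p + 1" "0 < p" and J: "J \<subseteq> B" "k + 1 \<le> card J"
    and \<gamma>: "0 \<le> \<gamma>" "\<gamma> \<le> real p" and z: "\<And>b. b \<in> B \<Longrightarrow> z b \<noteq> 0"
    and d: "0 < d" "\<And>b. b \<in> J \<Longrightarrow> \<bar>z b\<bar> \<le> d" and r: "0 < r" "\<And>b. b \<in> B \<Longrightarrow> \<bar>z b\<bar> \<le> r"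
  shows "d powr - real k * r powr - \<gamma> \<le> (\<Prod>b\<in>B. 1 + \<bar>z b\<bar> powr - ((real (card B) - 1) / real (card B)))"
proof -
  define n where "n = real (card B)"
  define m where "m = real (card J)"
  define \<theta> where "\<theta> = (n - 1) / n"
  \<comment> \<open>The exponent k of the distance is shared equally among the coordinates in
    \<open>J\<close>. As there are at least k + 1 of them, each share is at most k / (k + 1), hence
    at most \<theta>.\<close>
  define e where "e b = (if b \<in> J then real k / m else 0)" for b
  define w where "w b = (\<theta> - e b) / real p" for b
  have n: "n = real k + real p + 1" using B(2) by (simp add: n_def)
  have m: "real k + 1 \<le> m" using J(2) unfolding m_def by linarith
  have finJ: "finite J" using J(1) B(1) finite_subset by blast
  have mpos: "0 < m" "0 < n" using m n by linarith+
  have e_le: "e b \<le> \<theta>" for b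
  proof -
    have "real k * n \<le> (n - 1) * (real k + 1)" using B(3) unfolding n by (simp add: algebra_simps)
    also have "\<dots> \<le> (n - 1) * m" using m n by (intro mult_left_mono) auto
    finally have "real k / m \<le> \<theta>" using mpos by (simp add: \<theta>_def field_simps)
    moreover have "0 \<le> \<theta>" using n mpos by (simp add: \<theta>_def)
    ultimately show ?thesis by (simp add: e_def)
  qed
  have w0: "0 \<le> w b" for b using e_le[of b] by (simp add: w_def)
  have sum_e: "(\<Sum>b\<in>B. e b) = real k"
  proof -
    have "(\<Sum>b\<in>B. e b) = (\<Sum>b\<in>B \<inter> J. real k / m)" 
      unfolding e_def by (rule sum.inter_restrict[OF B(1), symmetric])
    also have "B \<inter> J = J" using J(1) by blast
    finally show ?thesis using mpos by (simp add: m_def)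
  qed
  have sum_w: "(\<Sum>b\<in>B. w b) = 1"
  proof -
    have "(\<Sum>b\<in>B. w b) = (n * \<theta> - real k) / real p"
      unfolding w_def by (simp add: sum_divide_distrib[symmetric] sum_subtractf sum_e n_def)
    also have "n * \<theta> = n - 1" using mpos by (simp add: \<theta>_def)
    finally show ?thesis using B(3) n by simp
  qed
  have "d powr - real k = d powr (\<Sum>b\<in>B. - e b)" by (simp add: sum_negf sum_e)
  also have "\<dots> = (\<Prod>b\<in>B. d powr - e b)" using d(1) B(1) by (intro powr_sum) auto
  finally have dk: "d powr - real k = (\<Prod>b\<in>B. d powr - e b)" .
  have "r powr - \<gamma> = r powr (\<Sum>b\<in>B. - (\<gamma> * w b))" by (simp add: sum_negf sum_distrib_left[symmetric] sum_w)
  also have "\<dots> = (\<Prod>b\<in>B. r powr - (\<gamma> * w b))" using r(1) B(1) by (intro powr_sum) auto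
  finally have rk: "r powr - \<gamma> = (\<Prod>b\<in>B. r powr - (\<gamma> * w b))" .
  have "d powr - real k * r powr - \<gamma> = (\<Prod>b\<in>B. d powr - e b * r powr - (\<gamma> * w b))"
    unfolding dk rk by (simp add: prod.distrib)
  also have "\<dots> \<le> (\<Prod>b\<in>B. 1 + \<bar>z b\<bar> powr - \<theta>)"
  proof (rule prod_mono, intro conjI)
    fix b assume b: "b \<in> B"
    show "0 \<le> d powr - e b * r powr - (\<gamma> * w b)" by simp
    have zb: "0 < \<bar>z b\<bar>" using z[OF b] by simp
    have k0: "0 \<le> e b" using mpos by (simp add: e_def)
    have "d powr - e b \<le> \<bar>z b\<bar> powr - e b"
    proof (cases "b \<in> J")
      case True
      then show ?thesis using d zb k0 by (intro powr_mono2') auto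
    qed (use zb d(1) in \<open>simp add: e_def\<close>)
    moreover have "r powr - (\<gamma> * w b) \<le> \<bar>z b\<bar> powr - (\<gamma> * w b)"
      using r(2)[OF b] zb \<gamma>(1) w0[of b] by (intro powr_mono2') auto
    ultimately have "d powr - e b * r powr - (\<gamma> * w b) \<le> \<bar>z b\<bar> powr - e b * \<bar>z b\<bar> powr - (\<gamma> * w b)"
      by (intro mult_mono) auto
    also have "\<dots> = \<bar>z b\<bar> powr - (e b + \<gamma> * w b)" by (simp add: powr_add[symmetric])
    also have "\<dots> \<le> 1 + \<bar>z b\<bar> powr - \<theta>"
    proof (cases "\<bar>z b\<bar> \<le> 1")
      case True
      have "\<gamma> * w b \<le> real p * w b" using \<gamma> w0[of b] by (intro mult_right_mono)
      also have "\<dots> = \<theta> - e b" using B(3) by (simp add: w_def)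
      finally have "\<bar>z b\<bar> powr - (e b + \<gamma> * w b) \<le> \<bar>z b\<bar> powr - \<theta>" using True zb by (intro powr_mono') auto
      then show ?thesis by linarith
    next
      case False
      have "\<bar>z b\<bar> powr - (e b + \<gamma> * w b) \<le> \<bar>z b\<bar> powr 0"
        using False add_nonneg_nonneg[OF k0 mult_nonneg_nonneg[OF \<gamma>(1) w0[of b]]] by (intro powr_mono) auto
      then show ?thesis using zb by (simp add: add_increasing2)
    qed
    finally show "d powr - e b * r powr - (\<gamma> * w b) \<le> 1 + \<bar>z b\<bar> powr - \<theta>" .
  qed
  finally show ?thesis by (simp add: \<theta>_def n_def)
qed

text \<open>The factor contributed by a column \<open>x\<close> given the columns in
  \<open>S\<close>: a power of its distance to their span times a power of its norm. The infinite
  value in the span makes it a true upper bound.\<close>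

definition column_weight :: "nat \<Rightarrow> real \<Rightarrow> 'a::euclidean_space set \<Rightarrow> 'a \<Rightarrow> ennreal" where
  "column_weight k \<gamma> S x = (if perp_part S x = 0 then \<top>
     else ennreal (norm (perp_part S x) powr - real k * norm x powr - \<gamma>))"

text \<open>In coordinates adapted to the span the weight is dominated by a product of
  one-dimensional poles, and the rotated integral factors. Asking for a measurable majorant g avoids
  integrating an expression built on the choice in \<open>perp_part\<close>. The constant is uniform
  in \<open>S\<close>, \<open>y\<close> and \<gamma>, as the induction over columns
  requires.\<close>

lemma column_weight_bound:
  fixes k p :: nat
  assumes dims: "DIM('a::euclidean_space) = k + p + 1" "0 < p"
  obtains C where "0 \<le> C" "\<And>\<gamma> (S :: 'a set) y. 0 \<le> \<gamma> \<Longrightarrow> \<gamma> \<le> real p \<Longrightarrow> dim S \<le> p \<Longrightarrow>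
    \<exists>g\<in>borel_measurable borel. (\<forall>x. column_weight k \<gamma> S x \<le> g x) \<and>
      (\<integral>\<^sup>+x. ennreal (exp (- (norm (x - y))\<^sup>2 / 4)) * g x \<partial>lborel) \<le> ennreal C"
proof -
  define \<theta> where "\<theta> = (real DIM('a) - 1) / real DIM('a)"
  have \<theta>: "0 \<le> \<theta>" "\<theta> < 1" unfolding \<theta>_def by (auto simp: field_simps Suc_leI)
  obtain C where C: "0 \<le> C"
    "\<And>y. (\<integral>\<^sup>+z. ennreal (exp (- (z - y)\<^sup>2 / 4)) * pole \<theta> z \<partial>lborel) \<le> ennreal C"
    using nn_integral_pole_bound[OF \<theta>] by blast
  have "\<exists>g\<in>borel_measurable borel. (\<forall>x. column_weight k \<gamma> S x \<le> g x) \<and>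
      (\<integral>\<^sup>+x. ennreal (exp (- (norm (x - y))\<^sup>2 / 4)) * g x \<partial>lborel) \<le> ennreal (C ^ DIM('a))"
    if \<gamma>: "0 \<le> \<gamma>" "\<gamma> \<le> real p" and S: "dim S \<le> p" for \<gamma> and S :: "'a set" and y
  proof -
    obtain T :: "'a \<Rightarrow> 'a" and J where T: "orthogonal_transformation T" and J: "J \<subseteq> Basis"
      "card J = DIM('a) - dim S" and TJ: "\<And>b v. b \<in> J \<Longrightarrow> v \<in> span S \<Longrightarrow> T b \<bullet> v = 0"
      using orthogonal_transformation_adapted by blast
    have Tin: "T v \<bullet> T w = v \<bullet> w" for v w using T by (simp add: orthogonal_transformation_def)
    have lin: "linear T" using T by (rule orthogonal_transformation_linear)
    define g where "g x = (\<Prod>b\<in>Basis. pole \<theta> (x \<bullet> T b))" for x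
    have gm[measurable]: "g \<in> borel_measurable borel" unfolding g_def by measurable
    have T1: "norm (T b) = 1" if "b \<in> Basis" for b
      using that Tin[of b b] by (simp add: norm_eq_1)
    have le: "column_weight k \<gamma> S x \<le> g x" for x
    proof (cases "\<exists>b\<in>Basis. x \<bullet> T b = 0")
      case True
      then obtain b where b: "b \<in> Basis" "x \<bullet> T b = 0" by blast
      have "(\<Prod>c\<in>Basis - {b}. pole \<theta> (x \<bullet> T c)) \<ge> 1" by (intro prod_ge_1 pole_ge_one)
      then have "g x = \<top>" unfolding g_def using b
        by (subst prod.remove[OF _ b(1)]) (auto simp: pole_def ennreal_top_mult not_one_le_zero)
      then show ?thesis by simp
    next
      case False
      then have z: "\<And>b. b \<in> Basis \<Longrightarrow> x \<bullet> T b \<noteq> 0" by blast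
      have gx: "g x = ennreal (\<Prod>b\<in>Basis. 1 + \<bar>x \<bullet> T b\<bar> powr - \<theta>)"
        unfolding g_def using z by (subst prod_ennreal[symmetric]) (auto simp: pole_def add_nonneg_nonneg intro!: prod.cong)
      have J1: "k + 1 \<le> card J" using J(2) S dims by simp
      then have "J \<noteq> {}" by auto
      then obtain b0 where b0: "b0 \<in> J" by blast
      \<comment> \<open>On coordinates orthogonal to the span, x and its residual agree, so these
        coordinates are bounded by the distance and not only by the norm of x.\<close>
      have proj: "x \<bullet> T b = perp_part S x \<bullet> T b" if "b \<in> J" for b
        using TJ[OF that perp_part(1)[of x S]] by (simp add: inner_diff_right inner_commute)
      have ne: "perp_part S x \<noteq> 0" using z[of b0] b0 J(1) proj[OF b0] by auto
      have xne: "x \<noteq> 0" using z[of b0] b0 J(1) by auto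
      have "norm (perp_part S x) powr - real k * norm x powr - \<gamma>
          \<le> (\<Prod>b\<in>Basis. 1 + \<bar>x \<bullet> T b\<bar> powr - ((real (card (Basis :: 'a set)) - 1) / real (card (Basis :: 'a set))))"
      proof (rule pole_product_bound[where J=J and p=p])
        show "\<bar>x \<bullet> T b\<bar> \<le> norm (perp_part S x)" if "b \<in> J" for b
          using proj[OF that] Cauchy_Schwarz_ineq2[of "perp_part S x" "T b"] T1[of b] that J(1) by auto
        show "\<bar>x \<bullet> T b\<bar> \<le> norm x" if "b \<in> Basis" for b
          using Cauchy_Schwarz_ineq2[of x "T b"] T1[OF that] by simp
      qed (use dims J(1) J1 \<gamma> z ne xne in auto)
      then show ?thesis using ne unfolding gx column_weight_def \<theta>_def by (simp add: ennreal_leI)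
    qed
    obtain y' where y': "T y' = y" using T orthogonal_transformation_surj by (metis surj_def)
    have "(\<integral>\<^sup>+x. ennreal (exp (- (norm (x - y))\<^sup>2 / 4)) * g x \<partial>lborel)
        = (\<integral>\<^sup>+x. ennreal (exp (- (norm (T x - y))\<^sup>2 / 4)) * g (T x) \<partial>lborel)"
      by (rule nn_integral_lborel_orthogonal[OF T, symmetric]) measurable
    also have "\<dots> = (\<integral>\<^sup>+x. (\<Prod>b\<in>Basis. ennreal (exp (- ((x \<bullet> b) - (y' \<bullet> b))\<^sup>2 / 4)) * pole \<theta> (x \<bullet> b)) \<partial>lborel)"
    proof (rule nn_integral_cong)
      fix x
      have "norm (T x - y) = norm (x - y')"
        unfolding y'[symmetric] linear_diff[OF lin, symmetric] by (rule orthogonal_transformation_norm[OF T])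
      moreover have "ennreal (exp (- (norm (x - y'))\<^sup>2 / 4)) = (\<Prod>b\<in>Basis. ennreal (exp (- ((x \<bullet> b) - (y' \<bullet> b))\<^sup>2 / 4)))"
        unfolding exp_quarter_norm_prod inner_diff_left by (rule prod_ennreal[symmetric]) simp
      ultimately show "ennreal (exp (- (norm (T x - y))\<^sup>2 / 4)) * g (T x)
         = (\<Prod>b\<in>Basis. ennreal (exp (- ((x \<bullet> b) - (y' \<bullet> b))\<^sup>2 / 4)) * pole \<theta> (x \<bullet> b))"
        by (simp add: g_def Tin prod.distrib)
    qed
    also have "\<dots> = (\<Prod>b\<in>Basis. \<integral>\<^sup>+z. ennreal (exp (- (z - (y' \<bullet> b))\<^sup>2 / 4)) * pole \<theta> z \<partial>lborel)"
      by (rule nn_integral_lborel_prod) (auto intro: borel_measurable_times_ennreal)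
    also have "\<dots> \<le> (\<Prod>b\<in>(Basis :: 'a set). ennreal C)" 
      by (rule prod_mono_ennreal) (rule C(2))
    also have "\<dots> = ennreal (C ^ DIM('a))" using C(1) by (simp add: ennreal_power)
    finally show ?thesis using le gm by (intro bexI[of _ g]) auto
  qed
  then show ?thesis using C(1) by (intro that[of "C ^ DIM('a)"]) auto
qed

text \<open>The prior as an extended real function of the columns, infinite on dependent families. A
  finite integral of it shows in addition that dependent families form a null set.\<close>

definition gram_weight :: "nat \<Rightarrow> ('p::finite \<Rightarrow> real) \<Rightarrow> 'p set \<Rightarrow> ('p \<Rightarrow> 'a::euclidean_space) \<Rightarrow> ennreal" where
  "gram_weight k \<gamma> I c = (if gram I c = 0 then \<top>
     else ennreal (gram I c powr (- real k / 2) * (\<Prod>i\<in>I. norm (c i) powr - \<gamma> i)))"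

lemma gram_weight_measurable[measurable]:
  "gram_weight k \<gamma> I \<in> borel_measurable (Pi\<^sub>M I (\<lambda>_. lborel :: 'a::euclidean_space measure))"
  unfolding gram_weight_def by measurable

text \<open>For independent families this is the factorisation of the Gram determinant. In the
  degenerate cases the right side must be infinite, so the other factor has to be nonzero.\<close>

lemma gram_weight_insert:
  assumes i: "i \<notin> I"
  shows "gram_weight k \<gamma> (insert i I) (x(i := z)) \<le> gram_weight k \<gamma> I x * column_weight k (\<gamma> i) (x ` I) z"
proof -
  let ?c = "x(i := z)" and ?p = "perp_part (x ` I) z"
  have im: "?c ` I = x ` I" using i by auto
  have g: "gram (insert i I) ?c = (norm ?p)\<^sup>2 * gram I x"
  proof -
    have "gram I ?c = gram I x" by (rule gram_cong) (use i in auto)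
    then show ?thesis using gram_insert[OF i, of ?c] unfolding im by simp
  qed
  have pr: "(\<Prod>j\<in>I. norm (?c j) powr - \<gamma> j) = (\<Prod>j\<in>I. norm (x j) powr - \<gamma> j)"
    using i by (intro prod.cong) auto
  show ?thesis
  proof (cases "?p = 0")
    case True
    \<comment> \<open>Excludes the product of 0 and infinity, which is 0 in
      \<open>ennreal\<close>.\<close>
    have "gram_weight k \<gamma> I x \<noteq> 0"
    proof (cases "gram I x = 0")
      case False
      then have "\<And>j. j \<in> I \<Longrightarrow> x j \<noteq> 0" using gram_zero_column by blast
      then show ?thesis using False gram_nonneg[of I x]
        by (auto simp: gram_weight_def not_le ennreal_eq_0_iff intro!: mult_pos_pos prod_pos)
    qed (simp add: gram_weight_def)
    then show ?thesis using True by (simp add: column_weight_def ennreal_mult_top)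
  next
    case False
    then have zne: "z \<noteq> 0" using perp_part_norm_le[of "x ` I" z] by auto
    show ?thesis
    proof (cases "gram I x = 0")
      case True
      have "0 < norm ?p powr - real k * norm z powr - \<gamma> i" using False zne by simp
      then show ?thesis using True False zne by (simp add: gram_weight_def column_weight_def ennreal_top_mult)
    next
      case g0: False
      have gp: "0 < gram I x" using g0 gram_nonneg[of I x] by simp
      have "((norm ?p)\<^sup>2 * gram I x) powr (- real k / 2) = norm ?p powr - real k * gram I x powr (- real k / 2)"
        using False gp by (simp add: powr_mult powr_powr flip: powr_numeral)
      then show ?thesis using False g0 i
        by (simp add: gram_weight_def column_weight_def g pr[unfolded fun_upd_apply] ennreal_mult[symmetric] prod_nonneg ac_simps)
    qed
  qed
qed

text \<open>The newest column is integrated first with the others fixed. Its bound does not depend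
  on their span, so each column contributes one factor \<open>C\<close>.\<close>

lemma gram_weight_integral_bound:
  fixes k p :: nat and \<gamma> :: "'p::finite \<Rightarrow> real"
  assumes dims: "DIM('a::euclidean_space) = k + CARD('p) + 1" and \<gamma>: "\<And>i. 0 \<le> \<gamma> i \<and> \<gamma> i \<le> real CARD('p)"
  obtains C where "0 \<le> C" "\<And>y :: 'p \<Rightarrow> 'a. (\<integral>\<^sup>+c. (\<Prod>i\<in>UNIV. ennreal (exp (- (norm (c i - y i))\<^sup>2 / 4)))
     * gram_weight k \<gamma> UNIV c \<partial>Pi\<^sub>M UNIV (\<lambda>_. lborel)) \<le> ennreal C"
proof -
  obtain C where C: "0 \<le> C" "\<And>\<gamma> (S :: 'a set) y. 0 \<le> \<gamma> \<Longrightarrow> \<gamma> \<le> real CARD('p) \<Longrightarrow> dim S \<le> CARD('p) \<Longrightarrow>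
    \<exists>g\<in>borel_measurable borel. (\<forall>x. column_weight k \<gamma> S x \<le> g x) \<and>
      (\<integral>\<^sup>+x. ennreal (exp (- (norm (x - y))\<^sup>2 / 4)) * g x \<partial>lborel) \<le> ennreal C"
    using column_weight_bound[OF dims] by auto
  interpret product_sigma_finite "\<lambda>_::'p. lborel :: 'a measure" ..
  have "(\<integral>\<^sup>+c. (\<Prod>i\<in>I. ennreal (exp (- (norm (c i - y i))\<^sup>2 / 4)))
     * gram_weight k \<gamma> I c \<partial>Pi\<^sub>M I (\<lambda>_. lborel)) \<le> ennreal (C ^ card I)" for y :: "'p \<Rightarrow> 'a" and I
    using finite[of I]
  proof induction
    case empty
    show ?case by (simp add: PiM_empty nn_integral_count_space_finite gram_weight_def gram_empty)
  next
    case (insert i I)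
    let ?E = "\<lambda>i x. ennreal (exp (- (norm (x - y i))\<^sup>2 / 4))"
    have "(\<integral>\<^sup>+c. (\<Prod>j\<in>insert i I. ?E j (c j)) * gram_weight k \<gamma> (insert i I) c \<partial>Pi\<^sub>M (insert i I) (\<lambda>_. lborel))
      = (\<integral>\<^sup>+x. (\<integral>\<^sup>+z. (\<Prod>j\<in>insert i I. ?E j ((x(i := z)) j)) * gram_weight k \<gamma> (insert i I) (x(i := z)) \<partial>lborel) \<partial>Pi\<^sub>M I (\<lambda>_. lborel))"
      by (intro product_nn_integral_insert insert.hyps) measurable
    also have "\<dots> \<le> (\<integral>\<^sup>+x. ((\<Prod>j\<in>I. ?E j (x j)) * gram_weight k \<gamma> I x) * ennreal C \<partial>Pi\<^sub>M I (\<lambda>_. lborel))"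
    proof (rule nn_integral_mono)
      fix x :: "'p \<Rightarrow> 'a"
      have "dim (x ` I) \<le> CARD('p)"
        using dim_le_card'[of "x ` I"] card_image_le[of I x] card_mono[of UNIV I] by simp
      then obtain g where g[measurable]: "g \<in> borel_measurable borel" and
          le: "\<And>z. column_weight k (\<gamma> i) (x ` I) z \<le> g z" and
          int: "(\<integral>\<^sup>+z. ?E i z * g z \<partial>lborel) \<le> ennreal C"
        using C(2)[of "\<gamma> i" "x ` I" "y i"] \<gamma>[of i] by blast
      let ?w = "(\<Prod>j\<in>I. ?E j (x j)) * gram_weight k \<gamma> I x"
      have "(\<integral>\<^sup>+z. (\<Prod>j\<in>insert i I. ?E j ((x(i := z)) j)) * gram_weight k \<gamma> (insert i I) (x(i := z)) \<partial>lborel)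
        \<le> (\<integral>\<^sup>+z. ?w * (?E i z * g z) \<partial>lborel)"
      proof (rule nn_integral_mono)
        fix z
        have "(\<Prod>j\<in>I. ?E j ((x(i := z)) j)) = (\<Prod>j\<in>I. ?E j (x j))" using insert.hyps by (intro prod.cong) auto
        then have pe: "(\<Prod>j\<in>insert i I. ?E j ((x(i := z)) j)) = ?E i z * (\<Prod>j\<in>I. ?E j (x j))"
          using insert.hyps by simp
        have gl: "gram_weight k \<gamma> (insert i I) (x(i := z)) \<le> gram_weight k \<gamma> I x * g z"
          by (rule order_trans[OF gram_weight_insert[OF insert.hyps(2)]]) (intro mult_left_mono le zero_le)
        have "(\<Prod>j\<in>insert i I. ?E j ((x(i := z)) j)) * gram_weight k \<gamma> (insert i I) (x(i := z))
          \<le> (?E i z * (\<Prod>j\<in>I. ?E j (x j))) * (gram_weight k \<gamma> I x * g z)"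
          unfolding pe by (intro mult_left_mono gl zero_le)
        then show "(\<Prod>j\<in>insert i I. ?E j ((x(i := z)) j)) * gram_weight k \<gamma> (insert i I) (x(i := z)) \<le> ?w * (?E i z * g z)"
          by (simp only: ac_simps)
      qed
      also have "\<dots> = ?w * (\<integral>\<^sup>+z. ?E i z * g z \<partial>lborel)" by (rule nn_integral_cmult) measurable
      also have "\<dots> \<le> ?w * ennreal C" by (intro mult_left_mono int zero_le)
      finally show "(\<integral>\<^sup>+z. (\<Prod>j\<in>insert i I. ?E j ((x(i := z)) j)) * gram_weight k \<gamma> (insert i I) (x(i := z)) \<partial>lborel) \<le> ?w * ennreal C" .
    qed
    also have "\<dots> = (\<integral>\<^sup>+x. (\<Prod>j\<in>I. ?E j (x j)) * gram_weight k \<gamma> I x \<partial>Pi\<^sub>M I (\<lambda>_. lborel)) * ennreal C"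
      by (rule nn_integral_multc) measurable
    also have "\<dots> \<le> ennreal (C ^ card I) * ennreal C" by (intro mult_right_mono insert.IH zero_le)
    also have "\<dots> = ennreal (C ^ card (insert i I))" using insert.hyps C(1) by (simp add: ennreal_mult[symmetric] ac_simps)
    finally show ?case .
  qed
  from this[of UNIV] show ?thesis using C(1) by (intro that[of "C ^ CARD('p)"]) auto
qed

section \<open>Matrices as families of columns\<close>

definition of_columns :: "('p::finite \<Rightarrow> real^'n) \<Rightarrow> real^'p^'n" where
  "of_columns c = (\<chi> a i. c i $ a)"

lemma column_of_columns[simp]: "column i (of_columns c) = c i"
  by (simp add: of_columns_def column_def vec_eq_iff)

lemma matrix_Basis: "(Basis :: (real^'p::finite^'n::finite) set) = (\<lambda>(a, i). axis a (axis i 1)) ` UNIV"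
  by (auto simp: Basis_vec_def image_iff)

lemma axis_axis_in_Basis: "axis a (axis i 1) \<in> (Basis :: (real^'p::finite^'n::finite) set)"
  unfolding matrix_Basis by (rule image_eqI[of _ _ "(a, i)"]) auto

lemma matrix_Basis_inj: "inj (\<lambda>(a::'n::finite, i::'p::finite). axis a (axis i (1::real)))"
  by (auto simp: inj_on_def axis_eq_axis axis_eq_0_iff)

lemma inner_matrix_axis: "(A :: real^'p::finite^'n::finite) \<bullet> axis a (axis i 1) = A $ a $ i"
  by (simp add: inner_axis)

lemma prod_matrix_Basis:
  fixes f :: "real^'p::finite^'n::finite \<Rightarrow> 'b::comm_monoid_mult"
  shows "(\<Prod>b\<in>Basis. f b) = (\<Prod>i\<in>UNIV. \<Prod>a\<in>UNIV. f (axis a (axis i 1)))"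
proof -
  have "(\<Prod>b\<in>Basis. f b) = (\<Prod>(a, i)\<in>UNIV. f (axis a (axis i 1)))"
    unfolding matrix_Basis by (subst prod.reindex[OF matrix_Basis_inj]) (simp add: case_prod_unfold)
  also have "\<dots> = (\<Prod>a\<in>UNIV. \<Prod>i\<in>UNIV. f (axis a (axis i 1)))"
    by (simp add: prod.cartesian_product)
  finally show ?thesis by (simp add: prod.swap[of _ "UNIV :: 'n set"])
qed

lemma of_columns_measurable[measurable]:
  "of_columns \<in> Pi\<^sub>M UNIV (\<lambda>_. lborel) \<rightarrow>\<^sub>M (borel :: (real^'p::finite^'n::finite) measure)"
proof (subst borel_measurable_euclidean_space, safe)
  fix b :: "real^'p^'n" assume "b \<in> Basis"
  then obtain a i where b: "b = axis a (axis i 1)" by (auto simp: matrix_Basis)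
  have "(\<lambda>c. c i \<bullet> axis a 1) \<in> borel_measurable (Pi\<^sub>M UNIV (\<lambda>_::'p. lborel :: (real^'n) measure))"
    by measurable
  then show "(\<lambda>c. of_columns c \<bullet> b) \<in> borel_measurable (Pi\<^sub>M UNIV (\<lambda>_. lborel))"
    unfolding b inner_matrix_axis of_columns_def by (simp add: inner_axis)
qed

text \<open>Lets matrix integrals be computed column by column; Lebesgue measure is characterised by
  its values on boxes, and a matrix box is a product of column boxes.\<close>

lemma lborel_columns:
  "lborel = distr (Pi\<^sub>M UNIV (\<lambda>_::'p::finite. lborel :: (real^'n::finite) measure)) borel of_columns"
proof (rule lborel_eqI)
  interpret product_sigma_finite "\<lambda>_::'p. lborel :: (real^'n) measure" ..
  fix l u :: "real^'p^'n" assume le: "\<And>b. b \<in> Basis \<Longrightarrow> l \<bullet> b \<le> u \<bullet> b"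
  have lea: "l $ a $ i \<le> u $ a $ i" for a i
    using le[OF axis_axis_in_Basis, of a i] by (simp add: inner_matrix_axis)
  have "of_columns -` box l u \<inter> space (Pi\<^sub>M UNIV (\<lambda>_::'p. lborel :: (real^'n) measure))
     = Pi\<^sub>E UNIV (\<lambda>i. box (column i l) (column i u))"
    by (auto simp: mem_box_cart space_PiM PiE_def Pi_def box_def Basis_vec_def inner_axis of_columns_def column_def
        axis_eq_axis)
  then have "emeasure (distr (Pi\<^sub>M UNIV (\<lambda>_::'p. lborel :: (real^'n) measure)) borel of_columns) (box l u)
    = emeasure (Pi\<^sub>M UNIV (\<lambda>_::'p. lborel)) (Pi\<^sub>E UNIV (\<lambda>i. box (column i l) (column i u)))"
    by (subst emeasure_distr) auto
  also have "\<dots> = (\<Prod>i\<in>UNIV. emeasure lborel (box (column i l) (column i u)))"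
    by (rule emeasure_PiM) auto
  also have "\<dots> = (\<Prod>i\<in>UNIV. ennreal (\<Prod>b\<in>Basis. (column i u - column i l) \<bullet> b))"
    by (intro prod.cong refl emeasure_lborel_box) (auto simp: Basis_vec_def inner_axis column_def lea)
  also have "\<dots> = (\<Prod>i\<in>UNIV. ennreal (\<Prod>a\<in>UNIV. (u - l) $ a $ i))"
  proof (intro prod.cong refl arg_cong[where f=ennreal])
    fix i
    have B: "(Basis :: (real^'n) set) = (\<lambda>a. axis a 1) ` UNIV" by (auto simp: Basis_vec_def)
    have inj: "inj (\<lambda>a::'n. axis a (1::real))" by (auto simp: inj_on_def axis_eq_axis)
    show "(\<Prod>b\<in>Basis. (column i u - column i l) \<bullet> b) = (\<Prod>a\<in>UNIV. (u - l) $ a $ i)"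
      unfolding B by (subst prod.reindex[OF inj]) (simp add: inner_axis column_def)
  qed
  also have "\<dots> = ennreal (\<Prod>b\<in>Basis. (u - l) \<bullet> b)"
    unfolding prod_matrix_Basis using lea by (subst prod_ennreal) (auto simp: inner_matrix_axis intro!: prod_nonneg)
  finally show "emeasure (distr (Pi\<^sub>M UNIV (\<lambda>_::'p. lborel :: (real^'n) measure)) borel of_columns) (box l u)
    = ennreal (\<Prod>b\<in>Basis. (u - l) \<bullet> b)" .
qed simp

lemma norm_matrix_columns:
  fixes A :: "real^'p::finite^'n::finite"
  shows "(norm A)\<^sup>2 = (\<Sum>i\<in>UNIV. (norm (column i A))\<^sup>2)"
proof -
  have "(norm A)\<^sup>2 = (\<Sum>a\<in>UNIV. \<Sum>i\<in>UNIV. (A $ a $ i)\<^sup>2)"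
    unfolding power2_norm_eq_inner by (simp add: inner_vec_def power2_eq_square)
  also have "\<dots> = (\<Sum>i\<in>UNIV. \<Sum>a\<in>UNIV. (A $ a $ i)\<^sup>2)" by (rule sum.swap)
  finally show ?thesis unfolding power2_norm_eq_inner by (simp add: inner_vec_def power2_eq_square column_def)
qed

lemma column_measurable[measurable]: "column i \<in> borel_measurable (borel :: (real^'p::finite^'n::finite) measure)"
proof (rule borel_measurable_continuous_onI)
  have "linear (column i :: real^'p^'n \<Rightarrow> real^'n)" by (rule linearI) (auto simp: column_def vec_eq_iff)
  then show "continuous_on UNIV (column i :: real^'p^'n \<Rightarrow> real^'n)"
    by (simp add: linear_continuous_on linear_conv_bounded_linear)
qed

lemma gram_columns_measurable[measurable]:
  "(\<lambda>A. gram UNIV (\<lambda>i. column i A)) \<in> borel_measurable (borel :: (real^'p::finite^'n::finite) measure)"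
  unfolding gram_def det_def by simp measurable

lemma matrix_gram_weight_bound:
  fixes k :: nat and \<gamma> :: "'p::finite \<Rightarrow> real"
  assumes dims: "CARD('n::finite) = k + CARD('p) + 1" and \<gamma>: "\<And>i. 0 \<le> \<gamma> i \<and> \<gamma> i \<le> real CARD('p)"
  shows "\<exists>C\<ge>0. \<forall>Y :: real^'p^'n. (\<integral>\<^sup>+A. ennreal (exp (- (norm (A - Y))\<^sup>2 / 4))
     * gram_weight k \<gamma> UNIV (\<lambda>i. column i A) \<partial>lborel) \<le> ennreal C"
proof -
  obtain C where C: "0 \<le> C" "\<And>y :: 'p \<Rightarrow> real^'n. (\<integral>\<^sup>+c. (\<Prod>i\<in>UNIV. ennreal (exp (- (norm (c i - y i))\<^sup>2 / 4)))
     * gram_weight k \<gamma> UNIV c \<partial>Pi\<^sub>M UNIV (\<lambda>_. lborel)) \<le> ennreal C"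
    using gram_weight_integral_bound[of k \<gamma>, where 'a="real^'n"] dims \<gamma> by auto
  have m: "(\<lambda>A. ennreal (exp (- (norm (A - Y))\<^sup>2 / 4)) * gram_weight k \<gamma> UNIV (\<lambda>i. column i A))
      \<in> borel_measurable borel" for Y :: "real^'p^'n"
    unfolding gram_weight_def by measurable
  have "(\<integral>\<^sup>+A. ennreal (exp (- (norm (A - Y))\<^sup>2 / 4)) * gram_weight k \<gamma> UNIV (\<lambda>i. column i A) \<partial>lborel) \<le> ennreal C"
    for Y :: "real^'p^'n"
  proof -
    have "exp (- (norm (of_columns c - Y))\<^sup>2 / 4) = (\<Prod>i\<in>UNIV. exp (- (norm (c i - column i Y))\<^sup>2 / 4))" for c
    proof -
      have "column i (of_columns c - Y) = c i - column i Y" for i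
        by (simp add: vec_eq_iff column_def of_columns_def)
      then show ?thesis by (simp add: norm_matrix_columns sum_negf sum_divide_distrib flip: exp_sum)
    qed
    then show ?thesis using C(2)[of "\<lambda>i. column i Y"]
      by (subst lborel_columns, subst nn_integral_distr) (use m in \<open>auto simp: prod_ennreal\<close>)
  qed
  with C(1) show ?thesis by (intro exI[of _ C]) simp
qed

section \<open>Calculus of second order expansions\<close>

text \<open>The additive counterpart of \<open>log_taylor2\<close>, with gradient and Hessian of
  \<open>f\<close> itself. It also applies to functions vanishing at \<open>M\<close>, such as
  matrix entries, from which the determinant is assembled.\<close>

definition taylor2 ::
    "('a::euclidean_space \<Rightarrow> real) \<Rightarrow> 'a \<Rightarrow> 'a \<Rightarrow> ('a \<Rightarrow> 'a \<Rightarrow> real) \<Rightarrow> bool" where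
  "taylor2 f M a Q \<longleftrightarrow> bilinear Q \<and> (\<forall>v w. Q v w = Q w v) \<and>
    (\<lambda>v. f (M + v) - f M - a \<bullet> v - Q v v / 2) \<in> o[nhds 0](\<lambda>v. (norm v)\<^sup>2)"

lemma smallo_norm_square_iff:
  fixes r :: "'a::real_normed_vector \<Rightarrow> real"
  shows "r \<in> o[nhds 0](\<lambda>v. (norm v)\<^sup>2) \<longleftrightarrow>
    (\<forall>\<epsilon>>0. \<exists>\<delta>>0. \<forall>v. norm v < \<delta> \<longrightarrow> \<bar>r v\<bar> \<le> \<epsilon> * (norm v)\<^sup>2)"
  by (simp add: smallo_def eventually_nhds_metric dist_norm)

lemma log_taylor2_iff:
  "log_taylor2 f M u H \<longleftrightarrow> 0 < f M \<and> bilinear H \<and> (\<forall>v w. H v w = H w v) \<and>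
    (\<lambda>v. f (M + v) - f M * (1 + u \<bullet> v + (H v v + (u \<bullet> v)\<^sup>2) / 2)) \<in> o[nhds 0](\<lambda>v. (norm v)\<^sup>2)"
  unfolding log_taylor2_def smallo_norm_square_iff ..

lemma inner_smallo: "(\<lambda>v::'a::real_inner. a \<bullet> v) \<in> o[nhds 0](\<lambda>_. 1)"
proof (rule smalloI_tendsto)
  have "((\<lambda>v. a \<bullet> v) \<longlongrightarrow> a \<bullet> 0) (nhds 0)" by (intro tendsto_inner tendsto_const filterlim_ident)
  then show "((\<lambda>v. (a \<bullet> v) / 1) \<longlongrightarrow> 0) (nhds 0)" by simp
qed simp

lemma bilinear_bigo:
  fixes Q :: "'a::euclidean_space \<Rightarrow> 'a \<Rightarrow> real"
  assumes "bilinear Q"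
  shows "(\<lambda>v. Q v v) \<in> O[nhds 0](\<lambda>v. (norm v)\<^sup>2)"
proof -
  obtain B where B: "0 < B" "\<And>v w. \<bar>Q v w\<bar> \<le> B * norm v * norm w"
    using bilinear_bounded_pos[OF assms] by auto
  show ?thesis
    by (rule bigoI[of _ B]) (use B in \<open>auto simp: power2_eq_square mult.assoc\<close>)
qed

lemma norm_square_smallo: "(\<lambda>v::'a::real_normed_vector. (norm v)\<^sup>2) \<in> o[nhds 0](\<lambda>_. 1 :: real)"
proof (rule smalloI_tendsto)
  have "((\<lambda>v::'a. (norm v)\<^sup>2) \<longlongrightarrow> (norm (0::'a))\<^sup>2) (nhds 0)"
    by (intro tendsto_power tendsto_norm filterlim_ident)
  then show "((\<lambda>v::'a. (norm v)\<^sup>2 / 1) \<longlongrightarrow> 0) (nhds 0)" by simp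
qed simp

lemma inner_bigo: "(\<lambda>v::'a::real_inner. a \<bullet> v) \<in> O[nhds 0](\<lambda>v. norm v)"
  by (rule bigoI[of _ "norm a"]) (auto simp: Cauchy_Schwarz_ineq2)

text \<open>The expansions of two factors, or of the inner function of a composition, are first
  rewritten in this form, which no longer mentions the base point.\<close>
lemma expansion_mult:
  fixes l q r l' q' r' :: "'a::euclidean_space \<Rightarrow> real"
  assumes l: "l \<in> o[nhds 0](\<lambda>_. 1)" "l' \<in> o[nhds 0](\<lambda>_. 1)"
    and q: "q \<in> O[nhds 0](\<lambda>v. (norm v)\<^sup>2)" "q' \<in> O[nhds 0](\<lambda>v. (norm v)\<^sup>2)"
    and r: "r \<in> o[nhds 0](\<lambda>v. (norm v)\<^sup>2)" "r' \<in> o[nhds 0](\<lambda>v. (norm v)\<^sup>2)"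
  shows "(\<lambda>v. (c + l v + q v + r v) * (c' + l' v + q' v + r' v)
      - (c * c' + (c * l' v + c' * l v) + (c * q' v + c' * q v + l v * l' v))) \<in> o[nhds 0](\<lambda>v. (norm v)\<^sup>2)"
proof -
  have qs: "q \<in> o[nhds 0](\<lambda>_. 1)" "q' \<in> o[nhds 0](\<lambda>_. 1)"
    using q norm_square_smallo landau_o.big_small_trans by blast+
  have rs: "r \<in> o[nhds 0](\<lambda>_. 1)" "r' \<in> o[nhds 0](\<lambda>_. 1)"
    using r norm_square_smallo landau_o.small_trans by blast+
  have 1: "(\<lambda>v. l v * q' v) \<in> o[nhds 0](\<lambda>v. (norm v)\<^sup>2)" using landau_o.small_big_mult[OF l(1) q(2)] by simp
  have 2: "(\<lambda>v. l' v * q v) \<in> o[nhds 0](\<lambda>v. (norm v)\<^sup>2)" using landau_o.small_big_mult[OF l(2) q(1)] by simp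
  have 3: "(\<lambda>v. q v * q' v) \<in> o[nhds 0](\<lambda>v. (norm v)\<^sup>2)" using landau_o.small_big_mult[OF qs(1) q(2)] by simp
  have cst: "(\<lambda>_. x) \<in> O[nhds 0](\<lambda>_::'a. 1 :: real)" for x :: real by (cases "x = 0") auto
  have g1: "(\<lambda>v. c' + l' v + q' v + r' v) \<in> O[nhds 0](\<lambda>_. 1)"
    by (intro sum_in_bigo landau_o.small_imp_big l qs rs cst)
  have g2: "(\<lambda>v. c + l v + q v) \<in> O[nhds 0](\<lambda>_. 1)"
    by (intro sum_in_bigo landau_o.small_imp_big l qs rs cst)
  have 4: "(\<lambda>v. r v * (c' + l' v + q' v + r' v)) \<in> o[nhds 0](\<lambda>v. (norm v)\<^sup>2)"
    using landau_o.small_big_mult[OF r(1) g1] by simp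
  have 5: "(\<lambda>v. r' v * (c + l v + q v)) \<in> o[nhds 0](\<lambda>v. (norm v)\<^sup>2)"
    using landau_o.small_big_mult[OF r(2) g2] by simp
  have "(\<lambda>v. l v * q' v + l' v * q v + q v * q' v + r v * (c' + l' v + q' v + r' v) + r' v * (c + l v + q v))
     \<in> o[nhds 0](\<lambda>v. (norm v)\<^sup>2)"
    by (intro sum_in_smallo 1 2 3 4 5)
  then show ?thesis by (rule landau_o.small.in_cong[THEN iffD1, rotated]) (auto simp: algebra_simps)
qed

lemma expansion_compose:
  fixes l q r :: "'a::euclidean_space \<Rightarrow> real" and \<phi> :: "real \<Rightarrow> real"
  assumes l: "l \<in> O[nhds 0](\<lambda>v. norm v)" and q: "q \<in> O[nhds 0](\<lambda>v. (norm v)\<^sup>2)"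
    and r: "r \<in> o[nhds 0](\<lambda>v. (norm v)\<^sup>2)"
    and \<phi>: "(\<lambda>t. \<phi> (c + t) - (\<phi> c + p1 * t + p2 / 2 * t\<^sup>2)) \<in> o[nhds 0](\<lambda>t. t\<^sup>2)"
  shows "(\<lambda>v. \<phi> (c + (l v + q v + r v)) - (\<phi> c + p1 * l v + (p1 * q v + p2 / 2 * (l v)\<^sup>2))) \<in> o[nhds 0](\<lambda>v. (norm v)\<^sup>2)"
proof -
  let ?t = "\<lambda>v. l v + q v + r v"
  have n1: "(\<lambda>v::'a. (norm v)\<^sup>2) \<in> O[nhds 0](\<lambda>v. norm v)"
  proof (rule bigoI[of _ 1])
    have "\<forall>\<^sub>F v in nhds (0::'a). norm v < 1"
      unfolding eventually_nhds_metric by (auto simp: dist_norm intro!: exI[of _ 1])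
    then show "\<forall>\<^sub>F v in nhds (0::'a). norm ((norm v)\<^sup>2) \<le> 1 * norm (norm v)"
      by eventually_elim (auto simp: power2_eq_square mult_left_le_one_le)
  qed
  have n0: "(\<lambda>v::'a. norm v) \<in> o[nhds 0](\<lambda>_. 1 :: real)"
  proof (rule smalloI_tendsto)
    have "((\<lambda>v::'a. norm v) \<longlongrightarrow> norm (0::'a)) (nhds 0)" by (intro tendsto_norm filterlim_ident)
    then show "((\<lambda>v::'a. norm v / 1) \<longlongrightarrow> 0) (nhds 0)" by simp
  qed simp
  have t: "?t \<in> O[nhds 0](\<lambda>v. norm v)"
    using landau_o.big_trans[OF q n1] landau_o.big_trans[OF landau_o.small_imp_big[OF r] n1]
    by (intro sum_in_bigo l)
  have t0: "(?t \<longlongrightarrow> 0) (nhds 0)"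
    using smalloD_tendsto[OF landau_o.big_small_trans[OF t n0]] by simp
  have t2: "(\<lambda>v. (?t v)\<^sup>2) \<in> O[nhds 0](\<lambda>v. (norm v)\<^sup>2)" by (rule landau_o.big_power[OF t])
  have "(\<lambda>v. \<phi> (c + ?t v) - (\<phi> c + p1 * ?t v + p2 / 2 * (?t v)\<^sup>2)) \<in> o[nhds 0](\<lambda>v. (?t v)\<^sup>2)"
    using landau_o.small.compose[OF \<phi> t0] by (simp add: o_def)
  then have 1: "(\<lambda>v. \<phi> (c + ?t v) - (\<phi> c + p1 * ?t v + p2 / 2 * (?t v)\<^sup>2)) \<in> o[nhds 0](\<lambda>v. (norm v)\<^sup>2)"
    using t2 by (rule landau_o.small_big_trans)
  have 2: "(\<lambda>v. p1 * r v) \<in> o[nhds 0](\<lambda>v. (norm v)\<^sup>2)" using r by (cases "p1 = 0") auto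
  \<comment> \<open>Replacing the square of the full increment t by that of its linear part l
    changes it by (t + l) (q + r), where the first factor tends to 0 and the second is
    O(|v|^2).\<close>
  have s: "(\<lambda>v. ?t v + l v) \<in> o[nhds 0](\<lambda>_. 1)"
    by (rule landau_o.big_small_trans[OF _ n0]) (rule sum_in_bigo[OF t l])
  have "(\<lambda>v. (?t v + l v) * (q v + r v)) \<in> o[nhds 0](\<lambda>v. 1 * (norm v)\<^sup>2)"
    by (rule landau_o.small_big_mult[OF s]) (rule sum_in_bigo[OF q landau_o.small_imp_big[OF r]])
  then have 3: "(\<lambda>v. p2 / 2 * ((?t v + l v) * (q v + r v))) \<in> o[nhds 0](\<lambda>v. (norm v)\<^sup>2)"
    by (cases "p2 = 0") auto
  have "(\<lambda>v. (\<phi> (c + ?t v) - (\<phi> c + p1 * ?t v + p2 / 2 * (?t v)\<^sup>2)) + p1 * r v + p2 / 2 * ((?t v + l v) * (q v + r v)))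
     \<in> o[nhds 0](\<lambda>v. (norm v)\<^sup>2)"
    by (intro sum_in_smallo 1 2 3)
  then show ?thesis
    by (rule landau_o.small.in_cong[THEN iffD1, rotated]) (auto simp: algebra_simps power2_eq_square)
qed

text \<open>Differentiability of \<phi>' at c makes the derivative of the remainder o(t); the mean
  value inequality between 0 and t raises this to o(t^2).\<close>

lemma peano_second_order:
  fixes \<phi> \<phi>' :: "real \<Rightarrow> real"
  assumes "0 < \<rho>" and d: "\<And>x. \<bar>x - c\<bar> < \<rho> \<Longrightarrow> (\<phi> has_real_derivative \<phi>' x) (at x)"
    and d2: "(\<phi>' has_real_derivative p2) (at c)"
  shows "(\<lambda>t. \<phi> (c + t) - (\<phi> c + \<phi>' c * t + p2 / 2 * t\<^sup>2)) \<in> o[nhds 0](\<lambda>t. t\<^sup>2)"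
proof -
  let ?h = "\<lambda>t. \<phi> (c + t) - (\<phi> c + \<phi>' c * t + p2 / 2 * t\<^sup>2)"
  let ?h' = "\<lambda>t. \<phi>' (c + t) - (\<phi>' c + p2 * t)"
  have "\<exists>\<delta>>0. \<forall>t. norm t < \<delta> \<longrightarrow> \<bar>?h t\<bar> \<le> \<epsilon> * (norm t)\<^sup>2" if \<epsilon>: "0 < \<epsilon>" for \<epsilon>
  proof -
    have "((\<lambda>t. (\<phi>' (c + t) - \<phi>' c) / t) \<longlongrightarrow> p2) (at 0)" using d2 by (simp add: DERIV_def)
    then obtain \<delta> where \<delta>: "0 < \<delta>" "\<And>t. t \<noteq> 0 \<Longrightarrow> \<bar>t\<bar> < \<delta> \<Longrightarrow> \<bar>(\<phi>' (c + t) - \<phi>' c) / t - p2\<bar> < \<epsilon>"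
      using \<epsilon> by (auto simp: LIM_def dist_real_def)
    have h': "\<bar>?h' t\<bar> \<le> \<epsilon> * \<bar>t\<bar>" if "\<bar>t\<bar> < \<delta>" for t
    proof (cases "t = 0")
      case False
      have "?h' t = ((\<phi>' (c + t) - \<phi>' c) / t - p2) * t" using False by (simp add: field_simps)
      then have "\<bar>?h' t\<bar> = \<bar>(\<phi>' (c + t) - \<phi>' c) / t - p2\<bar> * \<bar>t\<bar>" by (simp add: abs_mult)
      then show ?thesis using \<delta>(2)[OF False that] by (simp add: mult_right_mono less_imp_le)
    qed simp
    have "\<bar>?h t\<bar> \<le> \<epsilon> * (norm t)\<^sup>2" if t: "norm t < min \<delta> \<rho>" for t
    proof -
      have "norm (?h t - ?h 0) \<le> (\<epsilon> * \<bar>t\<bar>) * norm (t - 0)"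
      proof (rule field_differentiable_bound[where S="cball 0 \<bar>t\<bar>" and f'="?h'"])
        fix z :: real assume "z \<in> cball 0 \<bar>t\<bar>"
        then have z: "\<bar>z\<bar> \<le> \<bar>t\<bar>" by simp
        have "((\<lambda>t. \<phi> (c + t)) has_real_derivative \<phi>' (c + z)) (at z)"
          using d[of "c + z"] z t DERIV_shift[of \<phi> "\<phi>' (c + z)" z c] by (simp add: add.commute)
        then have "(?h has_real_derivative \<phi>' (c + z) - (0 + \<phi>' c * 1 + p2 / 2 * (2 * z))) (at z)"
          by (auto intro!: derivative_eq_intros)
        then show "(?h has_field_derivative ?h' z) (at z within cball 0 \<bar>t\<bar>)"
          by (auto intro: has_field_derivative_at_within)
        have "\<epsilon> * \<bar>z\<bar> \<le> \<epsilon> * \<bar>t\<bar>" using z \<epsilon> by simp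
        then show "norm (?h' z) \<le> \<epsilon> * \<bar>t\<bar>" using h'[of z] z t by simp
      qed auto
      then show ?thesis by (simp add: power2_eq_square)
    qed
    then show ?thesis using \<delta>(1) \<open>0 < \<rho>\<close> by (intro exI[of _ "min \<delta> \<rho>"]) auto
  qed
  then show ?thesis using smallo_norm_square_iff[of ?h] by simp
qed

lemma powr_second_order:
  assumes "0 < (c::real)"
  shows "(\<lambda>t. (c + t) powr \<alpha> - (c powr \<alpha> + (\<alpha> * c powr (\<alpha> - 1)) * t + (\<alpha> * (\<alpha> - 1) * c powr (\<alpha> - 2)) / 2 * t\<^sup>2))
     \<in> o[nhds 0](\<lambda>t. t\<^sup>2)"
proof (rule peano_second_order[where \<rho>=c and \<phi>="\<lambda>x. x powr \<alpha>" and \<phi>'="\<lambda>x. \<alpha> * x powr (\<alpha> - 1)"])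
  fix x assume "\<bar>x - c\<bar> < c"
  then have "0 < x" by linarith
  then show "((\<lambda>x. x powr \<alpha>) has_real_derivative \<alpha> * x powr (\<alpha> - 1)) (at x)"
    by (rule has_real_derivative_powr)
next
  have "((\<lambda>x. x powr (\<alpha> - 1)) has_real_derivative (\<alpha> - 1) * c powr (\<alpha> - 1 - 1)) (at c)"
    using assms by (rule has_real_derivative_powr)
  from DERIV_cmult[OF this, of \<alpha>]
  show "((\<lambda>x. \<alpha> * x powr (\<alpha> - 1)) has_real_derivative \<alpha> * (\<alpha> - 1) * c powr (\<alpha> - 2)) (at c)"
    by (simp add: mult.assoc)
qed (use assms in auto)

section \<open>Algebra of expansions\<close>

lemma taylor2_const: "taylor2 (\<lambda>_. c) M 0 (\<lambda>_ _. 0)"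
  by (simp add: taylor2_def bilinear_def linear_iff)

lemma taylor2_inner: "taylor2 (\<lambda>x. x \<bullet> b) M b (\<lambda>_ _. 0)"
  by (simp add: taylor2_def bilinear_def linear_iff inner_add_left inner_commute[of b])

lemma taylor2_add:
  assumes "taylor2 f M a Q" "taylor2 g M b R"
  shows "taylor2 (\<lambda>x. f x + g x) M (a + b) (\<lambda>v w. Q v w + R v w)"
proof -
  have b: "bilinear (\<lambda>v w. Q v w + R v w)"
    using assms unfolding taylor2_def bilinear_def by (auto intro: linear_compose_add)
  have "(\<lambda>v. (f (M + v) - f M - a \<bullet> v - Q v v / 2) + (g (M + v) - g M - b \<bullet> v - R v v / 2)) \<in> o[nhds 0](\<lambda>v. (norm v)\<^sup>2)"
    by (rule sum_in_smallo(1)) (use assms in \<open>unfold taylor2_def, blast+\<close>)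
  then have "(\<lambda>v. f (M + v) + g (M + v) - (f M + g M) - (a + b) \<bullet> v - (Q v v + R v v) / 2) \<in> o[nhds 0](\<lambda>v. (norm v)\<^sup>2)"
    by (rule landau_o.small.in_cong[THEN iffD1, rotated]) (auto simp: inner_add_left algebra_simps add_divide_distrib)
  with b show ?thesis using assms by (simp add: taylor2_def)
qed

lemma bilinear_inner_mult: "bilinear (\<lambda>v w. (a \<bullet> v) * (b \<bullet> w) :: real)"
  unfolding bilinear_def by (auto intro!: linearI simp: inner_add_right algebra_simps)

lemma bilinear_cmult: "bilinear (Q :: 'a::real_vector \<Rightarrow> 'b::real_vector \<Rightarrow> real) \<Longrightarrow> bilinear (\<lambda>v w. c * Q v w)"
  unfolding bilinear_def by (auto simp: linear_iff algebra_simps)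

lemma bilinear_add:
  "bilinear Q \<Longrightarrow> bilinear R \<Longrightarrow> bilinear (\<lambda>v w. Q v w + R v w :: real)"
  unfolding bilinear_def by (auto intro: linear_compose_add)

text \<open>The product rule; the mixed term is symmetrised because \<open>taylor2\<close> asks for
  a symmetric form.\<close>

lemma taylor2_mult:
  assumes f: "taylor2 f M a Q" and g: "taylor2 g M b R"
  shows "taylor2 (\<lambda>x. f x * g x) M (f M *\<^sub>R b + g M *\<^sub>R a)
    (\<lambda>v w. f M * R v w + g M * Q v w + ((a \<bullet> v) * (b \<bullet> w) + (b \<bullet> v) * (a \<bullet> w)))"
proof -
  have bil: "bilinear Q" "bilinear R" using f g by (auto simp: taylor2_def)
  define r where "r v = f (M + v) - f M - a \<bullet> v - Q v v / 2" for v
  define r' where "r' v = g (M + v) - g M - b \<bullet> v - R v v / 2" for v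
  have "(\<lambda>v. (f M + a \<bullet> v + Q v v / 2 + r v) * (g M + b \<bullet> v + R v v / 2 + r' v)
      - (f M * g M + (f M * (b \<bullet> v) + g M * (a \<bullet> v)) + (f M * (R v v / 2) + g M * (Q v v / 2) + (a \<bullet> v) * (b \<bullet> v))))
     \<in> o[nhds 0](\<lambda>v. (norm v)\<^sup>2)"
    using f g bilinear_bigo[OF bil(1)] bilinear_bigo[OF bil(2)]
    by (intro expansion_mult inner_smallo) (auto simp: taylor2_def r_def r'_def)
  then have "(\<lambda>v. f (M + v) * g (M + v) - f M * g M - (f M *\<^sub>R b + g M *\<^sub>R a) \<bullet> v -
       (f M * R v v + g M * Q v v + ((a \<bullet> v) * (b \<bullet> v) + (b \<bullet> v) * (a \<bullet> v))) / 2) \<in> o[nhds 0](\<lambda>v. (norm v)\<^sup>2)"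
    by (rule landau_o.small.in_cong[THEN iffD1, rotated])
      (auto simp: r_def r'_def inner_add_left algebra_simps add_divide_distrib)
  moreover have "bilinear (\<lambda>v w. f M * R v w + g M * Q v w + ((a \<bullet> v) * (b \<bullet> w) + (b \<bullet> v) * (a \<bullet> w)))"
    by (intro bilinear_add bilinear_cmult bil bilinear_inner_mult)
  ultimately show ?thesis using f g by (auto simp: taylor2_def)
qed

lemma taylor2_sum_ex:
  assumes "\<And>i. i \<in> I \<Longrightarrow> \<exists>a Q. taylor2 (f i) M a Q"
  shows "\<exists>a Q. taylor2 (\<lambda>x. \<Sum>i\<in>I. f i x) M a Q"
  using assms
proof (induction I rule: infinite_finite_induct)
  case (insert i I)
  then obtain a Q b R where "taylor2 (f i) M a Q" "taylor2 (\<lambda>x. \<Sum>i\<in>I. f i x) M b R" by blast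
  from taylor2_add[OF this] insert.hyps show ?case by auto
qed (auto intro: taylor2_const)

lemma taylor2_prod_ex:
  assumes "\<And>i. i \<in> I \<Longrightarrow> \<exists>a Q. taylor2 (f i) M a Q"
  shows "\<exists>a Q. taylor2 (\<lambda>x. \<Prod>i\<in>I. f i x) M a Q"
  using assms
proof (induction I rule: infinite_finite_induct)
  case (insert i I)
  then obtain a Q b R where "taylor2 (f i) M a Q" "taylor2 (\<lambda>x. \<Prod>i\<in>I. f i x) M b R" by blast
  from taylor2_mult[OF this] insert.hyps show ?case by auto
qed (auto intro: taylor2_const)

text \<open>The derivatives of ln f are u = a / f and H = Q / f - u u^T.\<close>

lemma taylor2_imp_log_taylor2:
  assumes f: "taylor2 f M a Q" and pos: "0 < f M"
  shows "\<exists>u H. log_taylor2 f M u H"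
proof -
  define u where "u = (1 / f M) *\<^sub>R a"
  define H where "H v w = 1 / f M * Q v w + - 1 * ((u \<bullet> v) * (u \<bullet> w))" for v w
  have "bilinear H" unfolding H_def using f
    by (intro bilinear_add bilinear_cmult bilinear_inner_mult) (simp add: taylor2_def)
  moreover have e: "f (M + v) - f M * (1 + u \<bullet> v + (H v v + (u \<bullet> v)\<^sup>2) / 2) = f (M + v) - f M - a \<bullet> v - Q v v / 2" for v
    using pos by (simp add: H_def u_def field_simps power2_eq_square)
  moreover have "H v w = H w v" for v w using f by (simp add: H_def taylor2_def mult.commute)
  ultimately have "log_taylor2 f M u H" 
    using f pos unfolding log_taylor2_iff e taylor2_def by blast
  then show ?thesis by blast
qed

lemma log_taylor2_one: "log_taylor2 (\<lambda>_. 1) M 0 (\<lambda>_ _. 0)"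
  by (simp add: log_taylor2_iff bilinear_def linear_iff)

lemma log_taylor2_mult:
  assumes f: "log_taylor2 f M u H" and g: "log_taylor2 g M u' H'"
  shows "log_taylor2 (\<lambda>x. f x * g x) M (u + u') (\<lambda>v w. H v w + H' v w)"
proof -
  have pos: "0 < f M" "0 < g M" and bil: "bilinear H" "bilinear H'" using f g by (auto simp: log_taylor2_iff)
  let ?q = "\<lambda>v. f M * ((H v v + (u \<bullet> v)\<^sup>2) / 2)" and ?q' = "\<lambda>v. g M * ((H' v v + (u' \<bullet> v)\<^sup>2) / 2)"
  define r where "r v = f (M + v) - f M * (1 + u \<bullet> v + (H v v + (u \<bullet> v)\<^sup>2) / 2)" for v
  define r' where "r' v = g (M + v) - g M * (1 + u' \<bullet> v + (H' v v + (u' \<bullet> v)\<^sup>2) / 2)" for v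
  have q: "?q \<in> O[nhds 0](\<lambda>v. (norm v)\<^sup>2)" "?q' \<in> O[nhds 0](\<lambda>v. (norm v)\<^sup>2)"
    using bilinear_bigo[OF bilinear_add[OF bil(1) bilinear_inner_mult[of u u]]]
      bilinear_bigo[OF bilinear_add[OF bil(2) bilinear_inner_mult[of u' u']]] pos
    by (auto simp: power2_eq_square)
  have "(\<lambda>v. (f M + f M * (u \<bullet> v) + ?q v + r v) * (g M + g M * (u' \<bullet> v) + ?q' v + r' v)
      - (f M * g M + (f M * (g M * (u' \<bullet> v)) + g M * (f M * (u \<bullet> v)))
        + (f M * ?q' v + g M * ?q v + (f M * (u \<bullet> v)) * (g M * (u' \<bullet> v))))) \<in> o[nhds 0](\<lambda>v. (norm v)\<^sup>2)"
    using f g q pos inner_smallo[of u] inner_smallo[of u']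
    by (intro expansion_mult) (auto simp: log_taylor2_iff r_def r'_def)
  then have "(\<lambda>v. f (M + v) * g (M + v) - (f M * g M) * (1 + (u + u') \<bullet> v + (H v v + H' v v + ((u + u') \<bullet> v)\<^sup>2) / 2))
       \<in> o[nhds 0](\<lambda>v. (norm v)\<^sup>2)"
    by (rule landau_o.small.in_cong[THEN iffD1, rotated])
      (auto simp: r_def r'_def inner_add_left algebra_simps add_divide_distrib power2_eq_square)
  then show ?thesis using f g bilinear_add[OF bil] pos by (auto simp: log_taylor2_iff)
qed

lemma log_taylor2_prod:
  assumes "finite I" "\<And>i. i \<in> I \<Longrightarrow> log_taylor2 (f i) M (u i) (H i)"
  shows "log_taylor2 (\<lambda>x. \<Prod>i\<in>I. f i x) M (\<Sum>i\<in>I. u i) (\<lambda>v w. \<Sum>i\<in>I. H i v w)"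
  using assms
proof induction
  case empty
  show ?case using log_taylor2_one by simp
next
  case (insert i I)
  then have "log_taylor2 (\<lambda>x. f i x * (\<Prod>i\<in>I. f i x)) M (u i + (\<Sum>i\<in>I. u i)) (\<lambda>v w. H i v w + (\<Sum>i\<in>I. H i v w))"
    by (intro log_taylor2_mult) auto
  then show ?case using insert.hyps by simp
qed

text \<open>The coefficient of (u . v)^2 / 2 is \<alpha> from the first derivative of the power plus
  \<alpha> (\<alpha> - 1) from the second, in total the \<alpha>^2 demanded by the square of the new
  gradient.\<close>

lemma log_taylor2_powr:
  assumes f: "log_taylor2 f M u H"
  shows "log_taylor2 (\<lambda>x. f x powr \<alpha>) M (\<alpha> *\<^sub>R u) (\<lambda>v w. \<alpha> * H v w)"
proof -
  have pos: "0 < f M" and bil: "bilinear H" using f by (auto simp: log_taylor2_iff)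
  let ?c = "f M"
  let ?q = "\<lambda>v. ?c * ((H v v + (u \<bullet> v)\<^sup>2) / 2)"
  let ?p1 = "\<alpha> * ?c powr (\<alpha> - 1)" and ?p2 = "\<alpha> * (\<alpha> - 1) * ?c powr (\<alpha> - 2)"
  define r where "r v = f (M + v) - ?c * (1 + u \<bullet> v + (H v v + (u \<bullet> v)\<^sup>2) / 2)" for v
  have q: "?q \<in> O[nhds 0](\<lambda>v. (norm v)\<^sup>2)"
    using bilinear_bigo[OF bilinear_add[OF bil bilinear_inner_mult[of u u]]] pos by (auto simp: power2_eq_square)
  have 0: "(\<lambda>v. (?c + (?c * (u \<bullet> v) + ?q v + r v)) powr \<alpha>
      - (?c powr \<alpha> + ?p1 * (?c * (u \<bullet> v)) + (?p1 * ?q v + ?p2 / 2 * (?c * (u \<bullet> v))\<^sup>2))) \<in> o[nhds 0](\<lambda>v. (norm v)\<^sup>2)"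
    by (rule expansion_compose[OF _ q _ powr_second_order[OF pos]])
      (use f pos inner_bigo[of u] in \<open>auto simp: log_taylor2_iff r_def\<close>)
  have c1: "?c powr (\<alpha> - 1) * ?c = ?c powr \<alpha>" using pos by (simp add: powr_diff)
  have c2: "?c powr (\<alpha> - 2) * (?c * ?c) = ?c powr \<alpha>"
    using pos by (simp add: powr_diff power2_eq_square)
  have "?c powr \<alpha> + ?p1 * (?c * (u \<bullet> v)) + (?p1 * ?q v + ?p2 / 2 * (?c * (u \<bullet> v))\<^sup>2)
     = ?c powr \<alpha> * (1 + (\<alpha> *\<^sub>R u) \<bullet> v + (\<alpha> * H v v + ((\<alpha> *\<^sub>R u) \<bullet> v)\<^sup>2) / 2)" for v
  proof -
    have "?c powr \<alpha> + ?p1 * (?c * (u \<bullet> v)) + (?p1 * ?q v + ?p2 / 2 * (?c * (u \<bullet> v))\<^sup>2)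
     = ?c powr \<alpha> + \<alpha> * (?c powr (\<alpha> - 1) * ?c) * (u \<bullet> v) + (\<alpha> * (?c powr (\<alpha> - 1) * ?c) * ((H v v + (u \<bullet> v)\<^sup>2) / 2)
        + \<alpha> * (\<alpha> - 1) * (?c powr (\<alpha> - 2) * (?c * ?c)) / 2 * (u \<bullet> v)\<^sup>2)"
      by (simp add: power2_eq_square algebra_simps)
    also have "\<dots> = ?c powr \<alpha> * (1 + (\<alpha> *\<^sub>R u) \<bullet> v + (\<alpha> * H v v + ((\<alpha> *\<^sub>R u) \<bullet> v)\<^sup>2) / 2)"
      unfolding c1 c2 by (simp add: power2_eq_square field_simps)
    finally show ?thesis .
  qed
  then have "(\<lambda>v. f (M + v) powr \<alpha> - ?c powr \<alpha> * (1 + (\<alpha> *\<^sub>R u) \<bullet> v + (\<alpha> * H v v + ((\<alpha> *\<^sub>R u) \<bullet> v)\<^sup>2) / 2))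
     \<in> o[nhds 0](\<lambda>v. (norm v)\<^sup>2)"
    by (intro landau_o.small.in_cong[THEN iffD1, OF _ 0]) (auto simp: r_def algebra_simps)
  then show ?thesis using f pos bilinear_cmult[OF bil, of \<alpha>] by (auto simp: log_taylor2_iff)
qed

text \<open>Makes it possible to compute a gradient whose existence alone is known, by
  differentiating along a line.\<close>

lemma log_taylor2_directional_derivative:
  assumes f: "log_taylor2 f M u H"
  shows "((\<lambda>t. f (M + t *\<^sub>R v)) has_real_derivative f M * (u \<bullet> v)) (at 0)"
proof -
  have bil: "bilinear H" using f by (auto simp: log_taylor2_iff)
  define r where "r w = f (M + w) - f M * (1 + u \<bullet> w + (H w w + (u \<bullet> w)\<^sup>2) / 2)" for w
  have r: "r \<in> o[nhds 0](\<lambda>w. (norm w)\<^sup>2)" 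
    using f unfolding log_taylor2_iff r_def[abs_def] by blast
  have "((\<lambda>t. t *\<^sub>R v) \<longlongrightarrow> 0 *\<^sub>R v) (at 0)" by (intro tendsto_intros)
  then have "filterlim (\<lambda>t::real. t *\<^sub>R v) (nhds 0) (at 0)" by simp
  from landau_o.small.compose[OF r this]
  have "(\<lambda>t. r (t *\<^sub>R v)) \<in> o[at 0](\<lambda>t. t\<^sup>2 * (norm v)\<^sup>2)" by (simp add: o_def power_mult_distrib)
  also have "(\<lambda>t. t\<^sup>2 * (norm v)\<^sup>2) \<in> O[at 0](\<lambda>t::real. t)"
  proof (rule bigoI[of _ "(norm v)\<^sup>2"])
    have "\<forall>\<^sub>F t in at (0::real). \<bar>t\<bar> < 1"
      unfolding eventually_at by (auto simp: dist_real_def intro!: exI[of _ 1])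
    then show "\<forall>\<^sub>F t in at (0::real). norm (t\<^sup>2 * (norm v)\<^sup>2) \<le> (norm v)\<^sup>2 * norm t"
    proof eventually_elim
      case (elim t)
      then have "\<bar>t\<bar> * \<bar>t\<bar> \<le> 1 * \<bar>t\<bar>" by (intro mult_right_mono) auto
      then have "t\<^sup>2 \<le> \<bar>t\<bar>" by (simp add: power2_eq_square)
      then have "t\<^sup>2 * (norm v)\<^sup>2 \<le> \<bar>t\<bar> * (norm v)\<^sup>2" by (intro mult_right_mono) auto
      then show ?case by (simp add: abs_mult mult.commute)
    qed
  qed
  finally have "((\<lambda>t. r (t *\<^sub>R v) / t) \<longlongrightarrow> 0) (at 0)" by (rule smalloD_tendsto)
  then have "((\<lambda>t. r (t *\<^sub>R v) / t + f M * (u \<bullet> v + t * ((H v v + (u \<bullet> v)\<^sup>2) / 2))) \<longlongrightarrow>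
      0 + f M * (u \<bullet> v + 0 * ((H v v + (u \<bullet> v)\<^sup>2) / 2))) (at 0)"
    by (intro tendsto_intros)
  moreover have "\<forall>\<^sub>F t in at 0. r (t *\<^sub>R v) / t + f M * (u \<bullet> v + t * ((H v v + (u \<bullet> v)\<^sup>2) / 2))
      = (f (M + t *\<^sub>R v) - f M) / t"
  proof (rule eventually_mono[OF eventually_neq_at_within])
    fix t :: real assume t: "t \<noteq> 0"
    have "H (t *\<^sub>R v) (t *\<^sub>R v) = t\<^sup>2 * H v v"
      using bil by (simp add: bilinear_lmul bilinear_rmul power2_eq_square)
    then show "r (t *\<^sub>R v) / t + f M * (u \<bullet> v + t * ((H v v + (u \<bullet> v)\<^sup>2) / 2)) = (f (M + t *\<^sub>R v) - f M) / t"
      using t by (simp add: r_def field_simps power2_eq_square)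
  qed
  ultimately show ?thesis by (simp add: DERIV_def filterlim_cong)
qed

section \<open>The matrix risk\<close>

lemma normal_density_scaled:
  assumes "0 < N"
  shows "normal_density \<mu> (1 / sqrt N) x = sqrt N * std_normal_density (sqrt N * (x - \<mu>))"
proof -
  have "sqrt (2 * pi * (1 / sqrt N)\<^sup>2) = sqrt (2 * pi) / sqrt N"
    using assms by (simp add: real_sqrt_mult real_sqrt_divide power_divide)
  then show ?thesis using assms
    by (simp add: normal_density_def std_normal_density_def power_divide power_mult_distrib)
qed

lemma lik_eq_gauss:
  fixes M Y :: "real^'p::finite^'n::finite"
  assumes N: "0 < N"
  shows "lik N M Y = sqrt N ^ DIM(real^'p^'n) * gauss_dens (sqrt N *\<^sub>R (Y - M))"
proof -
  have "lik N M Y = (\<Prod>i\<in>UNIV. \<Prod>a\<in>UNIV. sqrt N * std_normal_density (sqrt N * (Y $ a $ i - M $ a $ i)))"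
    unfolding lik_def normal_density_scaled[OF N] by (rule prod.swap)
  also have "\<dots> = (\<Prod>b\<in>(Basis :: (real^'p^'n) set). sqrt N * std_normal_density ((sqrt N *\<^sub>R (Y - M)) \<bullet> b))"
    unfolding prod_matrix_Basis by (simp add: inner_matrix_axis)
  also have "\<dots> = sqrt N ^ DIM(real^'p^'n) * gauss_dens (sqrt N *\<^sub>R (Y - M))"
    unfolding gauss_dens_prod by (simp only: prod.distrib prod_constant)
  finally show ?thesis .
qed

text \<open>As a function of the parameter the likelihood is a normal density centred at the data,
  so one standardisation serves both the posterior and the risk.\<close>

lemma lik_commute: "lik N M Y = lik N Y M"
  unfolding lik_def normal_density_def by (simp add: power2_commute)

lemma lik_measurable:
  fixes M :: "real^'p::finite^'n::finite"
  assumes "0 < N"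
  shows "lik N M \<in> borel_measurable borel"
proof -
  have "lik N M = (\<lambda>Y. sqrt N ^ DIM(real^'p^'n) * gauss_dens (sqrt N *\<^sub>R (Y - M)))"
    by (rule ext) (rule lik_eq_gauss[OF assms])
  also have "\<dots> \<in> borel_measurable borel" by measurable
  finally show ?thesis .
qed

lemma integral_lik:
  fixes F :: "real^'p::finite^'n::finite \<Rightarrow> 'b::{banach, second_countable_topology}"
  assumes N: "0 < N" and F[measurable]: "F \<in> borel_measurable borel"
  shows "(\<integral>Y. lik N M Y *\<^sub>R F Y \<partial>lborel) = (\<integral>Z. F (M + (1 / sqrt N) *\<^sub>R Z) \<partial>gauss)"
proof -
  define s where "s = 1 / sqrt N"
  have s: "0 < s" "s \<noteq> 0" and Ns: "sqrt N * s = 1" using N by (auto simp: s_def)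
  have [measurable]: "lik N M \<in> borel_measurable borel" using N by (rule lik_measurable)
  have "(\<integral>Y. lik N M Y *\<^sub>R F Y \<partial>lborel)
     = (\<integral>Z. (\<bar>s\<bar> ^ DIM(real^'p^'n)) *\<^sub>R (lik N M (M + s *\<^sub>R Z) *\<^sub>R F (M + s *\<^sub>R Z)) \<partial>lborel)"
    by (subst lborel_affine[OF s(2), of M], subst integral_density) (auto simp: integral_distr)
  also have "\<dots> = (\<integral>Z. gauss_dens Z *\<^sub>R F (M + s *\<^sub>R Z) \<partial>lborel)"
  proof (intro Bochner_Integration.integral_cong refl)
    fix Z :: "real^'p^'n"
    have "\<bar>s\<bar> ^ DIM(real^'p^'n) * lik N M (M + s *\<^sub>R Z) = (sqrt N * s) ^ DIM(real^'p^'n) * gauss_dens ((sqrt N * s) *\<^sub>R Z)"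
      unfolding lik_eq_gauss[OF N] using s by (simp add: power_mult_distrib)
    then show "(\<bar>s\<bar> ^ DIM(real^'p^'n)) *\<^sub>R (lik N M (M + s *\<^sub>R Z) *\<^sub>R F (M + s *\<^sub>R Z)) = gauss_dens Z *\<^sub>R F (M + s *\<^sub>R Z)"
      unfolding Ns by (simp del: DIM_cart)
  qed
  also have "\<dots> = (\<integral>Z. F (M + s *\<^sub>R Z) \<partial>gauss)"
    unfolding gauss_def by (subst integral_density) auto
  finally show ?thesis by (simp add: s_def)
qed

lemma matrix_eq_sum_axis:
  fixes g :: "'n::finite \<Rightarrow> 'p::finite \<Rightarrow> real"
  shows "(\<chi> i j. g i j) = (\<Sum>i\<in>UNIV. \<Sum>j\<in>UNIV. g i j *\<^sub>R axis i (axis j 1))"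
proof -
  have "(\<Sum>x\<in>UNIV. \<Sum>y\<in>UNIV. g x y *\<^sub>R axis x (axis y 1)) $ i $ j = g i j" for i j
  proof -
    have "(\<Sum>x\<in>UNIV. \<Sum>y\<in>UNIV. g x y *\<^sub>R axis x (axis y 1)) $ i $ j
       = (\<Sum>x\<in>UNIV. \<Sum>y\<in>UNIV. g x y * (axis x (axis y 1) $ i $ j))" by simp
    also have "\<dots> = (\<Sum>x\<in>UNIV. if i = x then (\<Sum>y\<in>UNIV. if j = y then g x y else 0) else 0)"
      by (intro sum.cong refl) (auto simp: axis_def if_distrib[of "\<lambda>z. g _ _ * z"] cong: if_cong)
    finally show ?thesis by simp
  qed
  then show ?thesis by (simp add: vec_eq_iff)
qed

context
  fixes \<pi> :: "real^'p::finite^'n::finite \<Rightarrow> real" and M u H k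
  assumes tp: "taylor_prior \<pi> M u H k"
begin

interpretation P: taylor_prior \<pi> M u H k by (rule tp)

text \<open>Substituting A = Y + s W turns the posterior mean into Y + s \<open>num\<close> /
  \<open>den\<close>, which is the shift up to one more factor s.\<close>

lemma gen_bayes_component:
  assumes N: "1 \<le> N" and b: "b \<in> Basis" and s: "s = 1 / sqrt N"
  shows "(gen_bayes \<pi> N (M + s *\<^sub>R Z) - M) \<bullet> b = s * (Z \<bullet> b) + s\<^sup>2 * P.mean_shift b s Z"
proof -
  have s01: "0 < s" "s \<le> 1" and N0: "0 < N" using N by (auto simp: s)
  let ?Y = "M + s *\<^sub>R Z"
  have eq: "M + s *\<^sub>R (Z + W) = ?Y + s *\<^sub>R W" for W by (simp add: scaleR_add_right add.assoc)
  have marg: "marginal \<pi> N ?Y = P.den s Z"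
  proof -
    have "marginal \<pi> N ?Y = (\<integral>A. lik N ?Y A *\<^sub>R \<pi> A \<partial>lborel)"
      unfolding marginal_def by (subst lik_commute) simp
    also have "\<dots> = P.den s Z" unfolding P.den_def eq unfolding s by (rule integral_lik[OF N0]) measurable
    finally show ?thesis .
  qed
  have D: "0 < P.den s Z" using s01 by (rule P.den_pos)
  have i0: "integrable gauss (\<lambda>W. \<pi> (?Y + s *\<^sub>R W))"
    using P.prior_poly_integrable[OF s01, of 0 Z] by (simp add: eq)
  \<comment> \<open>A Bochner integral that does not exist has the default value 0, so integrability
    is what makes \<open>gen_bayes\<close> the posterior mean and permits taking coordinates
    inside.\<close>
  have i1: "integrable gauss (\<lambda>W. \<pi> (?Y + s *\<^sub>R W) *\<^sub>R (?Y + s *\<^sub>R W))"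
  proof (rule Bochner_Integration.integrable_bound)
    show "integrable gauss (\<lambda>W. (norm ?Y + 1) * ((1 + norm W) ^ 1 * \<pi> (?Y + s *\<^sub>R W)))"
      using P.prior_poly_integrable[OF s01, of 1 Z] unfolding eq by (rule integrable_mult_right)
    show "AE W in gauss. norm (\<pi> (?Y + s *\<^sub>R W) *\<^sub>R (?Y + s *\<^sub>R W))
        \<le> norm ((norm ?Y + 1) * ((1 + norm W) ^ 1 * \<pi> (?Y + s *\<^sub>R W)))"
    proof (rule AE_I2)
      fix W
      have "norm (?Y + s *\<^sub>R W) \<le> norm ?Y + s * norm W"
        using norm_triangle_ineq[of ?Y "s *\<^sub>R W"] s01 by simp
      also have "\<dots> \<le> norm ?Y + norm W" using s01 by (simp add: mult_left_le_one_le)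
      also have "\<dots> \<le> (norm ?Y + 1) * (1 + norm W)" by (simp add: algebra_simps)
      finally have "\<pi> (?Y + s *\<^sub>R W) * norm (?Y + s *\<^sub>R W) \<le> \<pi> (?Y + s *\<^sub>R W) * ((norm ?Y + 1) * (1 + norm W))"
        using P.prior_nonneg by (intro mult_left_mono) auto
      then show "norm (\<pi> (?Y + s *\<^sub>R W) *\<^sub>R (?Y + s *\<^sub>R W))
        \<le> norm ((norm ?Y + 1) * ((1 + norm W) ^ 1 * \<pi> (?Y + s *\<^sub>R W)))"
        using P.prior_nonneg by (simp add: abs_mult ac_simps)
    qed
  qed measurable
  have "(\<integral>A. (lik N A ?Y * \<pi> A) *\<^sub>R A \<partial>lborel) = (\<integral>W. \<pi> (?Y + s *\<^sub>R W) *\<^sub>R (?Y + s *\<^sub>R W) \<partial>gauss)"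
  proof -
    have "(\<integral>A. (lik N A ?Y * \<pi> A) *\<^sub>R A \<partial>lborel) = (\<integral>A. lik N ?Y A *\<^sub>R (\<pi> A *\<^sub>R A) \<partial>lborel)"
      by (subst lik_commute) simp
    also have "\<dots> = (\<integral>W. \<pi> (?Y + s *\<^sub>R W) *\<^sub>R (?Y + s *\<^sub>R W) \<partial>gauss)"
      unfolding s by (rule integral_lik[OF N0]) measurable
    finally show ?thesis .
  qed
  then have "(\<integral>A. (lik N A ?Y * \<pi> A) *\<^sub>R A \<partial>lborel) \<bullet> b
      = (\<integral>W. (\<pi> (?Y + s *\<^sub>R W) *\<^sub>R (?Y + s *\<^sub>R W)) \<bullet> b \<partial>gauss)"
    using integral_inner_left[of b gauss, OF i1] by simp
  also have "\<dots> = (\<integral>W. (?Y \<bullet> b) * \<pi> (?Y + s *\<^sub>R W) + s * ((W \<bullet> b) * \<pi> (?Y + s *\<^sub>R W)) \<partial>gauss)"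
    by (intro Bochner_Integration.integral_cong) (auto simp: inner_add_left algebra_simps)
  also have "\<dots> = (?Y \<bullet> b) * P.den s Z + s * P.num b s Z"
  proof -
    have "integrable gauss (\<lambda>W. (W \<bullet> b) * \<pi> (?Y + s *\<^sub>R W))"
      using P.prior_poly_integrable[OF s01, of 1 Z] unfolding eq
      by (rule Bochner_Integration.integrable_bound)
        (auto simp: abs_mult intro!: mult_mono order_trans[OF Basis_le_norm[OF b]])
    then show ?thesis using i0 unfolding P.den_def P.num_def eq by simp
  qed
  finally show ?thesis unfolding gen_bayes_def marg P.mean_shift_def using D s01
    by (simp add: inner_diff_left inner_add_left field_simps power2_eq_square)
qed

lemma mat_loss_entry:
  fixes A :: "real^'p::finite^'n::finite"
  shows "mat_loss A M $ i $ j = (\<Sum>a\<in>UNIV. ((A - M) \<bullet> axis a (axis i 1)) * ((A - M) \<bullet> axis a (axis j 1)))"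
  by (simp add: mat_loss_def matrix_matrix_mult_def transpose_def inner_matrix_axis)

lemma mat_risk_entry:
  assumes N: "1 \<le> N" and s: "s = 1 / sqrt N"
  shows "mat_risk (gen_bayes \<pi>) N M $ i $ j = (\<Sum>a\<in>UNIV. \<integral>Z.
     (s * (Z \<bullet> axis a (axis i 1)) + s\<^sup>2 * P.mean_shift (axis a (axis i 1)) s Z)
      * (s * (Z \<bullet> axis a (axis j 1)) + s\<^sup>2 * P.mean_shift (axis a (axis j 1)) s Z) \<partial>gauss)"
proof -
  have s01: "0 < s" "s \<le> 1" and N0: "0 < N" using N by (auto simp: s)
  define e where "e b Z = s * (Z \<bullet> b) + s\<^sup>2 * P.mean_shift b s Z" for b Z
  have [measurable]: "e b \<in> borel_measurable borel" for b unfolding e_def by measurable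
  define F :: "real^'p^'n \<Rightarrow> real^'p^'p" where
    "F Z = (\<chi> i j. \<Sum>a\<in>UNIV. e (axis a (axis i 1)) Z * e (axis a (axis j 1)) Z)" for Z
  \<comment> \<open>Written as a finite sum of scalar functions times fixed matrices, F inherits
    integrability and measurability from its entries.\<close>
  have F_alt: "F Z = (\<Sum>i\<in>UNIV. \<Sum>j\<in>UNIV. (\<Sum>a\<in>UNIV. e (axis a (axis i 1)) Z * e (axis a (axis j 1)) Z) *\<^sub>R axis i (axis j 1))" for Z
    unfolding F_def by (rule matrix_eq_sum_axis)
  have ei: "integrable gauss (\<lambda>Z. \<Sum>a\<in>UNIV. e (axis a (axis i 1)) Z * e (axis a (axis j 1)) Z)" for i j
    unfolding e_def using P.has_integral_risk[OF axis_axis_in_Basis axis_axis_in_Basis s01]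
    by (intro Bochner_Integration.integrable_sum) (auto simp: has_bochner_integral_iff)
  have Fi: "integrable gauss F"
    unfolding F_alt by (intro Bochner_Integration.integrable_sum integrable_scaleR_left ei)
  have Fm[measurable]: "F \<in> borel_measurable borel" unfolding F_alt by measurable
  have loss: "mat_loss (gen_bayes \<pi> N (M + s *\<^sub>R Z)) M = F Z" for Z
    by (simp add: vec_eq_iff mat_loss_entry F_def e_def gen_bayes_component[OF N axis_axis_in_Basis s])
  \<comment> \<open>The loss is a measurable function of the standardised data; this settles its
    measurability in Y, which the change of variables requires.\<close>
  have "mat_loss (gen_bayes \<pi> N Y) M = F ((1 / s) *\<^sub>R (Y - M))" for Y
    using loss[of "(1 / s) *\<^sub>R (Y - M)"] s01 by simp
  then have [measurable]: "(\<lambda>Y. mat_loss (gen_bayes \<pi> N Y) M) \<in> borel_measurable borel" by simp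
  have "mat_risk (gen_bayes \<pi>) N M = (\<integral>Z. F Z \<partial>gauss)"
    unfolding mat_risk_def by (subst integral_lik[OF N0]) (auto simp: loss s[symmetric])
  then have "mat_risk (gen_bayes \<pi>) N M $ i $ j = (\<integral>Z. F Z \<partial>gauss) \<bullet> axis i (axis j 1)"
    by (simp add: inner_axis)
  also have "\<dots> = (\<integral>Z. F Z \<bullet> axis i (axis j 1) \<partial>gauss)"
    by (rule integral_inner_left[symmetric]) (rule Fi)
  also have "\<dots> = (\<integral>Z. (\<Sum>a\<in>UNIV. e (axis a (axis i 1)) Z * e (axis a (axis j 1)) Z) \<partial>gauss)"
    by (simp add: inner_axis F_def)
  also have "\<dots> = (\<Sum>a\<in>UNIV. \<integral>Z. e (axis a (axis i 1)) Z * e (axis a (axis j 1)) Z \<partial>gauss)"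
    unfolding e_def using P.has_integral_risk[OF axis_axis_in_Basis axis_axis_in_Basis s01]
    by (intro Bochner_Integration.integral_sum) (auto simp: has_bochner_integral_iff)
  finally show ?thesis by (simp only: e_def)
qed

text \<open>An entry of the loss matrix sums products over the rows \<open>a\<close>, so the limit
  is a partial trace. The subtracted n / N on the diagonal is the risk of the data
  themselves.\<close>

theorem mat_risk_expansion:
  "((\<lambda>N. N\<^sup>2 * (mat_risk (gen_bayes \<pi>) N M $ i $ j - (if i = j then real CARD('n) else 0) / N))
    \<longlongrightarrow> (\<Sum>a\<in>UNIV. 2 * H (axis a (axis i 1)) (axis a (axis j 1))
         + (u \<bullet> axis a (axis i 1)) * (u \<bullet> axis a (axis j 1)))) at_top"
proof -
  let ?I = "\<lambda>a N. \<integral>Z. (1 / sqrt N * (Z \<bullet> axis a (axis i 1)) + (1 / sqrt N)\<^sup>2 * P.mean_shift (axis a (axis i 1)) (1 / sqrt N) Z)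
        * (1 / sqrt N * (Z \<bullet> axis a (axis j 1)) + (1 / sqrt N)\<^sup>2 * P.mean_shift (axis a (axis j 1)) (1 / sqrt N) Z) \<partial>gauss"
  have "((\<lambda>N. \<Sum>a\<in>UNIV. N\<^sup>2 * (?I a N - ((axis a (axis i 1) :: real^'p^'n) \<bullet> axis a (axis j 1)) / N))
    \<longlongrightarrow> (\<Sum>a\<in>UNIV. 2 * H (axis a (axis i 1)) (axis a (axis j 1))
         + (u \<bullet> axis a (axis i 1)) * (u \<bullet> axis a (axis j 1)))) at_top"
    by (intro tendsto_sum P.risk_expansion axis_axis_in_Basis)
  moreover have "\<forall>\<^sub>F N in at_top. (\<Sum>a\<in>UNIV. N\<^sup>2 * (?I a N - ((axis a (axis i 1) :: real^'p^'n) \<bullet> axis a (axis j 1)) / N))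
     = N\<^sup>2 * (mat_risk (gen_bayes \<pi>) N M $ i $ j - (if i = j then real CARD('n) else 0) / N)"
  proof (rule eventually_at_top_linorderI[of 1])
    fix N :: real assume "1 \<le> N"
    have ax: "(axis a (axis i 1) :: real^'p^'n) \<bullet> axis a (axis j 1) = (if i = j then 1 else 0)" for a :: 'n
      unfolding inner_matrix_axis by (auto simp: axis_def)
    show "(\<Sum>a\<in>UNIV. N\<^sup>2 * (?I a N - ((axis a (axis i 1) :: real^'p^'n) \<bullet> axis a (axis j 1)) / N))
     = N\<^sup>2 * (mat_risk (gen_bayes \<pi>) N M $ i $ j - (if i = j then real CARD('n) else 0) / N)"
      unfolding mat_risk_entry[OF \<open>1 \<le> N\<close> refl] ax sum_distrib_left[symmetric] sum_subtractf by simp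
  qed
  ultimately show ?thesis by (simp only: filterlim_cong)
qed

end

section \<open>The two priors\<close>

text \<open>Used twice: with a scalar matrix for homogeneity, and with elementary column operations
  for the gradient of the logarithm.\<close>

lemma det_gram_mult:
  fixes A :: "real^'p::finite^'n::finite" and E :: "real^'p^'p"
  shows "det (transpose (A ** E) ** (A ** E)) = (det E)\<^sup>2 * det (transpose A ** A)"
proof -
  have "transpose (A ** E) ** (A ** E) = transpose E ** (transpose A ** A) ** E"
    by (simp add: matrix_transpose_mul matrix_mul_assoc)
  then show ?thesis by (simp add: det_mul det_transpose power2_eq_square)
qed

lemma gram_columns_scale:
  fixes A :: "real^'p::finite^'n::finite"
  shows "gram UNIV (\<lambda>i. column i (s *\<^sub>R A)) = s ^ (2 * CARD('p)) * gram UNIV (\<lambda>i. column i A)"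
proof -
  have "s *\<^sub>R A = A ** mat s"
    by (simp add: vec_eq_iff matrix_matrix_mult_def mat_def if_distrib[of "\<lambda>x. _ * x"] cong: if_cong)
  moreover have "det (mat s :: real^'p^'p) = s ^ CARD('p)"
    by (subst det_diagonal) (auto simp: mat_def)
  ultimately show ?thesis unfolding gram_columns by (simp add: det_gram_mult power_mult[symmetric] mult.commute)
qed

lemma norm_column_le: "norm (column i A) \<le> norm (A :: real^'p::finite^'n::finite)"
proof -
  have "(norm (column i A))\<^sup>2 \<le> (norm A)\<^sup>2"
    unfolding norm_matrix_columns by (rule member_le_sum) auto
  then show ?thesis by (rule power2_le_imp_le) simp
qed

text \<open>Here \<open>k\<close> is n - p - 1 as a natural number, and -k / 2 is the exponent of
  the determinant in the SVS prior.\<close>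

context
  fixes k :: nat and \<gamma> :: "'p::finite \<Rightarrow> real" and nn :: "'n::finite itself"
  assumes dims: "CARD('n) = k + CARD('p) + 1" and \<gamma>: "\<And>i. 0 \<le> \<gamma> i \<and> \<gamma> i \<le> real CARD('p)"
begin

lemma pi_MSVS2_gram:
  "pi_MSVS2 \<gamma> (A :: real^'p^'n)
    = gram UNIV (\<lambda>i. column i A) powr (- real k / 2) * (\<Prod>i\<in>UNIV. norm (column i A) powr - \<gamma> i)"
  using dims by (simp add: pi_MSVS2_def pi_SVS_def gram_columns)

lemma pi_MSVS2_le_gram_weight: "ennreal (pi_MSVS2 \<gamma> (A :: real^'p^'n)) \<le> gram_weight k \<gamma> UNIV (\<lambda>i. column i A)"
  by (simp add: gram_weight_def pi_MSVS2_gram)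

text \<open>Homogeneity trades noise of size s for unit noise; its degree is the source of the
  negative power of s in the moment bounds.\<close>

lemma pi_MSVS2_scale:
  assumes s: "0 < s"
  shows "pi_MSVS2 \<gamma> (s *\<^sub>R A :: real^'p^'n) = s powr - (\<Sum>i\<in>UNIV. real k + \<gamma> i) * pi_MSVS2 \<gamma> A"
proof -
  let ?g = "gram UNIV (\<lambda>i. column i A)"
  have col: "column i (s *\<^sub>R A) = s *\<^sub>R column i A" for i by (simp add: column_def vec_eq_iff)
  have 1: "(s ^ (2 * CARD('p)) * ?g) powr (- real k / 2) = s powr - (\<Sum>i\<in>(UNIV :: 'p set). real k) * ?g powr (- real k / 2)"
  proof -
    have "(s ^ (2 * CARD('p))) powr (- real k / 2) = s powr - (\<Sum>i\<in>(UNIV :: 'p set). real k)"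
      using s by (simp add: powr_realpow[symmetric] powr_powr)
    then show ?thesis using s gram_nonneg by (subst powr_mult) auto
  qed
  have 2: "(\<Prod>i\<in>UNIV. norm (s *\<^sub>R column i A) powr - \<gamma> i) = s powr - (\<Sum>i\<in>UNIV. \<gamma> i) * (\<Prod>i\<in>UNIV. norm (column i A) powr - \<gamma> i)"
  proof -
    have "(\<Prod>i\<in>UNIV. norm (s *\<^sub>R column i A) powr - \<gamma> i) = (\<Prod>i\<in>UNIV. s powr - \<gamma> i * norm (column i A) powr - \<gamma> i)"
      using s by (simp add: powr_mult)
    moreover have "s powr - (\<Sum>i\<in>UNIV. \<gamma> i) = (\<Prod>i\<in>UNIV. s powr - \<gamma> i)"
      using s by (simp add: powr_sum[symmetric] sum_negf)
    ultimately show ?thesis by (simp add: prod.distrib)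
  qed
  show ?thesis unfolding pi_MSVS2_gram gram_columns_scale unfolding col 2 1 sum.distrib
    by (simp add: powr_diff powr_minus field_simps del: sum_constant)
qed

lemma pi_MSVS2_measurable: "(pi_MSVS2 \<gamma> :: real^'p^'n \<Rightarrow> real) \<in> borel_measurable borel"
  unfolding pi_MSVS2_gram[abs_def] by measurable

lemma pi_MSVS2_nonneg: "0 \<le> pi_MSVS2 \<gamma> (A :: real^'p^'n)"
  unfolding pi_MSVS2_gram by (intro mult_nonneg_nonneg prod_nonneg) auto

lemma sum_exponents_le: "(\<Sum>i\<in>UNIV. real k + \<gamma> i) \<le> real (CARD('p) * (k + CARD('p)))"
proof -
  have "(\<Sum>i\<in>UNIV. real k + \<gamma> i) \<le> (\<Sum>i\<in>(UNIV :: 'p set). real k + real CARD('p))"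
    using \<gamma> by (intro sum_mono) auto
  then show ?thesis by simp
qed

text \<open>Writing A + s w = s (A / s + w), homogeneity extracts the power of s, and the remaining
  Gaussian integral is centred at A / s. Uniformity of \<open>matrix_gram_weight_bound\<close> in
  the centre absorbs both A and s.\<close>

lemma pi_MSVS2_moments:
  "\<exists>C\<ge>0. \<forall>(A :: real^'p^'n) s. 0 < s \<and> s \<le> 1 \<longrightarrow>
    (\<integral>\<^sup>+w. ennreal ((1 + norm w) ^ q * pi_MSVS2 \<gamma> (A + s *\<^sub>R w)) \<partial>gauss) \<le> ennreal (C / s ^ (CARD('p) * (k + CARD('p))))"
proof -
  let ?K = "CARD('p) * (k + CARD('p))"
  obtain C1 where C1: "0 < C1" "\<And>w::real^'p^'n. gauss_dens w * (1 + norm w) ^ q \<le> C1 * exp (- (norm w)\<^sup>2 / 4)"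
    using gauss_dens_poly_bound[where q=q and 'a="real^'p^'n"] by blast
  from matrix_gram_weight_bound[OF dims \<gamma>] obtain C2 where C2': "0 \<le> C2 \<and> (\<forall>Y :: real^'p^'n. (\<integral>\<^sup>+A. ennreal (exp (- (norm (A - Y))\<^sup>2 / 4))
     * gram_weight k \<gamma> UNIV (\<lambda>i. column i A) \<partial>lborel) \<le> ennreal C2)"
    by (rule exE)
  note C2 = conjunct1[OF C2'] conjunct2[OF C2', rule_format]
  note [measurable] = pi_MSVS2_measurable
  have [measurable]: "(\<lambda>A :: real^'p^'n. gram_weight k \<gamma> UNIV (\<lambda>i. column i A)) \<in> borel_measurable borel"
    unfolding gram_weight_def by measurable
  have "(\<integral>\<^sup>+w. ennreal ((1 + norm w) ^ q * pi_MSVS2 \<gamma> (A + s *\<^sub>R w)) \<partial>gauss) \<le> ennreal (C1 * C2 / s ^ ?K)"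
    if s: "0 < s" "s \<le> 1" for A :: "real^'p^'n" and s
  proof -
    define Y where "Y = (1 / s) *\<^sub>R A"
    let ?f = "\<lambda>B. ennreal (exp (- (norm (B - Y))\<^sup>2 / 4)) * gram_weight k \<gamma> UNIV (\<lambda>i. column i B)"
    have "(\<integral>\<^sup>+w. ennreal ((1 + norm w) ^ q * pi_MSVS2 \<gamma> (A + s *\<^sub>R w)) \<partial>gauss)
      = (\<integral>\<^sup>+w. ennreal (gauss_dens w) * ennreal ((1 + norm w) ^ q * pi_MSVS2 \<gamma> (A + s *\<^sub>R w)) \<partial>lborel)"
      by (rule nn_integral_gauss) measurable
    also have "\<dots> \<le> (\<integral>\<^sup>+w. ennreal (C1 / s ^ ?K) * ?f (Y + w) \<partial>lborel)"
    proof (rule nn_integral_mono)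
      fix w :: "real^'p^'n"
      have "A + s *\<^sub>R w = s *\<^sub>R (Y + w)" using s by (simp add: Y_def scaleR_add_right)
      then have "pi_MSVS2 \<gamma> (A + s *\<^sub>R w) = s powr - (\<Sum>i\<in>UNIV. real k + \<gamma> i) * pi_MSVS2 \<gamma> (Y + w)"
        using pi_MSVS2_scale[OF s(1)] by simp
      \<comment> \<open>For s \<le> 1 a larger exponent only increases the bound; p (k + p) is a
        natural number that dominates the degree for all admissible \<gamma>.\<close>
      also have "\<dots> \<le> s powr - real ?K * pi_MSVS2 \<gamma> (Y + w)"
        using s sum_exponents_le pi_MSVS2_nonneg by (intro mult_right_mono powr_mono') auto
      also have "s powr - real ?K = 1 / s ^ ?K"
        using s by (simp only: powr_minus powr_realpow inverse_eq_divide)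
      finally have le: "pi_MSVS2 \<gamma> (A + s *\<^sub>R w) \<le> 1 / s ^ ?K * pi_MSVS2 \<gamma> (Y + w)" .
      have "ennreal (gauss_dens w) * ennreal ((1 + norm w) ^ q * pi_MSVS2 \<gamma> (A + s *\<^sub>R w))
        = ennreal ((gauss_dens w * (1 + norm w) ^ q) * pi_MSVS2 \<gamma> (A + s *\<^sub>R w))"
        by (subst ennreal_mult[symmetric]) (auto simp: pi_MSVS2_nonneg ac_simps)
      also have "\<dots> \<le> ennreal ((C1 * exp (- (norm w)\<^sup>2 / 4)) * (1 / s ^ ?K * pi_MSVS2 \<gamma> (Y + w)))"
        by (intro ennreal_leI mult_mono[OF C1(2) le]) (use C1(1) pi_MSVS2_nonneg in auto)
      also have "\<dots> = ennreal (C1 / s ^ ?K) * (ennreal (exp (- (norm w)\<^sup>2 / 4)) * ennreal (pi_MSVS2 \<gamma> (Y + w)))"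
        using C1 s by (simp add: ennreal_mult[symmetric] pi_MSVS2_nonneg ac_simps)
      also have "\<dots> \<le> ennreal (C1 / s ^ ?K) * ?f (Y + w)"
        by (intro mult_left_mono) (auto intro!: mult_left_mono pi_MSVS2_le_gram_weight)
      finally show "ennreal (gauss_dens w) * ennreal ((1 + norm w) ^ q * pi_MSVS2 \<gamma> (A + s *\<^sub>R w))
        \<le> ennreal (C1 / s ^ ?K) * ?f (Y + w)" .
    qed
    also have "\<dots> = ennreal (C1 / s ^ ?K) * (\<integral>\<^sup>+w. ?f (Y + w) \<partial>lborel)"
      by (rule nn_integral_cmult) measurable
    also have "(\<integral>\<^sup>+w. ?f (Y + w) \<partial>lborel) = (\<integral>\<^sup>+B. ?f B \<partial>lborel)"
      by (rule nn_integral_lborel_translate) measurable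
    also have "ennreal (C1 / s ^ ?K) * (\<integral>\<^sup>+B. ?f B \<partial>lborel) \<le> ennreal (C1 / s ^ ?K) * ennreal C2"
      by (intro mult_left_mono C2(2)) auto
    also have "\<dots> = ennreal (C1 * C2 / s ^ ?K)" using C1 C2(1) s by (simp add: ennreal_mult[symmetric])
    finally show ?thesis .
  qed
  then show ?thesis using C1 C2(1) by (intro exI[of _ "C1 * C2"]) auto
qed

text \<open>A function with finite integral is finite almost everywhere, and
  \<open>gram_weight\<close> is infinite exactly on singular Gram matrices.\<close>

lemma AE_gram_nonzero: "AE A in (lborel :: (real^'p^'n) measure). gram UNIV (\<lambda>i. column i A) \<noteq> 0"
proof -
  from matrix_gram_weight_bound[OF dims \<gamma>] obtain C where C': "0 \<le> C \<and> (\<forall>Y :: real^'p^'n. (\<integral>\<^sup>+A. ennreal (exp (- (norm (A - Y))\<^sup>2 / 4))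
     * gram_weight k \<gamma> UNIV (\<lambda>i. column i A) \<partial>lborel) \<le> ennreal C)"
    by (rule exE)
  note C = conjunct1[OF C'] conjunct2[OF C', rule_format]
  let ?f = "\<lambda>A :: real^'p^'n. ennreal (exp (- (norm (A - 0))\<^sup>2 / 4)) * gram_weight k \<gamma> UNIV (\<lambda>i. column i A)"
  have "?f \<in> borel_measurable lborel" unfolding gram_weight_def by measurable
  moreover have "integral\<^sup>N lborel ?f \<noteq> \<infinity>" using C(2)[of 0] by (auto simp: top_unique)
  ultimately have "AE A in lborel. ?f A \<noteq> \<infinity>" by (rule nn_integral_PInf_AE)
  then show ?thesis
    by (rule eventually_mono) (auto simp: gram_weight_def ennreal_mult_top)
qed

text \<open>All exponents in the prior are nonpositive, so Hadamard's inequality and the bound of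
  each column by 1 + |A| turn into lower bounds.\<close>

lemma pi_MSVS2_lower:
  "AE A in lborel. 1 / (1 + norm A) ^ (CARD('p) * (k + CARD('p))) \<le> pi_MSVS2 \<gamma> (A :: real^'p^'n)"
  using AE_gram_nonzero
proof (rule eventually_mono)
  fix A :: "real^'p^'n" assume g0: "gram UNIV (\<lambda>i. column i A) \<noteq> 0"
  define a where "a = 1 + norm A"
  let ?p = "CARD('p)"
  have a: "1 \<le> a" by (simp add: a_def)
  have ca: "norm (column i A) \<le> a" for i using norm_column_le[of i A] by (simp add: a_def)
  have gp: "0 < gram UNIV (\<lambda>i. column i A)" using g0 gram_nonneg[of UNIV "\<lambda>i. column i A"] by simp
  have cp: "0 < norm (column i A)" for i using gram_zero_column[of i UNIV "\<lambda>i. column i A"] g0 by auto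
  have "gram UNIV (\<lambda>i. column i A) \<le> (\<Prod>i\<in>UNIV. (norm (column i A))\<^sup>2)" by (rule gram_le)
  also have "\<dots> \<le> (\<Prod>i\<in>(UNIV :: 'p set). a\<^sup>2)" by (intro prod_mono conjI power_mono ca) auto
  also have "\<dots> = a ^ (2 * ?p)" by (simp add: power_mult)
  also have "\<dots> = a powr (2 * real ?p)"
    using a powr_realpow[of a "2 * ?p"] by simp
  finally have "(a powr (2 * real ?p)) powr (- real k / 2) \<le> gram UNIV (\<lambda>i. column i A) powr (- real k / 2)"
    using gp by (intro powr_mono2') auto
  then have 1: "a powr - (real ?p * real k) \<le> gram UNIV (\<lambda>i. column i A) powr (- real k / 2)"
    by (simp add: powr_powr)
  have "(\<Prod>i\<in>(UNIV :: 'p set). a powr - real ?p) \<le> (\<Prod>i\<in>UNIV. norm (column i A) powr - \<gamma> i)"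
  proof (rule prod_mono, intro conjI)
    fix i
    have "a powr - real ?p \<le> a powr - \<gamma> i" using a \<gamma>[of i] by (intro powr_mono) auto
    also have "\<dots> \<le> norm (column i A) powr - \<gamma> i" using cp ca \<gamma>[of i] by (intro powr_mono2') auto
    finally show "a powr - real ?p \<le> norm (column i A) powr - \<gamma> i" .
  qed auto
  also have "(\<Prod>i\<in>(UNIV :: 'p set). a powr - real ?p) = a powr - (real ?p * real ?p)"
    using a powr_realpow[of "a powr - real ?p" ?p] by (simp add: powr_powr)
  finally have 2: "a powr - (real ?p * real ?p) \<le> (\<Prod>i\<in>UNIV. norm (column i A) powr - \<gamma> i)" .
  have "1 / a ^ (?p * (k + ?p)) = a powr - real (?p * (k + ?p))"
    using a by (simp only: powr_minus powr_realpow inverse_eq_divide)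
  also have "\<dots> = a powr - (real ?p * real k) * a powr - (real ?p * real ?p)"
    by (simp add: powr_add[symmetric] algebra_simps)
  also have "\<dots> \<le> pi_MSVS2 \<gamma> A" unfolding pi_MSVS2_gram using 1 2 by (intro mult_mono) auto
  finally show "1 / (1 + norm A) ^ (?p * (k + ?p)) \<le> pi_MSVS2 \<gamma> A" by (simp add: a_def)
qed

lemma pi_MSVS2_taylor_prior:
  assumes "log_taylor2 (pi_MSVS2 \<gamma> :: real^'p^'n \<Rightarrow> real) M u H"
  shows "taylor_prior (pi_MSVS2 \<gamma>) M u H (CARD('p) * (k + CARD('p)))"
  by (rule taylor_prior.intro)
    (rule pi_MSVS2_measurable pi_MSVS2_nonneg pi_MSVS2_moments pi_MSVS2_lower assms)+

end

text \<open>Makes SVS the case \<gamma> = 0 of the general results. At a zero column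
  \<open>0 powr 0\<close> is 0, not 1, but there the determinant factor vanishes on both
  sides.\<close>

lemma pi_MSVS2_zero: "pi_MSVS2 (\<lambda>_. 0) = (pi_SVS :: real^'p::finite^'n::finite \<Rightarrow> real)"
proof
  fix A :: "real^'p^'n"
  show "pi_MSVS2 (\<lambda>_. 0) A = pi_SVS A"
  proof (cases "\<exists>i. column i A = 0")
    case True
    then have "det (transpose A ** A) = 0"
      unfolding gram_columns[symmetric] using gram_zero_column[of _ UNIV "\<lambda>i. column i A"] by blast
    then show ?thesis by (simp add: pi_MSVS2_def pi_SVS_def)
  qed (simp add: pi_MSVS2_def)
qed

text \<open>The determinant is a polynomial in the entries, so an expansion exists. It stays
  abstract: \<open>H\<close> cancels in the comparison, and the required pairings of
  \<open>u\<close> are found by differentiation along lines.\<close>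

lemma log_taylor2_det_gram:
  fixes M :: "real^'p::finite^'n::finite"
  assumes "invertible (transpose M ** M)"
  obtains u H where "log_taylor2 (\<lambda>A. det (transpose A ** A)) M u H"
proof -
  have "det (transpose M ** M) \<noteq> 0" using assms by (simp add: invertible_det_nz)
  then have pos: "0 < det (transpose M ** M)"
    using gram_nonneg[of UNIV "\<lambda>i. column i M"] unfolding gram_columns by simp
  have e: "\<exists>b Q. taylor2 (\<lambda>A :: real^'p^'n. A $ a $ i) M b Q" for a i
    using taylor2_inner[of "axis a (axis i 1)" M] by (auto simp: inner_matrix_axis)
  have m: "\<exists>a Q. taylor2 (\<lambda>A :: real^'p^'n. f A * g A) M a Q"
    if "\<exists>a Q. taylor2 f M a Q" "\<exists>a Q. taylor2 g M a Q" for f g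
    using that taylor2_mult by blast
  have "\<exists>a Q. taylor2 (\<lambda>A :: real^'p^'n. \<Sum>p | p permutes (UNIV :: 'p set).
      of_int (sign p) * (\<Prod>i\<in>UNIV. \<Sum>a\<in>UNIV. A $ a $ i * A $ a $ p i)) M a Q"
    by (intro taylor2_sum_ex taylor2_prod_ex m e) (use taylor2_const in blast)
  then have "\<exists>a Q. taylor2 (\<lambda>A :: real^'p^'n. det (transpose A ** A)) M a Q"
    by (simp add: det_def matrix_matrix_mult_def transpose_def)
  then show ?thesis using taylor2_imp_log_taylor2 pos that by blast
qed

text \<open>Adding \<open>t\<close> times column \<open>j\<close> to column \<open>i\<close> multiplies the Gram determinant by \<open>1\<close>, or by
  \<open>(1 + t)\<^sup>2\<close> if \<open>i = j\<close>; this gives the gradient of its logarithm in all directions that matter.\<close>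
lemma log_det_gram_gradient:
  fixes M :: "real^'p::finite^'n::finite"
  assumes h: "log_taylor2 (\<lambda>A. det (transpose A ** A)) M u H"
  shows "(\<Sum>a\<in>UNIV. u $ a $ i * M $ a $ j) = (if i = j then 2 else 0)"
proof -
  define V :: "real^'p^'n" where "V = (\<chi> a l. if l = i then M $ a $ j else 0)"
  define \<delta> :: real where "\<delta> = (if i = j then 1 else 0)"
  have uV: "u \<bullet> V = (\<Sum>a\<in>UNIV. u $ a $ i * M $ a $ j)"
    by (simp add: V_def inner_vec_def if_distrib[of "\<lambda>x. _ * x"] cong: if_cong)
  define E :: "real \<Rightarrow> real^'p^'p" where
    "E t = (\<chi> k l. (if k = l then 1 else 0) + (if l = i then if k = j then t else 0 else 0))" for t
  have ME: "M + t *\<^sub>R V = M ** E t" for t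
    by (auto simp: vec_eq_iff V_def E_def matrix_matrix_mult_def distrib_left sum.distrib
        if_distrib[of "\<lambda>x. _ * x"] cong: if_cong)
  have detE: "det (E t) = 1 + \<delta> * t" for t
  proof (cases "i = j")
    case True
    have "det (E t) = (\<Prod>k\<in>UNIV. E t $ k $ k)"
      by (rule det_diagonal) (use True in \<open>auto simp: E_def\<close>)
    also have "\<dots> = (\<Prod>k\<in>UNIV. if k = i then 1 + t else 1)"
      using True by (intro prod.cong) (auto simp: E_def)
    finally show ?thesis using True by (simp add: \<delta>_def)
  next
    case False
    \<comment> \<open>Off the diagonal, \<open>E t\<close> is the identity with t times row
      \<open>i\<close> added to row \<open>j\<close>, so its determinant stays 1.\<close>
    have "E t = (\<chi> k. if k = j then row j (mat 1) + t *s row i (mat 1) else row k (mat 1))"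
      by (auto simp: vec_eq_iff E_def row_def mat_def)
    then show ?thesis using False det_row_operation[of j i "mat 1" t] by (simp add: \<delta>_def)
  qed
  have "((\<lambda>t. det (transpose (M + t *\<^sub>R V) ** (M + t *\<^sub>R V))) has_real_derivative
      det (transpose M ** M) * (u \<bullet> V)) (at 0)"
    by (rule log_taylor2_directional_derivative[OF h])
  moreover have "((\<lambda>t. det (transpose (M + t *\<^sub>R V) ** (M + t *\<^sub>R V))) has_real_derivative
      (2 * \<delta>) * det (transpose M ** M)) (at 0)"
    unfolding ME det_gram_mult detE by (auto intro!: derivative_eq_intros)
  ultimately have "det (transpose M ** M) * (u \<bullet> V) = (2 * \<delta>) * det (transpose M ** M)"
    by (rule DERIV_unique)
  moreover have "0 < det (transpose M ** M)" using h by (simp add: log_taylor2_def)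
  ultimately show ?thesis unfolding uV by (simp add: \<delta>_def)
qed

text \<open>The gradient of the logarithm of the squared norm of column \<open>i\<close>.\<close>

definition col_grad :: "'p \<Rightarrow> real^'p::finite^'n::finite \<Rightarrow> real^'p^'n" where
  "col_grad i M = (\<chi> a l. if l = i then 2 / (norm (column i M))\<^sup>2 * M $ a $ i else 0)"

lemma col_grad_inner:
  fixes v :: "real^'p::finite^'n::finite"
  shows "col_grad i M \<bullet> v = 2 / (norm (column i M))\<^sup>2 * (column i M \<bullet> column i v)"
  by (simp add: col_grad_def inner_vec_def column_def if_distrib[of "\<lambda>x. x * _"] sum_distrib_left mult.assoc
      cong: if_cong)

text \<open>The Hessian of the same logarithm: second derivative over value, minus the square of the
  gradient.\<close>

definition col_hess :: "'p \<Rightarrow> real^'p::finite^'n::finite \<Rightarrow> real^'p^'n \<Rightarrow> real^'p^'n \<Rightarrow> real" where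
  "col_hess i M v w = 2 / (norm (column i M))\<^sup>2 * (column i v \<bullet> column i w)
     + - 1 * ((col_grad i M \<bullet> v) * (col_grad i M \<bullet> w))"

text \<open>The squared norm is a quadratic polynomial, so its expansion is exact and the remainder
  vanishes identically.\<close>

lemma log_taylor2_norm_column_square:
  fixes M :: "real^'p::finite^'n::finite"
  assumes "column i M \<noteq> 0"
  shows "log_taylor2 (\<lambda>A. (norm (column i A))\<^sup>2) M (col_grad i M) (col_hess i M)"
proof -
  have add: "column i (v + w) = column i v + column i w" and scale: "column i (c *\<^sub>R v) = c *\<^sub>R column i v"
    for v w :: "real^'p^'n" and c by (auto simp: column_def vec_eq_iff)
  have "bilinear (\<lambda>v w :: real^'p^'n. column i v \<bullet> column i w)"
    unfolding bilinear_def by (auto intro!: linearI simp: add scale inner_add_left inner_add_right)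
  then have "bilinear (col_hess i M)" unfolding col_hess_def
    by (intro bilinear_add bilinear_cmult bilinear_inner_mult)
  moreover have "(norm (column i (M + v)))\<^sup>2 - (norm (column i M))\<^sup>2 *
      (1 + col_grad i M \<bullet> v + (col_hess i M v v + (col_grad i M \<bullet> v)\<^sup>2) / 2) = 0" for v
  proof -
    have "(norm (column i (M + v)))\<^sup>2 = (norm (column i M))\<^sup>2 + 2 * (column i M \<bullet> column i v) + column i v \<bullet> column i v"
      unfolding add power2_norm_eq_inner by (simp add: inner_add_left inner_add_right inner_commute)
    then show ?thesis using assms
      by (simp add: col_hess_def col_grad_inner field_simps power2_eq_square)
  qed
  ultimately show ?thesis using assms
    by (auto simp: log_taylor2_iff col_hess_def inner_commute mult.commute)
qed

lemma log_taylor2_column_factor: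
  fixes M :: "real^'p::finite^'n::finite"
  assumes "\<And>i. column i M \<noteq> 0"
  shows "log_taylor2 (\<lambda>A. \<Prod>i\<in>UNIV. norm (column i A) powr - \<gamma> i) M
    (\<Sum>i\<in>UNIV. (- \<gamma> i / 2) *\<^sub>R col_grad i M) (\<lambda>v w. \<Sum>i\<in>UNIV. (- \<gamma> i / 2) * col_hess i M v w)"
proof -
  \<comment> \<open>Passing to squared norms makes the base a polynomial; the identity also holds at
    0, where both powers are 0.\<close>
  have sq: "x powr - g = (x\<^sup>2) powr (- g / 2)" if "0 \<le> x" for x g :: real
    using that by (cases "x = 0") (auto simp: powr_powr simp flip: powr_numeral)
  show ?thesis unfolding sq[OF norm_ge_zero]
    by (intro log_taylor2_prod log_taylor2_powr log_taylor2_norm_column_square assms) auto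
qed

section \<open>The risk comparison\<close>

lemma col_grad_nth: "col_grad l M $ a $ i = (if i = l then 2 / (norm (column i M))\<^sup>2 * M $ a $ i else 0)"
  by (simp add: col_grad_def)

lemma column_axis_axis: "column l (axis a (axis i (1::real)) :: real^'p::finite^'n::finite) = (if l = i then axis a 1 else 0)"
  by (auto simp: column_def axis_def vec_eq_iff)

lemma col_hess_axis:
  fixes M :: "real^'p::finite^'n::finite"
  shows "col_hess l M (axis a (axis i 1)) (axis a (axis j 1))
    = (if i = l \<and> j = l then 2 / (norm (column l M))\<^sup>2 - (2 / (norm (column l M))\<^sup>2 * M $ a $ l)\<^sup>2 else 0)"
  unfolding col_hess_def inner_matrix_axis col_grad_nth column_axis_axis by (auto simp: power2_eq_square inner_axis)

lemma sum_column_squares: "(\<Sum>a\<in>UNIV. (M $ a $ i)\<^sup>2) = (norm (column i M))\<^sup>2"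
  for M :: "real^'p::finite^'n::finite"
  unfolding power2_norm_eq_inner by (simp add: inner_vec_def column_def power2_eq_square)

text \<open>Summing \<open>col_hess\<close> over the n rows gives (2 n - 4) / |M_i|^2 on the
  diagonal, the -4 stemming from the squared gradient; with the weight -\<gamma>_i this is -2 (n -
  2) D. Each mixed term is k D by \<open>grad\<close>, and w = -M D contributes the quadratic
  term.\<close>

lemma risk_difference_limit:
  fixes M u :: "real^'p::finite^'n::finite" and \<gamma> :: "'p \<Rightarrow> real" and k :: nat
  assumes col: "\<And>i. column i M \<noteq> 0"
    and grad: "\<And>i j. (\<Sum>a\<in>UNIV. u $ a $ i * M $ a $ j) = (if i = j then 2 else 0)"
  defines "w \<equiv> (\<Sum>l\<in>UNIV. (- \<gamma> l / 2) *\<^sub>R col_grad l M)"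
    and "v \<equiv> (- real k / 2) *\<^sub>R u"
  shows "(\<Sum>a\<in>UNIV. 2 * (\<Sum>l\<in>UNIV. (- \<gamma> l / 2) * col_hess l M (axis a (axis i 1)) (axis a (axis j 1)))
        + (v $ a $ i * w $ a $ j + w $ a $ i * v $ a $ j + w $ a $ i * w $ a $ j))
     = (- 2 * (real CARD('n) - 2 - real k)) * (diagD \<gamma> M $ i $ j) + (diagD \<gamma> M ** (transpose M ** M) ** diagD \<gamma> M) $ i $ j"
proof -
  define m where "m i = (norm (column i M))\<^sup>2" for i
  have m: "0 < m i" for i using col by (simp add: m_def)
  define d where "d i = \<gamma> i / m i" for i
  have w: "w $ a $ i = - d i * M $ a $ i" for a i
  proof -
    have "w $ a $ i = (\<Sum>l\<in>UNIV. if l = i then - \<gamma> i / 2 * (2 / m i * M $ a $ i) else 0)"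
      unfolding w_def sum_component vector_scaleR_component col_grad_nth m_def by (intro sum.cong) auto
    then show ?thesis by (simp add: d_def)
  qed
  have hess: "(\<Sum>a\<in>UNIV. 2 * (\<Sum>l\<in>UNIV. (- \<gamma> l / 2) * col_hess l M (axis a (axis i 1)) (axis a (axis j 1))))
      = (if i = j then - 2 * (real CARD('n) - 2) * d i else 0)"
  proof (cases "i = j")
    case True
    have "(\<Sum>a\<in>UNIV. 2 * (\<Sum>l\<in>UNIV. (- \<gamma> l / 2) * col_hess l M (axis a (axis i 1)) (axis a (axis j 1))))
      = (\<Sum>a\<in>UNIV. 2 * (\<Sum>l\<in>UNIV. if l = i then (- \<gamma> i / 2) * (2 / m i - (2 / m i * M $ a $ i)\<^sup>2) else 0))"
      unfolding True col_hess_axis m_def by (intro sum.cong arg_cong[where f="\<lambda>x. 2 * x"]) auto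
    also have "\<dots> = (\<Sum>a\<in>UNIV. - 2 * d i + 4 * d i / m i * (M $ a $ i)\<^sup>2)"
      by (intro sum.cong) (auto simp: d_def power_mult_distrib power_divide power2_eq_square field_simps)
    also have "\<dots> = - 2 * d i * real CARD('n) + 4 * d i / m i * (\<Sum>a\<in>UNIV. (M $ a $ i)\<^sup>2)"
      unfolding sum.distrib sum_distrib_left by simp
    also have "(\<Sum>a\<in>UNIV. (M $ a $ i)\<^sup>2) = m i" unfolding m_def by (rule sum_column_squares)
    finally show ?thesis using m[of i] True by (simp add: algebra_simps)
  next
    case False
    then have "\<And>l a. col_hess l M (axis a (axis i 1)) (axis a (axis j 1)) = 0" by (auto simp: col_hess_axis)
    then show ?thesis using False by simp
  qed
  have cross: "(\<Sum>a\<in>UNIV. v $ a $ i * w $ a $ j) = (if i = j then real k * d j else 0)" for i j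
  proof -
    have "(\<Sum>a\<in>UNIV. v $ a $ i * w $ a $ j) = (real k / 2 * d j) * (\<Sum>a\<in>UNIV. u $ a $ i * M $ a $ j)"
      unfolding w v_def sum_distrib_left by (intro sum.cong) auto
    then show ?thesis unfolding grad by (cases "i = j") auto
  qed
  have cross': "(\<Sum>a\<in>UNIV. w $ a $ i * v $ a $ j) = (if i = j then real k * d i else 0)"
    using cross[of j i] by (auto simp: mult.commute)
  have ww: "(\<Sum>a\<in>UNIV. w $ a $ i * w $ a $ j) = d i * (transpose M ** M) $ i $ j * d j"
    unfolding w by (simp add: matrix_matrix_mult_def transpose_def sum_distrib_left sum_distrib_right ac_simps)
  have D: "diagD \<gamma> M $ i $ j = (if i = j then d i else 0)" for i j
    by (simp add: diagD_def d_def m_def)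
  have mm: "(A ** B) $ i $ j = (\<Sum>h\<in>UNIV. A $ i $ h * B $ h $ j)" for A B :: "real^'p^'p" and i j
    by (simp add: matrix_matrix_mult_def)
  have "(diagD \<gamma> M ** (transpose M ** M)) $ i $ l = d i * (transpose M ** M) $ i $ l" for l
  proof -
    have "(diagD \<gamma> M ** (transpose M ** M)) $ i $ l = (\<Sum>h\<in>UNIV. if h = i then d i * (transpose M ** M) $ h $ l else 0)"
      unfolding mm[of "diagD \<gamma> M"] D by (intro sum.cong) auto
    then show ?thesis by simp
  qed
  moreover have "(B ** diagD \<gamma> M) $ i $ j = B $ i $ j * d j" for B :: "real^'p^'p"
  proof -
    have "(B ** diagD \<gamma> M) $ i $ j = (\<Sum>h\<in>UNIV. if h = j then B $ i $ j * d j else 0)"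
      unfolding mm D by (intro sum.cong) auto
    then show ?thesis by simp
  qed
  ultimately have DGD: "(diagD \<gamma> M ** (transpose M ** M) ** diagD \<gamma> M) $ i $ j = d i * (transpose M ** M) $ i $ j * d j"
    by simp
  show ?thesis unfolding sum.distrib hess cross cross' ww DGD D by (auto simp: algebra_simps)
qed

text \<open>With t_i = |x_i| / |M_i| the linear term is -2 (p - 1) c times the sum of t_i^2, and the
  quadratic term |M D x|^2 is at most c^2 p times the same sum. The condition on c says exactly c p
  < 2 (p - 1).\<close>

lemma limit_neg_definite:
  fixes M :: "real^'p::finite^'n::finite" and \<gamma> :: "'p \<Rightarrow> real"
  assumes col: "\<And>i. column i M \<noteq> 0" and c: "0 < c" "c < 2 - 2 / real CARD('p)" and \<gamma>: "\<And>i. \<gamma> i = c"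
  shows "neg_definite ((- 2 * (real CARD('p) - 1)) *\<^sub>R diagD \<gamma> M + diagD \<gamma> M ** (transpose M ** M) ** diagD \<gamma> M)"
  unfolding neg_definite_def
proof (intro allI impI)
  fix x :: "real^'p" assume x: "x \<noteq> 0"
  let ?D = "diagD \<gamma> M" and ?p = "real CARD('p)"
  define r where "r i = norm (column i M)" for i
  have r: "0 < r i" for i using col by (simp add: r_def)
  define t where "t i = \<bar>x $ i\<bar> / r i" for i
  have Dx: "(?D *v z) $ i = c / (r i)\<^sup>2 * z $ i" for z i
    by (simp add: diagD_def matrix_vector_mult_def \<gamma> r_def if_distrib[of "\<lambda>y. y * _"] cong: if_cong)
  have Dsym: "x \<bullet> (?D *v z) = (?D *v x) \<bullet> z" for z
    by (simp add: inner_vec_def Dx ac_simps)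
  have quad: "x \<bullet> (?D *v x) = c * (\<Sum>i\<in>UNIV. (t i)\<^sup>2)"
    by (simp add: inner_vec_def Dx t_def sum_distrib_left power_divide power2_eq_square ac_simps)
  have "x \<bullet> ((?D ** (transpose M ** M) ** ?D) *v x) = (?D *v x) \<bullet> (transpose M *v (M *v (?D *v x)))"
    by (simp add: matrix_vector_mul_assoc[symmetric] Dsym del: transpose_matrix_vector)
  also have "\<dots> = (norm (M *v (?D *v x)))\<^sup>2"
    unfolding power2_norm_eq_inner by (simp add: dot_lmul_matrix[symmetric] del: transpose_matrix_vector)
  also have "norm (M *v (?D *v x)) \<le> (\<Sum>i\<in>UNIV. c * t i)"
  proof -
    have "norm (M *v (?D *v x)) \<le> (\<Sum>i\<in>UNIV. norm ((?D *v x) $ i *s column i M))"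
      unfolding matrix_mult_sum by (rule norm_sum)
    also have "\<dots> = (\<Sum>i\<in>UNIV. c * t i)"
    proof (rule sum.cong[OF refl])
      fix i
      have "norm ((?D *v x) $ i *s column i M) = \<bar>c / (r i)\<^sup>2 * x $ i\<bar> * r i"
        by (simp add: scalar_mult_eq_scaleR Dx r_def)
      also have "\<dots> = c * t i" using r[of i] c by (simp add: t_def abs_mult power2_eq_square)
      finally show "norm ((?D *v x) $ i *s column i M) = c * t i" .
    qed
    finally show ?thesis .
  qed
  then have "(norm (M *v (?D *v x)))\<^sup>2 \<le> (\<Sum>i\<in>UNIV. c * t i)\<^sup>2" by (intro power_mono) auto
  \<comment> \<open>Cauchy-Schwarz over the p columns; this is where the factor p in the threshold
    arises.\<close>
  also have "(\<Sum>i\<in>UNIV. c * t i)\<^sup>2 \<le> (\<Sum>i\<in>UNIV. (c * t i)\<^sup>2) * ?p" by (rule sum_squared_le_sum_of_squares)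
  also have "\<dots> = c * c * ?p * (\<Sum>i\<in>UNIV. (t i)\<^sup>2)"
    by (simp add: power_mult_distrib sum_distrib_left[symmetric]) (simp add: power2_eq_square)
  finally have quad2: "x \<bullet> ((?D ** (transpose M ** M) ** ?D) *v x) \<le> c * c * ?p * (\<Sum>i\<in>UNIV. (t i)\<^sup>2)" .
  obtain i where "x $ i \<noteq> 0" using x by (auto simp: vec_eq_iff)
  then have "0 < t i" using r[of i] by (simp add: t_def)
  then have T: "0 < (\<Sum>i\<in>UNIV. (t i)\<^sup>2)" by (intro sum_pos2[of _ i]) auto
  have "c * ?p < 2 * (?p - 1)" using c(2) by (simp add: field_simps)
  then have "c * (c * ?p - 2 * (?p - 1)) * (\<Sum>i\<in>UNIV. (t i)\<^sup>2) < 0"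
    using c(1) T by (intro mult_neg_pos mult_pos_neg) auto
  moreover have "x \<bullet> (((- 2 * (?p - 1)) *\<^sub>R ?D + ?D ** (transpose M ** M) ** ?D) *v x)
      = (- 2 * (?p - 1)) * (x \<bullet> (?D *v x)) + x \<bullet> ((?D ** (transpose M ** M) ** ?D) *v x)"
    by (simp add: matrix_vector_mult_add_rdistrib inner_add_right scaleR_matrix_vector_assoc[symmetric])
  ultimately show "x \<bullet> (((- 2 * (?p - 1)) *\<^sub>R ?D + ?D ** (transpose M ** M) ** ?D) *v x) < 0"
    using quad quad2 by (simp add: algebra_simps)
qed

theorem theorem6:
  fixes \<gamma> :: "'p::finite \<Rightarrow> real" and M :: "real^'p^'n::finite"
  assumes "real CARD('n) - real CARD('p) - 1 > 0"
    and "\<And>i. 0 \<le> \<gamma> i \<and> \<gamma> i \<le> real CARD('p)"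
    and "invertible (transpose M ** M)"
  shows "((\<lambda>N. N\<^sup>2 *\<^sub>R (mat_risk (gen_bayes (pi_MSVS2 \<gamma>)) N M - mat_risk (gen_bayes pi_SVS) N M))
           \<longlongrightarrow> ((- 2 * (real CARD('p) - 1)) *\<^sub>R diagD \<gamma> M
                + diagD \<gamma> M ** (transpose M ** M) ** diagD \<gamma> M)) at_top
       \<and> ((CARD('p) \<ge> 2 \<and> (\<exists>c. 0 < c \<and> c < 2 - 2 / real CARD('p) \<and> (\<forall>i. \<gamma> i = c)))
          \<longrightarrow> neg_definite ((- 2 * (real CARD('p) - 1)) *\<^sub>R diagD \<gamma> M
                + diagD \<gamma> M ** (transpose M ** M) ** diagD \<gamma> M))"
proof -
  \<comment> \<open>Truncated subtraction is exact here since n > p + 1.\<close>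
  define k where "k = CARD('n) - CARD('p) - 1"
  have dims: "CARD('n) = k + CARD('p) + 1" using assms(1) unfolding k_def by linarith
  have "det (transpose M ** M) \<noteq> 0" using assms(3) by (simp add: invertible_det_nz)
  then have col: "column i M \<noteq> 0" for i
    using gram_zero_column[of i UNIV "\<lambda>i. column i M"] unfolding gram_columns by auto
  obtain u0 H0 where h0: "log_taylor2 (\<lambda>A :: real^'p^'n. det (transpose A ** A)) M u0 H0"
    using log_taylor2_det_gram[OF assms(3)] by blast
  define u1 where "u1 = (- real k / 2) *\<^sub>R u0"
  define H1 where "H1 = (\<lambda>v w. - real k / 2 * H0 v w)"
  define w where "w = (\<Sum>i\<in>UNIV. (- \<gamma> i / 2) *\<^sub>R col_grad i M)"
  define Hw where "Hw = (\<lambda>x y. \<Sum>i\<in>UNIV. (- \<gamma> i / 2) * col_hess i M x y)"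
  have "(pi_SVS :: real^'p^'n \<Rightarrow> real) = (\<lambda>A. det (transpose A ** A) powr (- real k / 2))"
    using dims by (simp add: pi_SVS_def fun_eq_iff)
  then have h1: "log_taylor2 (pi_SVS :: real^'p^'n \<Rightarrow> real) M u1 H1"
    using log_taylor2_powr[OF h0, of "- real k / 2"] by (simp add: u1_def H1_def)
  have "log_taylor2 (\<lambda>A. pi_SVS A * (\<Prod>i\<in>UNIV. norm (column i A) powr - \<gamma> i)) M (u1 + w) (\<lambda>x y. H1 x y + Hw x y)"
    unfolding w_def Hw_def by (intro log_taylor2_mult h1 log_taylor2_column_factor col)
  moreover have "(pi_MSVS2 \<gamma> :: real^'p^'n \<Rightarrow> real) = (\<lambda>A. pi_SVS A * (\<Prod>i\<in>UNIV. norm (column i A) powr - \<gamma> i))"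
    by (simp add: pi_MSVS2_def fun_eq_iff)
  ultimately have h2: "log_taylor2 (pi_MSVS2 \<gamma>) M (u1 + w) (\<lambda>x y. H1 x y + Hw x y)" by simp
  have P1: "taylor_prior pi_SVS M u1 H1 (CARD('p) * (k + CARD('p)))"
    using pi_MSVS2_taylor_prior[OF dims, of "\<lambda>_. 0" M u1 H1] h1 unfolding pi_MSVS2_zero by simp
  have P2: "taylor_prior (pi_MSVS2 \<gamma>) M (u1 + w) (\<lambda>x y. H1 x y + Hw x y) (CARD('p) * (k + CARD('p)))"
    by (rule pi_MSVS2_taylor_prior[OF dims assms(2) h2])
  let ?L = "(- 2 * (real CARD('p) - 1)) *\<^sub>R diagD \<gamma> M + diagD \<gamma> M ** (transpose M ** M) ** diagD \<gamma> M"
  have "((\<lambda>N. N\<^sup>2 *\<^sub>R (mat_risk (gen_bayes (pi_MSVS2 \<gamma>)) N M - mat_risk (gen_bayes pi_SVS) N M)) \<longlongrightarrow> ?L) at_top"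
  proof (rule vec_tendstoI, rule vec_tendstoI)
    fix i j
    let ?b = "\<lambda>a. axis a (axis i 1) :: real^'p^'n" and ?c = "\<lambda>a. axis a (axis j 1) :: real^'p^'n"
    \<comment> \<open>The terms built from \<open>H1\<close> and from \<open>u1\<close> alone
      cancel; the Hessian of the column factor, the mixed terms and the square of \<open>w\<close>
      remain.\<close>
    have "(\<Sum>a\<in>UNIV. 2 * (H1 (?b a) (?c a) + Hw (?b a) (?c a)) + ((u1 + w) \<bullet> ?b a) * ((u1 + w) \<bullet> ?c a))
        - (\<Sum>a\<in>UNIV. 2 * H1 (?b a) (?c a) + (u1 \<bullet> ?b a) * (u1 \<bullet> ?c a))
      = (\<Sum>a\<in>UNIV. 2 * Hw (?b a) (?c a) + (u1 $ a $ i * w $ a $ j + w $ a $ i * u1 $ a $ j + w $ a $ i * w $ a $ j))"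
      unfolding sum_subtractf[symmetric] inner_matrix_axis by (intro sum.cong) (auto simp: algebra_simps)
    also have "\<dots> = (- 2 * (real CARD('n) - 2 - real k)) * (diagD \<gamma> M $ i $ j)
        + (diagD \<gamma> M ** (transpose M ** M) ** diagD \<gamma> M) $ i $ j"
      unfolding Hw_def w_def u1_def
      by (rule risk_difference_limit) (use col log_det_gram_gradient[OF h0] in auto)
    also have "\<dots> = ?L $ i $ j" using dims by simp
    finally have L: "(\<Sum>a\<in>UNIV. 2 * (H1 (?b a) (?c a) + Hw (?b a) (?c a)) + ((u1 + w) \<bullet> ?b a) * ((u1 + w) \<bullet> ?c a))
        - (\<Sum>a\<in>UNIV. 2 * H1 (?b a) (?c a) + (u1 \<bullet> ?b a) * (u1 \<bullet> ?c a)) = ?L $ i $ j" .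
    \<comment> \<open>Both risks are compared with the same n / N on the diagonal, so this
      correction drops out of the difference.\<close>
    have "((\<lambda>N. N\<^sup>2 * (mat_risk (gen_bayes (pi_MSVS2 \<gamma>)) N M $ i $ j - (if i = j then real CARD('n) else 0) / N)
         - N\<^sup>2 * (mat_risk (gen_bayes pi_SVS) N M $ i $ j - (if i = j then real CARD('n) else 0) / N)) \<longlongrightarrow> ?L $ i $ j) at_top"
      unfolding L[symmetric] by (intro tendsto_diff mat_risk_expansion[OF P1] mat_risk_expansion[OF P2])
    then show "((\<lambda>N. (N\<^sup>2 *\<^sub>R (mat_risk (gen_bayes (pi_MSVS2 \<gamma>)) N M - mat_risk (gen_bayes pi_SVS) N M)) $ i $ j)
        \<longlongrightarrow> ?L $ i $ j) at_top"
      by (simp add: algebra_simps)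
  qed
  moreover have "neg_definite ?L" if "\<exists>c. 0 < c \<and> c < 2 - 2 / real CARD('p) \<and> (\<forall>i. \<gamma> i = c)"
    using that limit_neg_definite[OF col] by blast
  ultimately show ?thesis by blast
qed

end
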